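(* Let $n\ge 2$. Consider the $\mathbb{Q}$-vector space $\mathrm{Dend}(n-1)$, i.e. the arity $n-1$ component of the dendriform operad, as a module over the cyclic group $C_n$ of order $n$, the generator of $C_n$ acting by the operator $\tau$ of the anticyclic structure on $\mathrm{Dend}$. Then the character of the $C_n$-module $\mathrm{Dend}(n-1)$ is $$2\,\mathbf{c}_{n-1}\,\chi_{n,n}-\sum_{d\mid n}\mathbf{a}_d\,\chi_{n,d},$$ and the characteristic polynomial (in the variable $x$) of the generator of $C_n$ acting on $\mathrm{Dend}(n-1)$, i.e. of $\tau$, is $$\frac{(x^{n}-1)^{2\mathbf{c}_{n-1}}}{\prod_{d\mid n}(x^d-1)^{\mathbf{a}_d}}.$$
   Context: **Numbers.** $\mathbf{c}_m=\frac{1}{m+1}\binom{2m}{m}$ is the Catalan number. For $m\ge1$, $\mathbf{a}_m=\frac{1}{2m}\sum_{d\mid m}\mu(m/d)\binom{2d}{d}$, where $\mu$ is the Möbius function; these are positive integers ($1,1,3,8,25,75,245,\dots$). **Characters.** Let $t$ be a generator of $C_n$. For $d\mid n$, $M_{n,d}=\mathbb{Q}[t]/(t^d-1)$ is a $C_n$-module ($t$ acting by multiplication by $t$), and $\chi_{n,d}$ is its character: $\chi_{n,d}(t^k)=d$ if $d\mid k$ and $0$ otherwise. **The dendriform operad.** $\mathrm{Dend}$ is the nonsymmetric operad in $\mathbb{Q}$-vector spaces (components $\mathrm{Dend}(m)$, $m\ge1$, unit $1\in \mathrm{Dend}(1)$, partial compositions $x\circ_i y\in\mathrm{Dend}(p+q-1)$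 for $x\in \mathrm{Dend}(p)$, $y\in\mathrm{Dend}(q)$, $1\le i\le p$) generated by two elements $\prec,\succ$ of $\mathrm{Dend}(2)$ subject to the relations $$\prec\circ_1\prec\;=\;\prec\circ_2(\prec+\succ),\qquad \prec\circ_1\succ\;=\;\succ\circ_2\prec,\qquad \succ\circ_1(\prec+\succ)\;=\;\succ\circ_2\succ,$$ i.e. $(a\prec b)\prec c=a\prec(b\prec c+b\succ c)$, $(a\succ b)\prec c=a\succ(b\prec c)$, $(a\prec b+a\succ b)\succ c=a\succ(b\succ c)$. The space $\mathrm{Dend}(m)$ has a basis indexed by planar binary trees with $m$ internal vertices, so its dimension is $\mathbf{c}_m$. **The cyclic action.** The anticyclic structure on $\mathrm{Dend}$ is the unique family of linear maps $\tau:\mathrm{Dend}(m)\to\mathrm{Dend}(m)$, $m\ge1$, such that $\tau(1)=-1$, $\tau(\prec)=\succ$, $\tau(\succ)=-(\prec+\succ)$, and for all $x\in\mathrm{Dend}(p)$, $y\in\mathrm{Dend}(q)$: $$\tau(x\circ_i y)=\tau(x)\circ_{i+1}y\quad(1\le i\le p-1),\qquad \tau(x\circ_p y)=-\,\tau(y)\circ_1\tau(x).$$ It is known that these maps are well defined and that $\tau^{m+1}=\mathrm{id}$ on $\mathrm{Dend}(m)$; hence $\tau$ defines an action of $C_n$ on $\mathrm{Dend}(n-1)$ for $n\ge2$. (The opposite rotation convention replaces $\tau$ by $\tau^{-1}$, which affects neither the character nor the characteristic polynomial.) *)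

theory Defs
  imports
    "HOL-Library.Poly_Mapping"
    "HOL-Computational_Algebra.Computational_Algebra"
    "Jordan_Normal_Form.Char_Poly"
begin

section \<open>Traces and characteristic polynomials of operators on a subspace\<close>

text \<open>
  Here \<open>f\<close> is an operator that maps the finite-dimensional subspace \<open>V\<close> to
  itself. Column \<open>j\<close> of the matrix holds the coordinates of the image of the \<open>j\<close>-th basis
  vector. Trace and characteristic polynomial do not depend on the basis chosen by \<open>SOME\<close>.
\<close>

definition ordered_basis ::
    "('a::field \<Rightarrow> 'b::ab_group_add \<Rightarrow> 'b) \<Rightarrow> 'b set \<Rightarrow> 'b list \<Rightarrow> bool" where
  "ordered_basis scale V bs \<longleftrightarrow>
     distinct bs \<and> \<not> module.dependent scale (set bs) \<and> module.span scale (set bs) = V"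

definition endo_matrix ::
    "('a::field \<Rightarrow> 'b::ab_group_add \<Rightarrow> 'b) \<Rightarrow> 'b list \<Rightarrow> ('b \<Rightarrow> 'b) \<Rightarrow> 'a mat" where
  "endo_matrix scale bs f =
     mat (length bs) (length bs)
       (\<lambda>(i, j). module.representation scale (set bs) (f (bs ! j)) (bs ! i))"

definition trace_on ::
    "('a::field \<Rightarrow> 'b::ab_group_add \<Rightarrow> 'b) \<Rightarrow> 'b set \<Rightarrow> ('b \<Rightarrow> 'b) \<Rightarrow> 'a" where
  "trace_on scale V f =
     sum_list (diag_mat (endo_matrix scale (SOME bs. ordered_basis scale V bs) f))"

definition charpoly_on ::
    "('a::field \<Rightarrow> 'b::ab_group_add \<Rightarrow> 'b) \<Rightarrow> 'b set \<Rightarrow> ('b \<Rightarrow> 'b) \<Rightarrow> 'a poly" where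
  "charpoly_on scale V f =
     char_poly (endo_matrix scale (SOME bs. ordered_basis scale V bs) f)"


section \<open>The free nonsymmetric operad on two binary generators\<close>

datatype dgen = GPrec | GSucc

text \<open>
  Tree monomials: planar binary trees whose internal vertices carry a generator. The arity is
  the number of leaves, and leaves are numbered from 1, from left to right.
\<close>

datatype dtree = Leaf | Node dgen dtree dtree

fun arity :: "dtree \<Rightarrow> nat" where
  "arity Leaf = 1"
| "arity (Node g l r) = arity l + arity r"

text \<open>\<open>graft s i t\<close> plugs \<open>t\<close> into the \<open>i\<close>-th leaf of \<open>s\<close>; it is used for \<open>1 \<le> i \<le> arity s\<close> only.\<close>

fun graft :: "dtree \<Rightarrow> nat \<Rightarrow> dtree \<Rightarrow> dtree" where
  "graft Leaf i t = t"
| "graft (Node g l r) i t =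
     (if i \<le> arity l then Node g (graft l i t) r else Node g l (graft r (i - arity l) t))"

text \<open>
  The type \<open>dtree \<Rightarrow>\<^sub>0 rat\<close> is the direct sum over all arities \<open>m \<ge> 1\<close> of the components of the
  free operad.
\<close>

definition free_component :: "nat \<Rightarrow> (dtree \<Rightarrow>\<^sub>0 rat) set" where
  "free_component m = {x. \<forall>t \<in> Poly_Mapping.keys x. arity t = m}"

definition free_scale :: "rat \<Rightarrow> (dtree \<Rightarrow>\<^sub>0 rat) \<Rightarrow> (dtree \<Rightarrow>\<^sub>0 rat)" where
  "free_scale c x = Poly_Mapping.map ((*) c) x"

text \<open>
  The partial composition \<open>x \<circ>\<^sub>i y\<close>, made total on the direct sum by letting it vanish on the
  components of \<open>x\<close> of arity \<open>p\<close> when \<open>i\<close> is not in \<open>{1..p}\<close>.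
\<close>

definition free_comp :: "nat \<Rightarrow> (dtree \<Rightarrow>\<^sub>0 rat) \<Rightarrow> (dtree \<Rightarrow>\<^sub>0 rat) \<Rightarrow> (dtree \<Rightarrow>\<^sub>0 rat)" where
  "free_comp i x y =
     (\<Sum>s \<in> Poly_Mapping.keys x. \<Sum>t \<in> Poly_Mapping.keys y.
        if 1 \<le> i \<and> i \<le> arity s
        then Poly_Mapping.single (graft s i t) (Poly_Mapping.lookup x s * Poly_Mapping.lookup y t) else 0)"

definition free_gen :: "dgen \<Rightarrow> (dtree \<Rightarrow>\<^sub>0 rat)" where
  "free_gen g = Poly_Mapping.single (Node g Leaf Leaf) 1"

lemma lookup_free_scale: "Poly_Mapping.lookup (free_scale c x) k = c * Poly_Mapping.lookup x k"
  by (simp add: free_scale_def Poly_Mapping.map.rep_eq when_def)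

lemma free_scale_simps:
  "free_scale c (x + y) = free_scale c x + free_scale c y"
  "free_scale c (x - y) = free_scale c x - free_scale c y"
  "free_scale (c + d) x = free_scale c x + free_scale d x"
  "free_scale c (free_scale d x) = free_scale (c * d) x"
  "free_scale 1 x = x"
  "free_scale (- 1) x = - x"
  by (auto intro!: poly_mapping_eqI simp: lookup_free_scale lookup_add lookup_minus algebra_simps)

lemma free_comp_superset:
  assumes "finite A" "finite B" "Poly_Mapping.keys x \<subseteq> A" "Poly_Mapping.keys y \<subseteq> B"
  shows "free_comp i x y =
     (\<Sum>s \<in> A. \<Sum>t \<in> B.
        if 1 \<le> i \<and> i \<le> arity s
        then Poly_Mapping.single (graft s i t) (Poly_Mapping.lookup x s * Poly_Mapping.lookup y t) else 0)"
proof -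
  have "free_comp i x y = (\<Sum>s \<in> Poly_Mapping.keys x. \<Sum>t \<in> B.
        if 1 \<le> i \<and> i \<le> arity s
        then Poly_Mapping.single (graft s i t) (Poly_Mapping.lookup x s * Poly_Mapping.lookup y t) else 0)"
    unfolding free_comp_def using assms
    by (intro sum.cong refl sum.mono_neutral_left) (auto simp: in_keys_iff)
  also have "\<dots> = (\<Sum>s \<in> A. \<Sum>t \<in> B.
        if 1 \<le> i \<and> i \<le> arity s
        then Poly_Mapping.single (graft s i t) (Poly_Mapping.lookup x s * Poly_Mapping.lookup y t) else 0)"
    using assms by (intro sum.mono_neutral_left) (auto simp: in_keys_iff intro!: sum.neutral)
  finally show ?thesis .
qed

lemma free_comp_diff_left: "free_comp i (x - x') y = free_comp i x y - free_comp i x' y"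
proof -
  have fin: "finite (Poly_Mapping.keys x \<union> Poly_Mapping.keys x' \<union> Poly_Mapping.keys (x - x'))" "finite (Poly_Mapping.keys y)" by auto
  show ?thesis
    by (subst (1 2 3) free_comp_superset[OF fin])
       (auto simp: lookup_minus left_diff_distrib single_diff
             simp flip: sum_subtractf intro!: sum.cong)
qed

lemma free_comp_diff_right: "free_comp i x (y - y') = free_comp i x y - free_comp i x y'"
proof -
  have fin: "finite (Poly_Mapping.keys x)" "finite (Poly_Mapping.keys y \<union> Poly_Mapping.keys y' \<union> Poly_Mapping.keys (y - y'))" by auto
  show ?thesis
    by (subst (1 2 3) free_comp_superset[OF fin])
       (auto simp: lookup_minus right_diff_distrib single_diff
             simp flip: sum_subtractf intro!: sum.cong)
qed


section \<open>The dendriform operad\<close>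

text \<open>
  The operadic ideal generated by the three relations. Closure under composition with arbitrary,
  not necessarily homogeneous, elements gives the same ideal, because the relators are
  homogeneous and the composition is bilinear and graded.
\<close>

inductive_set dend_ideal :: "(dtree \<Rightarrow>\<^sub>0 rat) set" where
  rel1: "free_comp 1 (free_gen GPrec) (free_gen GPrec)
         - free_comp 2 (free_gen GPrec) (free_gen GPrec + free_gen GSucc) \<in> dend_ideal"
| rel2: "free_comp 1 (free_gen GPrec) (free_gen GSucc)
         - free_comp 2 (free_gen GSucc) (free_gen GPrec) \<in> dend_ideal"
| rel3: "free_comp 1 (free_gen GSucc) (free_gen GPrec + free_gen GSucc)
         - free_comp 2 (free_gen GSucc) (free_gen GSucc) \<in> dend_ideal"
| zero: "0 \<in> dend_ideal"
| add: "x \<in> dend_ideal \<Longrightarrow> y \<in> dend_ideal \<Longrightarrow> x + y \<in> dend_ideal"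
| scale: "x \<in> dend_ideal \<Longrightarrow> free_scale c x \<in> dend_ideal"
| comp_left: "x \<in> dend_ideal \<Longrightarrow> free_comp i x y \<in> dend_ideal"
| comp_right: "x \<in> dend_ideal \<Longrightarrow> free_comp i y x \<in> dend_ideal"

lemma dend_ideal_uminus: "x \<in> dend_ideal \<Longrightarrow> - x \<in> dend_ideal"
  using dend_ideal.scale[of x "-1"] by (simp add: free_scale_simps)

lemma dend_ideal_diff: "x \<in> dend_ideal \<Longrightarrow> y \<in> dend_ideal \<Longrightarrow> x - y \<in> dend_ideal"
  using dend_ideal.add[of x "- y"] dend_ideal_uminus[of y] by simp

text \<open>The type \<open>dend\<close> is the direct sum of all components \<open>Dend(m)\<close>, \<open>m \<ge> 1\<close>.\<close>

quotient_type dend = "dtree \<Rightarrow>\<^sub>0 rat" / "\<lambda>x y. x - y \<in> dend_ideal"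
proof (rule equivpI)
  show "reflp (\<lambda>x y. x - y \<in> dend_ideal)"
    by (auto intro!: reflpI dend_ideal.zero)
  show "symp (\<lambda>x y. x - y \<in> dend_ideal)"
  proof (rule sympI)
    fix x y :: "dtree \<Rightarrow>\<^sub>0 rat"
    assume "x - y \<in> dend_ideal"
    from dend_ideal_uminus[OF this] show "y - x \<in> dend_ideal" by simp
  qed
  show "transp (\<lambda>x y. x - y \<in> dend_ideal)"
  proof (rule transpI)
    fix x y z :: "dtree \<Rightarrow>\<^sub>0 rat"
    assume "x - y \<in> dend_ideal" "y - z \<in> dend_ideal"
    from dend_ideal.add[OF this] show "x - z \<in> dend_ideal" by simp
  qed
qed

instantiation dend :: ab_group_add
begin

lift_definition zero_dend :: dend is 0 .

lift_definition plus_dend :: "dend \<Rightarrow> dend \<Rightarrow> dend" is "(+)"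
proof -
  fix x x' y y' :: "dtree \<Rightarrow>\<^sub>0 rat"
  assume "x - x' \<in> dend_ideal" "y - y' \<in> dend_ideal"
  from dend_ideal.add[OF this] show "x + y - (x' + y') \<in> dend_ideal"
    by (simp add: algebra_simps)
qed

lift_definition minus_dend :: "dend \<Rightarrow> dend \<Rightarrow> dend" is "(-)"
proof -
  fix x x' y y' :: "dtree \<Rightarrow>\<^sub>0 rat"
  assume "x - x' \<in> dend_ideal" "y - y' \<in> dend_ideal"
  from dend_ideal_diff[OF this] show "x - y - (x' - y') \<in> dend_ideal"
    by (simp add: algebra_simps)
qed

lift_definition uminus_dend :: "dend \<Rightarrow> dend" is uminus
proof -
  fix x x' :: "dtree \<Rightarrow>\<^sub>0 rat"
  assume "x - x' \<in> dend_ideal"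
  from dend_ideal_uminus[OF this] show "- x - (- x') \<in> dend_ideal"
    by simp
qed

instance
  by standard (transfer, simp add: algebra_simps dend_ideal.zero)+

end

lift_definition dend_scale :: "rat \<Rightarrow> dend \<Rightarrow> dend" is free_scale
proof -
  fix c :: rat and x x' :: "dtree \<Rightarrow>\<^sub>0 rat"
  assume "x - x' \<in> dend_ideal"
  from dend_ideal.scale[OF this] show "free_scale c x - free_scale c x' \<in> dend_ideal"
    by (simp add: free_scale_simps)
qed

global_interpretation dend: vector_space dend_scale
  by standard (transfer, simp add: free_scale_simps dend_ideal.zero)+

lift_definition dend_comp :: "nat \<Rightarrow> dend \<Rightarrow> dend \<Rightarrow> dend" is free_comp
proof -
  fix i and x x' y y' :: "dtree \<Rightarrow>\<^sub>0 rat"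
  assume "x - x' \<in> dend_ideal" "y - y' \<in> dend_ideal"
  then have "free_comp i (x - x') y + free_comp i x' (y - y') \<in> dend_ideal"
    by (intro dend_ideal.add dend_ideal.comp_left dend_ideal.comp_right)
  then show "free_comp i x y - free_comp i x' y' \<in> dend_ideal"
    by (simp add: free_comp_diff_left free_comp_diff_right)
qed

lift_definition dend_unit :: dend is "Poly_Mapping.single Leaf 1" .

lift_definition dend_prec :: dend is "free_gen GPrec" .

lift_definition dend_succ :: dend is "free_gen GSucc" .

text \<open>\<open>Dend m\<close> is the arity \<open>m\<close> component.\<close>

definition Dend :: "nat \<Rightarrow> dend set" where
  "Dend m = abs_dend ` free_component m"

lemma dend_relations:
  "dend_comp 1 dend_prec dend_prec = dend_comp 2 dend_prec (dend_prec + dend_succ)"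
  "dend_comp 1 dend_prec dend_succ = dend_comp 2 dend_succ dend_prec"
  "dend_comp 1 dend_succ (dend_prec + dend_succ) = dend_comp 2 dend_succ dend_succ"
  by (transfer, rule dend_ideal.intros)+


section \<open>The anticyclic structure\<close>

text \<open>
  A family of linear maps \<open>Dend(m) \<rightarrow> Dend(m)\<close>, \<open>m \<ge> 1\<close>, is the same thing as one linear
  endomorphism of the direct sum that preserves each component. The conditions determine this
  endomorphism uniquely.
\<close>

definition anticyclic_structure :: "(dend \<Rightarrow> dend) \<Rightarrow> bool" where
  "anticyclic_structure \<tau> \<longleftrightarrow>
     Vector_Spaces.linear dend_scale dend_scale \<tau> \<and>
     (\<forall>m\<ge>1. \<tau> ` Dend m \<subseteq> Dend m) \<and>
     \<tau> dend_unit = - dend_unit \<and>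
     \<tau> dend_prec = dend_succ \<and>
     \<tau> dend_succ = - (dend_prec + dend_succ) \<and>
     (\<forall>p\<ge>1. \<forall>q\<ge>1. \<forall>x \<in> Dend p. \<forall>y \<in> Dend q.
        (\<forall>i. 1 \<le> i \<and> i \<le> p - 1 \<longrightarrow> \<tau> (dend_comp i x y) = dend_comp (i + 1) (\<tau> x) y) \<and>
        \<tau> (dend_comp p x y) = - dend_comp 1 (\<tau> y) (\<tau> x))"


section \<open>Numbers and characters\<close>

text \<open>The division is exact.\<close>

definition catalan :: "nat \<Rightarrow> nat" where
  "catalan m = (2 * m choose m) div (m + 1)"

definition moebius :: "nat \<Rightarrow> int" where
  "moebius n = (if squarefree n then (- 1) ^ card (prime_factors n) else 0)"

text \<open>
  The numbers \<open>a_num m\<close>, \<open>m \<ge> 1\<close>, are positive integers, so \<open>nat \<lfloor>a_num m\<rfloor>\<close>, which is used when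
  they occur as exponents, involves no rounding.
\<close>

definition a_num :: "nat \<Rightarrow> rat" where
  "a_num m = 1 / (2 * of_nat m) *
     (\<Sum>d | d dvd m. of_int (moebius (m div d)) * of_nat (2 * d choose d))"

text \<open>
  \<open>chi n d k\<close> is the value at \<open>t\<^sup>k\<close> of the character of the \<open>C\<^sub>n\<close>-module
  \<open>\<rat>[t]/(t\<^sup>d - 1)\<close>, for \<open>d\<close> dividing \<open>n\<close>: multiplication by \<open>t\<^sup>k\<close> permutes the basis
  \<open>1, t, \<dots>, t\<^sup>d\<^sup>-\<^sup>1\<close>, fixing all its elements if \<open>d\<close> divides \<open>k\<close> and none otherwise.
\<close>

definition chi :: "nat \<Rightarrow> nat \<Rightarrow> nat \<Rightarrow> rat" where
  "chi n d k = (if d dvd k then of_nat d else 0)"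

end

theory Submission
  imports
    Defs
    "HOL-Library.Function_Algebras"
    "Jordan_Normal_Form.Schur_Decomposition"
begin

text \<open>
  The operator \<open>\<tau>\<close> is a rotation of points. An element of \<open>Dend m\<close> is read as a fraction in
  \<open>n = m + 1\<close> points \<open>y\<^sub>0, \<dots>, y\<^sub>m\<close> on a circle: the unit is \<open>1 / (y\<^sub>0 - y\<^sub>1)\<close>, and a composition
  multiplies the fractions of two polygons, glued along a side, and the length of that side. This
  reading is well defined (\<open>free_value_ideal\<close>) and turns \<open>\<tau>\<close> into the substitution of \<open>y\<^sub>1, \<dots>, y\<^sub>m, y\<^sub>0\<close> for
  \<open>y\<^sub>0, \<dots>, y\<^sub>m\<close> (\<open>dend_value_tau\<close>). Rewriting to \<open>(l \<succ> Y) \<prec> r\<close> shows that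
  \<open>Dend m\<close> is spanned by one element for every binary tree with \<open>n\<close> tips, and the fraction of this
  element is the product over the inner nodes of \<open>1 / (y\<^sub>i - y\<^sub>j)\<close>, where \<open>i\<close> and \<open>j\<close> are the first
  and the last tip below the node. These fractions are linearly independent
  (\<open>btree_frac_independent\<close>), so \<open>Dend m\<close> is their span \<open>V\<close>, and its dimension is a Catalan number.

  For the trace of a rotation by \<open>k\<close> steps, \<open>n\<close> not dividing \<open>k\<close>, add a point \<open>c\<close> in the centre of the
  circle, which the rotation fixes, and let \<open>Z\<close> be the sum of the spaces \<open>V / (c - y\<^sub>j)\<close>, where
  \<open>j < n\<close>. By uniqueness of partial fractions in \<open>c\<close> this sum is direct. The rotation permutes the
  summands without fixing one, so its trace on \<open>Z\<close> is \<open>0\<close>. On the other hand, the differences of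
  \<open>f / (c - y\<^sub>i)\<close> and \<open>f / (c - y\<^sub>j)\<close> span a subspace with quotient \<open>V\<close>, and this subspace has a
  basis that is permuted by the rotation: cut the circle into at least two arcs, put a tree fraction
  on every arc and divide it by \<open>c - y\<close>, with \<open>y\<close> the last point of the arc. That these products
  span the differences comes from
  \<open>1 / (c - y\<^sub>0) - 1 / (c - y\<^sub>m) = (y\<^sub>0 - y\<^sub>m) / ((c - y\<^sub>0) (c - y\<^sub>m))\<close>, applied along the left spine
  of a tree (\<open>sum_left_spine\<close>); that they are independent follows by counting. Hence the trace on
  \<open>V\<close> is minus the number of decorated cuttings of the circle fixed by the rotation
  (\<open>trace_nonidentity\<close>). Unrolled, a cutting is a tiling of the natural numbers by trees with period
  \<open>n\<close>, and the fixed ones are those with period \<open>g = gcd k n\<close>. Recording the tile at \<open>0\<close>, the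
  position of \<open>0\<close> in it and the remaining tiles counts them as the sum of \<open>a c\<^sub>a\<^sub>-\<^sub>1 c\<^sub>g\<^sub>-\<^sub>a\<close>
  over \<open>a = 1, \<dots>, g\<close>, which by symmetry equals \<open>(g + 1) c\<^sub>g / 2\<close>, half of the central
  binomial coefficient (\<open>card_tilings\<close>).

  By Moebius inversion the same number is the sum of \<open>d\<close> times \<open>a_num d\<close> over the divisors \<open>d\<close> of
  \<open>g\<close>; so \<open>d\<close> times \<open>a_num d\<close> counts the tilings with least period \<open>d\<close>, and \<open>a_num d\<close> counts their
  orbits under shifts. This gives the character and the integrality of \<open>a_num d\<close>. The
  characteristic polynomial follows because the traces of all powers are the power sums of the
  complex eigenvalues, and power sums determine a monic polynomial.
\<close>

section \<open>Traces, bases and families of vectors\<close>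

lemma mult_pow_mat_commute:
  assumes A: "A \<in> carrier_mat n n"
  shows "A * A ^\<^sub>m k = A ^\<^sub>m k * A"
proof (induction k)
  case (Suc k)
  have "A * (A ^\<^sub>m k * A) = A * A ^\<^sub>m k * A"
    using A by (intro assoc_mult_mat[symmetric]) auto
  then show ?case using Suc by simp
qed (use A in auto)

context vector_space
begin

text \<open>
  Both sums are \<open>\<Sum>b c. C\<^sub>b\<^sub>c B\<^sub>c\<^sub>b\<close>, with \<open>C\<^sub>b\<^sub>c\<close> the coordinates of \<open>b\<close> in \<open>C\<close> and \<open>B\<^sub>c\<^sub>b\<close> those of
  \<open>f c\<close> in \<open>B\<close>. This makes \<open>trace_on\<close> computable in any basis, and the proof of the trace formula
  compares two bases of one space.
\<close>

lemma basis_trace_unique: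
  assumes B: "finite B" "independent B" and C: "finite C" "independent C"
    and span: "span B = span C"
    and lin: "Vector_Spaces.linear scale scale f" and f: "\<And>b. b \<in> B \<Longrightarrow> f b \<in> span B"
  shows "(\<Sum>b\<in>B. representation B (f b) b) = (\<Sum>c\<in>C. representation C (f c) c)"
proof -
  interpret l: Vector_Spaces.linear scale scale f by fact
  have f': "f v \<in> span B" if "v \<in> span B" for v
    using that by (induction rule: span_induct_alt) (auto simp: l.zero l.add l.scale intro: span_add span_scale f span_zero)
  have repB: "f b = (\<Sum>c\<in>C. scale (representation C b c) (f c))" if "b \<in> B" for b
  proof -
    have "b \<in> span C" using that span span_base by blast
    then have "b = (\<Sum>c\<in>C. scale (representation C b c) c)"
      using sum_representation_eq[of C b C] C by simp
    then have "f b = f (\<Sum>c\<in>C. scale (representation C b c) c)" by simp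
    also have "\<dots> = (\<Sum>c\<in>C. scale (representation C b c) (f c))"
      by (simp add: l.sum l.scale)
    finally show ?thesis .
  qed
  have bC: "b \<in> span C" if "b \<in> B" for b
    using that span span_base by blast
  have fC: "f c \<in> span B" if "c \<in> C" for c
    using that span span_base f' by blast
  have "(\<Sum>b\<in>B. representation B (f b) b) = (\<Sum>b\<in>B. \<Sum>c\<in>C. representation C b c * representation B (f c) b)"
  proof (intro sum.cong refl)
    fix b assume b: "b \<in> B"
    have "representation B (f b) = representation B (\<Sum>c\<in>C. scale (representation C b c) (f c))"
      using repB[OF b] by simp
    also have "\<dots> = (\<lambda>x. \<Sum>c\<in>C. representation B (scale (representation C b c) (f c)) x)"
      by (rule representation_sum) (use B fC in \<open>auto intro!: span_scale\<close>)
    finally show "representation B (f b) b = (\<Sum>c\<in>C. representation C b c * representation B (f c) b)"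
      using fC by (simp add: representation_scale B)
  qed
  also have "\<dots> = (\<Sum>c\<in>C. \<Sum>b\<in>B. representation B (f c) b * representation C b c)"
    by (subst sum.swap) (simp add: mult.commute)
  also have "\<dots> = (\<Sum>c\<in>C. representation C (f c) c)"
  proof (intro sum.cong refl)
    fix c assume c: "c \<in> C"
    have "f c = (\<Sum>b\<in>B. scale (representation B (f c) b) b)"
      using sum_representation_eq[of B "f c" B] B fC[OF c] by simp
    then have "representation C (f c) = representation C (\<Sum>b\<in>B. scale (representation B (f c) b) b)"
      by simp
    also have "\<dots> = (\<lambda>x. \<Sum>b\<in>B. representation C (scale (representation B (f c) b) b) x)"
      by (rule representation_sum) (use C bC in \<open>auto intro!: span_scale\<close>)
    finally show "(\<Sum>b\<in>B. representation B (f c) b * representation C b c) = representation C (f c) c"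
      using bC C by (simp add: representation_scale)
  qed
  finally show ?thesis .
qed

lemma ordered_basis_some:
  assumes "finite B" "independent B" "span B = V"
  defines "bs \<equiv> SOME bs. ordered_basis scale V bs"
  shows "distinct bs" "independent (set bs)" "span (set bs) = V"
proof -
  obtain cs where "set cs = B" "distinct cs" using finite_distinct_list[OF assms(1)] by blast
  then have "ordered_basis scale V cs" unfolding ordered_basis_def using assms by auto
  then have "ordered_basis scale V bs" unfolding bs_def by (rule someI)
  then show "distinct bs" "independent (set bs)" "span (set bs) = V"
    unfolding ordered_basis_def by auto
qed

lemma trace_on_eq_basis_trace:
  assumes B: "finite B" "independent B" "span B = V"
    and lin: "Vector_Spaces.linear scale scale f" and f: "\<And>v. v \<in> V \<Longrightarrow> f v \<in> V"
  shows "trace_on scale V f = (\<Sum>b\<in>B. representation B (f b) b)"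
proof -
  define bs where "bs = (SOME bs. ordered_basis scale V bs)"
  note bs = ordered_basis_some[OF B, folded bs_def]
  have "trace_on scale V f = (\<Sum>b\<in>set bs. representation (set bs) (f b) b)"
    unfolding trace_on_def bs_def[symmetric] diag_mat_def endo_matrix_def
    using bs(1) by (simp add: sum_list_distinct_conv_sum_set sum_list_sum_nth sum.distinct_set_conv_list
       atLeast0LessThan)
  also have "\<dots> = (\<Sum>b\<in>B. representation B (f b) b)"
    by (rule basis_trace_unique) (use bs B lin f span_base in auto)
  finally show ?thesis .
qed

lemma endo_matrix_pow:
  assumes bs: "distinct bs" "independent (set bs)" "span (set bs) = V"
    and lin: "Vector_Spaces.linear scale scale f" and f: "\<And>v. v \<in> V \<Longrightarrow> f v \<in> V"
  shows "endo_matrix scale bs (f ^^ k) = endo_matrix scale bs f ^\<^sub>m k"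
proof (induction k)
  case 0
  show ?case using bs span_base
    by (auto simp: endo_matrix_def representation_basis nth_eq_iff_index_eq intro!: eq_matI)
next
  case (Suc k)
  interpret l: Vector_Spaces.linear scale scale f by fact
  have fk: "(f ^^ k) v \<in> V" if "v \<in> V" for v using that by (induction k) (auto intro: f)
  have "endo_matrix scale bs (f ^^ Suc k) = endo_matrix scale bs f * endo_matrix scale bs (f ^^ k)"
  proof (rule eq_matI)
    fix i j assume "i < dim_row (endo_matrix scale bs f * endo_matrix scale bs (f ^^ k))"
       "j < dim_col (endo_matrix scale bs f * endo_matrix scale bs (f ^^ k))"
    then have ij: "i < length bs" "j < length bs" by (auto simp: endo_matrix_def)
    let ?v = "(f ^^ k) (bs ! j)"
    have v: "?v \<in> span (set bs)" using fk bs span_base ij by auto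
    have "?v = (\<Sum>b\<in>set bs. scale (representation (set bs) ?v b) b)"
      using sum_representation_eq[of "set bs" ?v "set bs"] bs v by simp
    then have "f ?v = f (\<Sum>b\<in>set bs. scale (representation (set bs) ?v b) b)" by simp
    also have "\<dots> = (\<Sum>b\<in>set bs. scale (representation (set bs) ?v b) (f b))"
      by (simp add: l.sum l.scale)
    finally have "representation (set bs) (f ?v) =
       representation (set bs) (\<Sum>b\<in>set bs. scale (representation (set bs) ?v b) (f b))" by simp
    also have "\<dots> = (\<lambda>x. \<Sum>b\<in>set bs. representation (set bs) (scale (representation (set bs) ?v b) (f b)) x)"
      by (rule representation_sum) (use bs span_base f in \<open>auto intro!: span_scale\<close>)
    finally have "representation (set bs) (f ?v) (bs ! i)
       = (\<Sum>b\<in>set bs. representation (set bs) ?v b * representation (set bs) (f b) (bs ! i))"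
      using bs span_base f by (auto simp: representation_scale)
    also have "\<dots> = (\<Sum>l<length bs. representation (set bs) (f (bs!l)) (bs ! i) * representation (set bs) ?v (bs!l))"
      using bs(1) by (simp add: sum.distinct_set_conv_list sum_list_sum_nth atLeast0LessThan mult.commute)
    finally show "endo_matrix scale bs (f ^^ Suc k) $$ (i, j) =
       (endo_matrix scale bs f * endo_matrix scale bs (f ^^ k)) $$ (i, j)"
      using ij by (simp add: endo_matrix_def scalar_prod_def atLeast0LessThan)
  qed (auto simp: endo_matrix_def)
  also have "\<dots> = endo_matrix scale bs f ^\<^sub>m Suc k"
  proof -
    have "endo_matrix scale bs f \<in> carrier_mat (length bs) (length bs)" by (simp add: endo_matrix_def)
    from mult_pow_mat_commute[OF this, of k] show ?thesis using Suc by simp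
  qed
  finally show ?case .
qed

text \<open>
  Bases occur below as indexed families. Independence of the family includes that its members are
  different, so coordinates can be written in terms of indices.
\<close>

lemma family_independent:
  assumes "finite I" "\<And>q i. (\<Sum>i\<in>I. scale (q i) (v i)) = 0 \<Longrightarrow> i \<in> I \<Longrightarrow> q i = 0"
  shows "inj_on v I" "independent (v ` I)"
proof -
  show inj: "inj_on v I"
  proof (rule inj_onI, rule ccontr)
    fix i j assume ij: "i \<in> I" "j \<in> I" "v i = v j" "i \<noteq> j"
    have "(\<Sum>k\<in>I. scale ((if k = i then 1 else 0) - (if k = j then 1 else 0)) (v k)) =
       (\<Sum>k\<in>I. if k = i then v k else 0) - (\<Sum>k\<in>I. if k = j then v k else 0)"
      unfolding sum_subtractf[symmetric] by (intro sum.cong refl) simp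
    also have "\<dots> = 0" using ij assms(1) by simp
    finally show False using assms(2)[of "\<lambda>k. (if k = i then 1 else 0) - (if k = j then 1 else 0)" i] ij by simp
  qed
  show "independent (v ` I)"
  proof (rule independent_if_scalars_zero)
    fix f x assume "(\<Sum>x\<in>v ` I. scale (f x) x) = 0" "x \<in> v ` I"
    then show "f x = 0" using assms(2)[of "\<lambda>i. f (v i)"] by (auto simp: sum.reindex[OF inj])
  qed (use assms in auto)
qed

lemma family_representation:
  assumes "finite I" "inj_on v I" "independent (v ` I)" "j \<in> I"
  shows "representation (v ` I) (\<Sum>i\<in>I. scale (q i) (v i)) (v j) = q j"
proof -
  have sp: "v i \<in> span (v ` I)" if "i \<in> I" for i using that by (auto intro: span_base)
  have "representation (v ` I) (\<Sum>i\<in>I. scale (q i) (v i)) =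
     (\<lambda>x. \<Sum>i\<in>I. representation (v ` I) (scale (q i) (v i)) x)"
    by (rule representation_sum) (use assms sp in \<open>auto intro!: span_scale\<close>)
  then have "representation (v ` I) (\<Sum>i\<in>I. scale (q i) (v i)) (v j) =
      (\<Sum>i\<in>I. q i * (if v j = v i then 1 else 0))"
    using assms sp by (simp add: representation_scale representation_basis)
  also have "\<dots> = (\<Sum>i\<in>I. if i = j then q i else 0)"
    using assms by (intro sum.cong refl) (auto dest: inj_onD)
  finally show ?thesis using assms by simp
qed

lemma representation_family_sum:
  assumes "finite I" "inj_on v I" "independent (v ` I)" "x \<in> span (v ` I)"
  shows "x = (\<Sum>i\<in>I. scale (representation (v ` I) x (v i)) (v i))"
  using sum_representation_eq[of "v ` I" x "v ` I"] assms by (simp add: sum.reindex)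

text \<open>
  A spanning set that is no larger than an independent set is a basis. Here \<open>E\<close> need not
  consist of elements of \<open>F\<close>.
\<close>

lemma spanning_family_independent:
  assumes "independent E" "finite F" "E \<subseteq> span F" "card F \<le> card E"
  shows "independent F" "span E = span F" "card F = card E"
proof -
  obtain T where T: "T \<subseteq> F" "independent T" "F \<subseteq> span T" using maximal_independent_subset[of F] by blast
  have fT: "finite T" by (rule finite_subset[OF T(1) assms(2)])
  have "span F \<subseteq> span T" using T(3) by (simp add: span_minimal subspace_span)
  then have "E \<subseteq> span T" using assms by auto
  then have E: "finite E" "card E \<le> card T" using independent_span_bound[OF fT assms(1)] by auto
  have TF: "T = F" using card_subset_eq[OF assms(2) T(1)] E(2) assms(4) card_mono[OF assms(2) T(1)] by linarith
  then show "independent F" using T by simp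
  show "card F = card E" using E assms TF by simp
  have "F \<subseteq> span E"
  proof
    fix x assume x: "x \<in> F"
    show "x \<in> span E"
    proof (rule ccontr)
      assume n: "x \<notin> span E"
      then have "independent (insert x E)" using assms(1) by (simp add: independent_insert)
      moreover have "insert x E \<subseteq> span F" using assms(3) x span_base by auto
      ultimately have "card (insert x E) \<le> card F" using independent_span_bound[OF assms(2)] by blast
      moreover have "x \<notin> E" using n span_base by auto
      ultimately show False using E assms by simp
    qed
  qed
  then show "span E = span F" using assms(3) by (meson span_eq)
qed

end

section \<open>Compositions of tree monomials\<close>

lemma free_comp_single:
  "free_comp i (Poly_Mapping.single s a) (Poly_Mapping.single t b) =
     (if 1 \<le> i \<and> i \<le> arity s then Poly_Mapping.single (graft s i t) (a * b) else 0)"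
  by (subst free_comp_superset[of "{s}" "{t}"]) auto

lemma free_comp_add_left: "free_comp i (x + x') y = free_comp i x y + free_comp i x' y"
  using free_comp_diff_left[of i "x + x'" x' y] by (simp add: algebra_simps)

lemma free_comp_add_right: "free_comp i x (y + y') = free_comp i x y + free_comp i x y'"
  using free_comp_diff_right[of i x "y + y'" y'] by (simp add: algebra_simps)

lemma free_comp_scale_left: "free_comp i (free_scale c x) y = free_scale c (free_comp i x y)"
proof -
  have fin: "finite (Poly_Mapping.keys x \<union> Poly_Mapping.keys (free_scale c x))" "finite (Poly_Mapping.keys y)" by auto
  show ?thesis
    by (subst (1 2) free_comp_superset[OF fin])
      (auto intro!: poly_mapping_eqI sum.cong simp: lookup_free_scale lookup_sum lookup_single when_def sum_distrib_left)
qed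

lemma free_comp_scale_right: "free_comp i x (free_scale c y) = free_scale c (free_comp i x y)"
proof -
  have fin: "finite (Poly_Mapping.keys x)" "finite (Poly_Mapping.keys y \<union> Poly_Mapping.keys (free_scale c y))" by auto
  show ?thesis
    by (subst (1 2) free_comp_superset[OF fin])
      (auto intro!: poly_mapping_eqI sum.cong simp: lookup_free_scale lookup_sum lookup_single when_def sum_distrib_left)
qed

lemma dend_comp_linear_right: "Vector_Spaces.linear dend_scale dend_scale (dend_comp i x)"
  by unfold_locales (transfer; simp add: free_comp_add_right free_comp_scale_right dend_ideal.zero)+

lemma dend_comp_linear_left: "Vector_Spaces.linear dend_scale dend_scale (\<lambda>x. dend_comp i x y)"
  by unfold_locales (transfer; simp add: free_comp_add_left free_comp_scale_left dend_ideal.zero)+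

lift_definition tree_class :: "dtree \<Rightarrow> dend" is "\<lambda>t. Poly_Mapping.single t 1" .

lift_definition dend_gen :: "dgen \<Rightarrow> dend" is free_gen .

lemma dend_gen_simps: "dend_gen GPrec = dend_prec" "dend_gen GSucc = dend_succ"
  by (transfer, simp add: dend_ideal.zero)+

lemma dend_gen_eq: "dend_gen g = tree_class (Node g Leaf Leaf)"
  by transfer (simp add: free_gen_def dend_ideal.zero)

lemma arity_pos: "arity t \<ge> 1" by (induction t) auto

lemma dend_comp_class:
  assumes "1 \<le> i" "i \<le> arity s"
  shows "dend_comp i (tree_class s) (tree_class t) = tree_class (graft s i t)"
  using assms by transfer (simp add: free_comp_single dend_ideal.zero)

lemma arity_graft: "1 \<le> i \<Longrightarrow> i \<le> arity s \<Longrightarrow> arity (graft s i t) + 1 = arity s + arity t"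
proof (induction s arbitrary: i)
  case (Node g l r)
  show ?case
  proof (cases "i \<le> arity l")
    case True
    then show ?thesis using Node by simp
  next
    case False
    then show ?thesis using Node.IH(2)[of "i - arity l"] Node.prems by simp
  qed
qed simp

lemma sum_single: "x = (\<Sum>t\<in>Poly_Mapping.keys x. Poly_Mapping.single t (Poly_Mapping.lookup x t))"
  by (rule poly_mapping_eqI) (simp add: lookup_sum lookup_single when_def in_keys_iff)

lemma single_eq_scale: "Poly_Mapping.single t c = free_scale c (Poly_Mapping.single t 1)"
  by (rule poly_mapping_eqI) (simp add: lookup_free_scale lookup_single when_def)

lemma abs_dend_sum: "finite A \<Longrightarrow> abs_dend (sum f A) = (\<Sum>a\<in>A. abs_dend (f a))"
  by (induction A rule: finite_induct) (simp_all add: zero_dend_def plus_dend.abs_eq[symmetric])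

lemma Dend_eq_span: "Dend m = dend.span {tree_class t |t. arity t = m}"
proof (intro equalityI subsetI)
  fix a assume "a \<in> Dend m"
  then obtain x where x: "x \<in> free_component m" "a = abs_dend x" unfolding Dend_def by auto
  have "a = (\<Sum>t\<in>Poly_Mapping.keys x. dend_scale (Poly_Mapping.lookup x t) (tree_class t))"
    unfolding x(2) by (subst sum_single)
      (simp add: abs_dend_sum, simp add: single_eq_scale[symmetric] dend_scale.abs_eq tree_class.abs_eq)
  also have "\<dots> \<in> dend.span {tree_class t |t. arity t = m}"
    by (intro dend.span_sum dend.span_scale dend.span_base) (use x(1) in \<open>auto simp: free_component_def\<close>)
  finally show "a \<in> dend.span {tree_class t |t. arity t = m}" .
next
  fix a assume "a \<in> dend.span {tree_class t |t. arity t = m}"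
  then show "a \<in> Dend m"
  proof (induction rule: dend.span_induct_alt)
    case base
    show ?case unfolding Dend_def zero_dend_def
      by (rule imageI) (simp add: free_component_def)
  next
    case (step c b a)
    then obtain t x where t: "arity t = m" "b = tree_class t" and x: "x \<in> free_component m" "a = abs_dend x"
      by (auto simp: Dend_def)
    have "dend_scale c b + a = abs_dend (free_scale c (Poly_Mapping.single t 1) + x)"
      by (simp add: t x dend_scale.abs_eq plus_dend.abs_eq tree_class.abs_eq)
    moreover have "free_scale c (Poly_Mapping.single t 1) + x \<in> free_component m"
      using t x by (auto simp: free_component_def in_keys_iff lookup_free_scale lookup_single lookup_add when_def split: if_splits)
    ultimately show ?case unfolding Dend_def by blast
  qed
qed

lemma tree_class_in_Dend: "tree_class t \<in> Dend (arity t)"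
  unfolding Dend_eq_span by (rule dend.span_base) auto

lemma dend_comp_in_Dend:
  assumes x: "x \<in> Dend p" and y: "y \<in> Dend q" and i: "1 \<le> i" "i \<le> p"
  shows "dend_comp i x y \<in> Dend (p + q - 1)"
proof -
  have 1: "dend_comp i (tree_class s) y \<in> Dend (p + q - 1)" if s: "arity s = p" for s
  proof -
    interpret l: Vector_Spaces.linear dend_scale dend_scale "dend_comp i (tree_class s)" by (rule dend_comp_linear_right)
    show ?thesis using y unfolding Dend_eq_span[of q]
    proof (induction rule: dend.span_induct_alt)
      case base then show ?case by (simp add: l.zero Dend_eq_span dend.span_zero)
    next
      case (step c b a)
      then obtain t where t: "b = tree_class t" "arity t = q" by auto
      have "dend_comp i (tree_class s) b = tree_class (graft s i t)"
        unfolding t by (rule dend_comp_class) (use i s in auto)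
      moreover have "arity (graft s i t) = p + q - 1" using arity_graft[of i s t] i s t by simp
      ultimately have "dend_comp i (tree_class s) b \<in> Dend (p + q - 1)" using tree_class_in_Dend by metis
      with step show ?case by (simp add: l.add l.scale Dend_eq_span dend.span_add dend.span_scale)
    qed
  qed
  interpret l: Vector_Spaces.linear dend_scale dend_scale "\<lambda>x. dend_comp i x y" by (rule dend_comp_linear_left)
  show ?thesis using x unfolding Dend_eq_span[of p]
  proof (induction rule: dend.span_induct_alt)
    case base then show ?case by (simp add: l.zero Dend_eq_span dend.span_zero)
  next
    case (step c b a)
    then have "dend_comp i b y \<in> Dend (p + q - 1)" using 1 by auto
    with step show ?case by (simp add: l.add l.scale Dend_eq_span dend.span_add dend.span_scale)
  qed
qed

text \<open>
  The binary operations \<open>a \<prec> b\<close> and \<open>a \<succ> b\<close> on the free dendriform algebra with one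
  generator, which is the direct sum of the components of the operad.
\<close>

definition dmul :: "dgen \<Rightarrow> dend \<Rightarrow> dend \<Rightarrow> dend" where
  "dmul g a b = dend_comp 1 (dend_comp 2 (dend_gen g) b) a"

lemma dmul_class: "dmul g (tree_class s) (tree_class t) = tree_class (Node g s t)"
proof -
  have "dend_comp 2 (dend_gen g) (tree_class t) = tree_class (Node g Leaf t)"
    unfolding dend_gen_eq by (subst dend_comp_class) auto
  then show ?thesis unfolding dmul_def using arity_pos[of t] by (simp add: dend_comp_class)
qed

lemma dmul_linear_left: "Vector_Spaces.linear dend_scale dend_scale (\<lambda>a. dmul g a b)"
  unfolding dmul_def by (rule dend_comp_linear_right)

lemma dmul_linear_right: "Vector_Spaces.linear dend_scale dend_scale (dmul g a)"
  using Vector_Spaces.linear_compose[OF dend_comp_linear_right[of 2 "dend_gen g"] dend_comp_linear_left[of 1 a]]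
  by (simp add: dmul_def[abs_def] o_def)

text \<open>
  The relations between the generators, composed with \<open>c\<close>, \<open>b\<close> and \<open>a\<close> at the third, second and
  first input. Composing from the right keeps the numbers of the remaining inputs.
\<close>

lemma dend_relations_trees:
  "tree_class (Node GPrec (Node GPrec a b) c) = tree_class (Node GPrec a (Node GPrec b c)) + tree_class (Node GPrec a (Node GSucc b c))"
  "tree_class (Node GPrec (Node GSucc a b) c) = tree_class (Node GSucc a (Node GPrec b c))"
  "tree_class (Node GSucc (Node GPrec a b) c) + tree_class (Node GSucc (Node GSucc a b) c) = tree_class (Node GSucc a (Node GSucc b c))"
proof -
  interpret l1: Vector_Spaces.linear dend_scale dend_scale "\<lambda>x. dend_comp 1 x y" for y by (rule dend_comp_linear_left)
  interpret l2: Vector_Spaces.linear dend_scale dend_scale "\<lambda>x. dend_comp 2 x y" for y by (rule dend_comp_linear_left)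
  interpret l3: Vector_Spaces.linear dend_scale dend_scale "\<lambda>x. dend_comp 3 x y" for y by (rule dend_comp_linear_left)
  interpret r: Vector_Spaces.linear dend_scale dend_scale "dend_comp i x" for i x by (rule dend_comp_linear_right)
  have ab: "1 \<le> arity a" "1 \<le> arity b" by (rule arity_pos)+
  let ?F = "\<lambda>x. dend_comp 1 (dend_comp 2 (dend_comp 3 x (tree_class c)) (tree_class b)) (tree_class a)"
  have F: "?F (tree_class (Node g (Node h Leaf Leaf) Leaf)) = tree_class (Node g (Node h a b) c)"
          "?F (tree_class (Node g Leaf (Node h Leaf Leaf))) = tree_class (Node g a (Node h b c))" for g h
    using ab by (simp_all add: dend_comp_class)
  have G: "dend_comp 1 (tree_class (Node g Leaf Leaf)) (tree_class (Node h Leaf Leaf)) = tree_class (Node g (Node h Leaf Leaf) Leaf)"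
       "dend_comp 2 (tree_class (Node g Leaf Leaf)) (tree_class (Node h Leaf Leaf)) = tree_class (Node g Leaf (Node h Leaf Leaf))" for g h
    by (simp_all add: dend_comp_class)
  note rel = dend_relations[folded dend_gen_simps, unfolded dend_gen_eq r.add G]
  show "tree_class (Node GPrec (Node GPrec a b) c) = tree_class (Node GPrec a (Node GPrec b c)) + tree_class (Node GPrec a (Node GSucc b c))"
    using arg_cong[OF rel(1), of ?F] unfolding l1.add l2.add l3.add F .
  show "tree_class (Node GPrec (Node GSucc a b) c) = tree_class (Node GSucc a (Node GPrec b c))"
    using arg_cong[OF rel(2), of ?F] unfolding l1.add l2.add l3.add F .
  show "tree_class (Node GSucc (Node GPrec a b) c) + tree_class (Node GSucc (Node GSucc a b) c) = tree_class (Node GSucc a (Node GSucc b c))"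
    using arg_cong[OF rel(3), of ?F] unfolding l1.add l2.add l3.add F .
qed

section \<open>Normal forms\<close>

datatype btree = Tip | Join btree btree

fun tips :: "btree \<Rightarrow> nat" where
  "tips Tip = 1"
| "tips (Join l r) = tips l + tips r"

lemma tips_pos: "tips b \<ge> 1" by (induction b) auto

text \<open>
  The tree \<open>Join l r\<close> stands for \<open>(l \<succ> Y) \<prec> r\<close>, with \<open>Y\<close> the generator of the free dendriform
  algebra and a side that is a tip left out. The value on \<open>Tip\<close> is a dummy. A tree with \<open>n\<close> tips
  gives a monomial of arity \<open>n - 1\<close>, the number of its inner nodes.
\<close>

fun nf_tree :: "btree \<Rightarrow> dtree" where
  "nf_tree Tip = Leaf"
| "nf_tree (Join l r) =
     (let u = (if l = Tip then Leaf else Node GSucc (nf_tree l) Leaf)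
      in if r = Tip then u else Node GPrec u (nf_tree r))"

lemma arity_nf_tree: "b \<noteq> Tip \<Longrightarrow> arity (nf_tree b) + 1 = tips b"
  by (induction b) (auto simp: Let_def)

abbreviation nf :: "btree \<Rightarrow> dend" where "nf b \<equiv> tree_class (nf_tree b)"

definition nf_span :: "nat \<Rightarrow> dend set" where
  "nf_span n = dend.span (nf ` {b. b \<noteq> Tip \<and> tips b = n})"

lemma linear_add: "Vector_Spaces.linear dend_scale dend_scale f \<Longrightarrow> f (x + x') = f x + f x'"
  by (simp add: Vector_Spaces.linear_iff)

lemma linear_image_span_subset:
  assumes "Vector_Spaces.linear dend_scale dend_scale f" "\<And>x. x \<in> S \<Longrightarrow> f x \<in> dend.span T" "v \<in> dend.span S"
  shows "f v \<in> dend.span T"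
proof -
  interpret l: Vector_Spaces.linear dend_scale dend_scale f by fact
  show ?thesis using assms(3)
    by (induction rule: dend.span_induct_alt) (auto simp: l.zero l.add l.scale intro!: dend.span_add dend.span_scale dend.span_zero assms(2))
qed

abbreviation half :: "btree \<Rightarrow> dtree" where
  "half l \<equiv> (if l = Tip then Leaf else Node GSucc (nf_tree l) Leaf)"

lemma nf_tree_Join: "nf_tree (Join l r) = (if r = Tip then half l else Node GPrec (half l) (nf_tree r))"
  by (simp add: Let_def)

text \<open>
  The first relation moves a product \<open>\<dots> \<prec> c\<close> into the right subtree of the left factor, the
  third one moves \<open>b \<succ> \<dots>\<close> into the left subtree of the right factor, and the second one keeps
  the right subtree of that factor in place. Each step makes the factors smaller.
\<close>

lemma nf_products:
  assumes "b \<noteq> Tip" "c \<noteq> Tip"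
  shows "tree_class (Node g (nf_tree b) (nf_tree c)) \<in> nf_span (tips b + tips c - 1)"
  using assms
proof (induction "tips b + tips c" arbitrary: b c g rule: less_induct)
  case less
  have base: "nf d \<in> nf_span m" if "d \<noteq> Tip" "tips d = m" for d m
    unfolding nf_span_def by (rule dend.span_base) (use that in auto)
  have half: "dmul GPrec (tree_class (half l)) x \<in> nf_span (tips l + m)" if "x \<in> nf_span m" for x l m
    using that unfolding nf_span_def[of m] nf_span_def[of "tips l + m"]
  proof (rule linear_image_span_subset[OF dmul_linear_right, rotated])
    fix z assume "z \<in> nf ` {b. b \<noteq> Tip \<and> tips b = m}"
    then obtain d where d: "z = nf d" "d \<noteq> Tip" "tips d = m" by auto
    have "nf (Join l d) \<in> nf_span (tips l + m)" by (rule base) (use d in simp_all)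
    then show "dmul GPrec (tree_class (half l)) z \<in> dend.span (nf ` {b. b \<noteq> Tip \<and> tips b = tips l + m})"
      using d by (simp add: dmul_class nf_tree_Join nf_span_def del: nf_tree.simps)
  qed
  obtain l r where b: "b = Join l r" using \<open>b \<noteq> Tip\<close> by (cases b) auto
  obtain l' r' where c: "c = Join l' r'" using \<open>c \<noteq> Tip\<close> by (cases c) auto
  note pos = tips_pos[of l] tips_pos[of r] tips_pos[of l'] tips_pos[of r']
  show ?case
  proof (cases g)
    case GPrec
    show ?thesis
    proof (cases "r = Tip")
      case True
      then show ?thesis using base[of "Join l c"] \<open>c \<noteq> Tip\<close> by (simp add: GPrec b nf_tree_Join del: nf_tree.simps)
    next
      case False
      have "tree_class (Node g' (nf_tree r) (nf_tree c)) \<in> nf_span (tips r + tips c - 1)" for g'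
        by (rule less.hyps) (use pos False \<open>c \<noteq> Tip\<close> in \<open>auto simp: b\<close>)
      then have "tree_class (Node GPrec (nf_tree r) (nf_tree c)) + tree_class (Node GSucc (nf_tree r) (nf_tree c))
          \<in> nf_span (tips r + tips c - 1)"
        unfolding nf_span_def by (intro dend.span_add)
      from half[OF this, of l] show ?thesis
      proof -
        interpret l: Vector_Spaces.linear dend_scale dend_scale "dmul GPrec (tree_class (half l))" by (rule dmul_linear_right)
        assume A: "dmul GPrec (tree_class (half l)) (tree_class (Node GPrec (nf_tree r) (nf_tree c)) + tree_class (Node GSucc (nf_tree r) (nf_tree c)))
          \<in> nf_span (tips l + (tips r + tips c - 1))"
        have "tips l + (tips r + tips c - 1) = tips b + tips c - 1" using pos by (simp add: b)
        then show ?thesis using A False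
          by (simp add: l.add dmul_class GPrec b nf_tree_Join dend_relations_trees(1) del: nf_tree.simps)
      qed
    qed
  next
    case GSucc
    have *: "tree_class (Node GSucc (nf_tree b) (half l')) \<in> dend.span ((\<lambda>d. tree_class (half d)) ` {d. d \<noteq> Tip \<and> tips d = tips b + tips l' - 1})"
    proof (cases "l' = Tip")
      case True
      then show ?thesis using \<open>b \<noteq> Tip\<close> by (auto intro!: dend.span_base image_eqI[of _ _ b])
    next
      case False
      have I: "tree_class (Node g' (nf_tree b) (nf_tree l')) \<in> nf_span (tips b + tips l' - 1)" for g'
        by (rule less.hyps) (use pos False \<open>b \<noteq> Tip\<close> in \<open>auto simp: c\<close>)
      have "tree_class (Node GPrec (nf_tree b) (nf_tree l')) + tree_class (Node GSucc (nf_tree b) (nf_tree l'))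
          \<in> nf_span (tips b + tips l' - 1)"
        unfolding nf_span_def by (intro dend.span_add I[unfolded nf_span_def])
      then have "dmul GSucc (tree_class (Node GPrec (nf_tree b) (nf_tree l')) + tree_class (Node GSucc (nf_tree b) (nf_tree l'))) (tree_class Leaf)
         \<in> dend.span ((\<lambda>d. tree_class (half d)) ` {d. d \<noteq> Tip \<and> tips d = tips b + tips l' - 1})"
        unfolding nf_span_def
        by (rule linear_image_span_subset[OF dmul_linear_left, rotated])
           (auto simp: dmul_class intro!: dend.span_base)
      moreover have "dmul GSucc (x + x') z = dmul GSucc x z + dmul GSucc x' z" for x x' z
        using linear_add[OF dmul_linear_left] .
      ultimately show ?thesis using False
        by (simp add: dmul_class dend_relations_trees(3))
    qed
    show ?thesis
    proof (cases "r' = Tip")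
      case True
      have "dend.span ((\<lambda>d. tree_class (half d)) ` {d. d \<noteq> Tip \<and> tips d = tips b + tips l' - 1}) \<subseteq> nf_span (tips b + tips l')"
        unfolding nf_span_def
      proof (rule dend.span_mono, safe)
        fix d assume "d \<noteq> Tip" "tips d = tips b + tips l' - 1"
        then show "tree_class (half d) \<in> nf ` {d. d \<noteq> Tip \<and> tips d = tips b + tips l'}"
          using pos by (intro image_eqI[of _ _ "Join d Tip"]) (auto simp: nf_tree_Join)
      qed
      then show ?thesis using * True pos by (auto simp: GSucc c nf_tree_Join simp del: nf_tree.simps)
    next
      case False
      have "dmul GPrec (tree_class (Node GSucc (nf_tree b) (half l'))) (nf r') \<in> nf_span (tips b + tips l' - 1 + tips r')"
        using * unfolding nf_span_def
        by (rule linear_image_span_subset[OF dmul_linear_left, rotated])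
           (use False in \<open>auto simp: dmul_class nf_tree_Join intro!: dend.span_base image_eqI[of _ _ "Join _ r'"]\<close>)
      moreover have "tips b + tips l' - 1 + tips r' = tips b + tips c - 1" using pos by (simp add: c b)
      ultimately show ?thesis using False
        by (simp add: dmul_class GSucc c nf_tree_Join dend_relations_trees(2) del: nf_tree.simps)
    qed
  qed
qed

lemma tree_class_in_nf_span: "tree_class t \<in> nf_span (arity t + 1)"
proof (induction t)
  case Leaf
  show ?case unfolding nf_span_def by (rule dend.span_base) (auto intro!: image_eqI[of _ _ "Join Tip Tip"])
next
  case (Node g s t)
  have "dmul g (tree_class s) (tree_class t) \<in> nf_span (arity s + arity t + 1)"
    using Node(1) unfolding nf_span_def[of "arity s + 1"] nf_span_def[of "arity s + arity t + 1"]
  proof (rule linear_image_span_subset[OF dmul_linear_left, rotated])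
    fix x assume "x \<in> nf ` {b. b \<noteq> Tip \<and> tips b = arity s + 1}"
    then obtain b where b: "x = nf b" "b \<noteq> Tip" "tips b = arity s + 1" by auto
    show "dmul g x (tree_class t) \<in> dend.span (nf ` {b. b \<noteq> Tip \<and> tips b = arity s + arity t + 1})"
      using Node(2) unfolding nf_span_def[of "arity t + 1"]
    proof (rule linear_image_span_subset[OF dmul_linear_right, rotated])
      fix z assume "z \<in> nf ` {b. b \<noteq> Tip \<and> tips b = arity t + 1}"
      then obtain c where "z = nf c" "c \<noteq> Tip" "tips c = arity t + 1" by auto
      then show "dmul g x z \<in> dend.span (nf ` {b. b \<noteq> Tip \<and> tips b = arity s + arity t + 1})"
        using nf_products[of b c g] b by (simp add: dmul_class nf_span_def)
    qed
  qed
  then show ?case by (simp add: dmul_class)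
qed

lemma Dend_eq_nf_span: "Dend m = nf_span (m + 1)"
proof
  show "Dend m \<subseteq> nf_span (m + 1)" unfolding Dend_eq_span nf_span_def
    by (rule dend.span_minimal) (use tree_class_in_nf_span in \<open>auto simp: nf_span_def dend.subspace_span\<close>)
  show "nf_span (m + 1) \<subseteq> Dend m" unfolding Dend_eq_span nf_span_def
    by (rule dend.span_mono) (use arity_nf_tree in fastforce)
qed

section \<open>Dendriform elements as fractions\<close>

fun corner :: "dgen \<Rightarrow> real \<Rightarrow> real \<Rightarrow> real \<Rightarrow> real" where
  "corner GPrec a b c = (a - b) / (a - c)"
| "corner GSucc a b c = (b - c) / (a - c)"

text \<open>
  A tree of arity \<open>m\<close> is read on points \<open>y 0, \<dots>, y m\<close>; its \<open>i\<close>-th leaf is the side from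
  \<open>y (i - 1)\<close> to \<open>y i\<close>. A node glues two polygons to a triangle along the sides
  \<open>a b\<close> and \<open>b c\<close>, and \<open>corner\<close> is the fraction of the generator on that triangle multiplied by
  the lengths \<open>a - b\<close> and \<open>b - c\<close> of the glued sides.
\<close>

fun tree_frac :: "dtree \<Rightarrow> (nat \<Rightarrow> real) \<Rightarrow> real" where
  "tree_frac Leaf y = 1 / (y 0 - y 1)"
| "tree_frac (Node g l r) y = tree_frac l y * tree_frac r (\<lambda>j. y (arity l + j)) *
     corner g (y 0) (y (arity l)) (y (arity l + arity r))"

lemma tree_frac_cong: "(\<And>j. j \<le> arity t \<Longrightarrow> y j = z j) \<Longrightarrow> tree_frac t y = tree_frac t z"
proof (induction t arbitrary: y z)
  case (Node g l r)
  have "tree_frac l y = tree_frac l z" by (rule Node.IH) (use Node.prems in auto)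
  moreover have "tree_frac r (\<lambda>j. y (arity l + j)) = tree_frac r (\<lambda>j. z (arity l + j))"
    by (rule Node.IH) (use Node.prems in auto)
  ultimately show ?case using Node.prems by simp
qed simp

text \<open>
  The points of the outer polygon when a polygon with \<open>q\<close> further sides is glued to its \<open>i\<close>-th
  side.
\<close>

definition collapse :: "nat \<Rightarrow> nat \<Rightarrow> (nat \<Rightarrow> real) \<Rightarrow> nat \<Rightarrow> real" where
  "collapse i q y = (\<lambda>j. if j < i then y j else y (j + q - 1))"

lemma inj_shift:
  fixes y :: "nat \<Rightarrow> real"
  assumes "inj_on y {..m}" "k + q \<le> m"
  shows "inj_on (\<lambda>j. y (k + j)) {..q}"
proof (rule inj_onI)
  fix a b assume "a \<in> {..q}" "b \<in> {..q}" "y (k + a) = y (k + b)"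
  then have "k + a = k + b" using assms by (intro inj_onD[OF assms(1)]) auto
  then show "a = b" by simp
qed

text \<open>
  The leaf that is replaced contributes the inverse of the length of the glued side; the last
  factor cancels it.
\<close>

lemma tree_frac_graft:
  assumes "1 \<le> i" "i \<le> arity s" "inj_on y {..arity s + arity t - 1}"
  shows "tree_frac (graft s i t) y = tree_frac s (collapse i (arity t) y) * tree_frac t (\<lambda>j. y (i - 1 + j)) *
    (y (i - 1) - y (i - 1 + arity t))"
  using assms
proof (induction s arbitrary: i y)
  case Leaf
  then have "y 0 \<noteq> y (arity t)" using arity_pos[of t] inj_onD[OF Leaf(3), of 0 "arity t"] by auto
  then show ?case using Leaf arity_pos[of t] by (auto simp: collapse_def)
next
  case (Node g l r)
  note q = arity_pos[of t]
  have al: "arity (graft l i t) = arity l + arity t - 1" if "i \<le> arity l"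
    using arity_graft[of i l t] Node.prems that by simp
  have ar: "arity (graft r (i - arity l) t) = arity r + arity t - 1" if "\<not> i \<le> arity l"
  proof -
    have "1 \<le> i - arity l" "i - arity l \<le> arity r" using Node.prems that by auto
    from arity_graft[OF this, of t] show ?thesis by simp
  qed
  show ?case
  proof (cases "i \<le> arity l")
    case True
    have IH: "tree_frac (graft l i t) y = tree_frac l (collapse i (arity t) y) * tree_frac t (\<lambda>j. y (i - 1 + j)) *
       (y (i - 1) - y (i - 1 + arity t))"
      by (rule Node.IH) (use Node.prems True in \<open>auto elim!: inj_on_subset\<close>)
    have r: "(\<lambda>j. collapse i (arity t) y (arity l + j)) = (\<lambda>j. y (arity l + arity t - 1 + j))"
      using True q by (auto simp: collapse_def fun_eq_iff algebra_simps)
    have c: "collapse i (arity t) y 0 = y 0" "collapse i (arity t) y (arity l) = y (arity l + arity t - 1)"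
      "collapse i (arity t) y (arity l + arity r) = y (arity l + arity t - 1 + arity r)"
      using True q Node.prems by (auto simp: collapse_def algebra_simps)
    show ?thesis using True by (simp add: al IH r c)
  next
    case False
    have IH: "tree_frac (graft r (i - arity l) t) (\<lambda>j. y (arity l + j))
      = tree_frac r (collapse (i - arity l) (arity t) (\<lambda>j. y (arity l + j))) *
        tree_frac t (\<lambda>j. y (arity l + (i - arity l - 1 + j))) *
       (y (arity l + (i - arity l - 1)) - y (arity l + (i - arity l - 1 + arity t)))"
    proof (rule Node.IH)
      show "inj_on (\<lambda>j. y (arity l + j)) {..arity r + arity t - 1}"
        by (rule inj_shift[OF Node.prems(3)]) (use q in auto)
    qed (use Node.prems False in auto)
    have r: "collapse (i - arity l) (arity t) (\<lambda>j. y (arity l + j)) = (\<lambda>j. collapse i (arity t) y (arity l + j))"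
      using False q by (auto simp: collapse_def fun_eq_iff algebra_simps intro!: arg_cong[of _ _ y])
    have l: "tree_frac l (collapse i (arity t) y) = tree_frac l y"
      by (rule tree_frac_cong) (use False in \<open>auto simp: collapse_def\<close>)
    have c: "collapse i (arity t) y 0 = y 0" "collapse i (arity t) y (arity l) = y (arity l)"
      "collapse i (arity t) y (arity l + arity r) = y (arity l + (arity r + arity t - 1))"
      using False q Node.prems by (auto simp: collapse_def algebra_simps intro!: arg_cong[of _ _ y])
    have e: "arity l + (i - arity l - 1) = i - 1" "\<And>j. arity l + (i - arity l - 1 + j) = i - 1 + j"
      using False by auto
    show ?thesis using False by (simp add: ar IH[unfolded e] r l c)
  qed
qed

definition free_value :: "nat \<Rightarrow> (dtree \<Rightarrow>\<^sub>0 rat) \<Rightarrow> (nat \<Rightarrow> real) \<Rightarrow> real" where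
  "free_value m x y = (\<Sum>t\<in>Poly_Mapping.keys x. if arity t = m then of_rat (Poly_Mapping.lookup x t) * tree_frac t y else 0)"

lemma free_value_superset:
  assumes "finite A" "Poly_Mapping.keys x \<subseteq> A"
  shows "free_value m x y = (\<Sum>t\<in>A. if arity t = m then of_rat (Poly_Mapping.lookup x t) * tree_frac t y else 0)"
  unfolding free_value_def using assms by (intro sum.mono_neutral_left) (auto simp: in_keys_iff)

lemma free_value_single: "free_value m (Poly_Mapping.single t c) y = (if arity t = m then of_rat c * tree_frac t y else 0)"
  by (subst free_value_superset[of "{t}"]) auto

lemma free_value_0: "free_value m 0 y = 0" by (simp add: free_value_def)

lemma free_value_add: "free_value m (x + x') y = free_value m x y + free_value m x' y"
proof -
  define A where "A = Poly_Mapping.keys x \<union> Poly_Mapping.keys x' \<union> Poly_Mapping.keys (x + x')"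
  have s: "free_value m z y = (\<Sum>t\<in>A. if arity t = m then of_rat (Poly_Mapping.lookup z t) * tree_frac t y else 0)"
    if "Poly_Mapping.keys z \<subseteq> A" for z
    by (rule free_value_superset) (use that in \<open>simp_all add: A_def\<close>)
  have "Poly_Mapping.keys x \<subseteq> A" "Poly_Mapping.keys x' \<subseteq> A" "Poly_Mapping.keys (x + x') \<subseteq> A"
    by (auto simp: A_def)
  from this[THEN s] show ?thesis
    by (simp only: sum.distrib[symmetric]) (rule sum.cong[OF refl], simp add: lookup_add of_rat_add distrib_right)
qed

lemma free_value_scale: "free_value m (free_scale c x) y = of_rat c * free_value m x y"
proof -
  have "finite (Poly_Mapping.keys x \<union> Poly_Mapping.keys (free_scale c x))" by auto
  note s = free_value_superset[OF this]
  show ?thesis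
    by (subst (1 2) s) (auto simp: lookup_free_scale of_rat_mult algebra_simps sum_distrib_left intro!: sum.cong)
qed

lemma free_value_diff: "free_value m (x - x') y = free_value m x y - free_value m x' y"
  using free_value_add[of m "x - x'" x' y] by simp

lemma free_value_sum: "free_value m (sum f A) y = (\<Sum>a\<in>A. free_value m (f a) y)"
  by (induction A rule: infinite_finite_induct) (auto simp: free_value_0 free_value_add)

lemma free_value_comp:
  assumes y: "inj_on y {..m}"
  shows "free_value m (free_comp i x z) y =
    (\<Sum>s\<in>Poly_Mapping.keys x. \<Sum>t\<in>Poly_Mapping.keys z.
       if 1 \<le> i \<and> i \<le> arity s \<and> arity s + arity t = m + 1
       then of_rat (Poly_Mapping.lookup x s) * tree_frac s (collapse i (arity t) y) *
         (of_rat (Poly_Mapping.lookup z t) * tree_frac t (\<lambda>j. y (i - 1 + j))) * (y (i - 1) - y (i - 1 + arity t)) else 0)"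
  unfolding free_comp_def free_value_sum
proof (intro sum.cong refl)
  fix s t
  have a: "1 \<le> i \<Longrightarrow> i \<le> arity s \<Longrightarrow> arity (graft s i t) = m \<longleftrightarrow> arity s + arity t = m + 1"
    using arity_graft[of i s t] by auto
  show "free_value m (if 1 \<le> i \<and> i \<le> arity s
          then Poly_Mapping.single (graft s i t) (Poly_Mapping.lookup x s * Poly_Mapping.lookup z t) else 0) y =
    (if 1 \<le> i \<and> i \<le> arity s \<and> arity s + arity t = m + 1
       then of_rat (Poly_Mapping.lookup x s) * tree_frac s (collapse i (arity t) y) *
         (of_rat (Poly_Mapping.lookup z t) * tree_frac t (\<lambda>j. y (i - 1 + j))) * (y (i - 1) - y (i - 1 + arity t)) else 0)"
    using y tree_frac_graft[of i s y t] by (auto simp: free_value_0 free_value_single a of_rat_mult)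
qed

lemma inj_collapse:
  assumes "inj_on y {..m}" "q \<ge> 1" "p + q = m + 1"
  shows "inj_on (collapse i q y) {..p}"
proof (rule inj_onI)
  fix a b assume ab: "a \<in> {..p}" "b \<in> {..p}" "collapse i q y a = collapse i q y b"
  define f where "f = (\<lambda>j. if j < i then j else j + q - 1)"
  have "y (f a) = y (f b)" using ab(3) unfolding collapse_def f_def by (auto split: if_splits)
  moreover have "f a \<le> m" "f b \<le> m" using ab assms unfolding f_def by auto
  ultimately have "f a = f b" using assms(1) by (auto simp: inj_on_def)
  then show "a = b" using assms(2) unfolding f_def by (auto split: if_splits)
qed

text \<open>
  The relators vanish by an identity of fractions in four different points. Composition
  preserves this, because the value of a composite is the value of one factor at a subset of the
  points times a quantity that depends on the other factor only.
\<close>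

lemma free_value_ideal:
  assumes "x \<in> dend_ideal" "inj_on y {..m}"
  shows "free_value m x y = 0"
  using assms
proof (induction arbitrary: m y rule: dend_ideal.induct)
  case rel1
  have "y 0 \<noteq> y 1" "y 0 \<noteq> y 2" "y 0 \<noteq> y 3" "y 1 \<noteq> y 2" "y 1 \<noteq> y 3" "y 2 \<noteq> y 3" if "m = 3"
    using rel1 that by (auto dest: inj_onD)
  then show ?case
    by (auto simp: free_gen_def free_comp_add_right free_comp_single free_value_diff free_value_add free_value_single
        eval_nat_numeral divide_simps)
next
  case rel2
  have "y 0 \<noteq> y 1" "y 0 \<noteq> y 2" "y 0 \<noteq> y 3" "y 1 \<noteq> y 2" "y 1 \<noteq> y 3" "y 2 \<noteq> y 3" if "m = 3"
    using rel2 that by (auto dest: inj_onD)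
  then show ?case
    by (auto simp: free_gen_def free_comp_add_right free_comp_single free_value_diff free_value_add free_value_single
        eval_nat_numeral divide_simps)
next
  case rel3
  have "y 0 \<noteq> y 1" "y 0 \<noteq> y 2" "y 0 \<noteq> y 3" "y 1 \<noteq> y 2" "y 1 \<noteq> y 3" "y 2 \<noteq> y 3" if "m = 3"
    using rel3 that by (auto dest: inj_onD)
  then show ?case
    by (auto simp: free_gen_def free_comp_add_right free_comp_single free_value_diff free_value_add free_value_single
        eval_nat_numeral divide_simps)
next
  case (comp_left x i z)
  show ?case unfolding free_value_comp[OF comp_left.prems]
  proof (subst sum.swap, rule sum.neutral, rule ballI)
    fix t
    let ?q = "arity t" let ?p = "m + 1 - arity t" let ?c = "collapse i (arity t) y"
    have *: "free_value ?p x ?c = 0" if "?q \<le> m + 1"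
      by (rule comp_left.IH, rule inj_collapse[OF comp_left.prems]) (use arity_pos[of t] that in auto)
    have "(\<Sum>s\<in>Poly_Mapping.keys x. if 1 \<le> i \<and> i \<le> arity s \<and> arity s + arity t = m + 1
       then of_rat (Poly_Mapping.lookup x s) * tree_frac s ?c *
         (of_rat (Poly_Mapping.lookup z t) * tree_frac t (\<lambda>j. y (i - 1 + j))) * (y (i - 1) - y (i - 1 + arity t)) else 0)
      = (if 1 \<le> i \<and> i \<le> ?p \<and> ?q \<le> m + 1 then free_value ?p x ?c * ((of_rat (Poly_Mapping.lookup z t) * tree_frac t (\<lambda>j. y (i - 1 + j))) * (y (i - 1) - y (i - 1 + arity t))) else 0)"
      unfolding free_value_def
      by (cases "1 \<le> i \<and> i \<le> ?p \<and> ?q \<le> m + 1") (auto simp: sum_distrib_right intro!: sum.cong sum.neutral)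
    then show "(\<Sum>s\<in>Poly_Mapping.keys x. if 1 \<le> i \<and> i \<le> arity s \<and> arity s + arity t = m + 1
       then of_rat (Poly_Mapping.lookup x s) * tree_frac s ?c *
         (of_rat (Poly_Mapping.lookup z t) * tree_frac t (\<lambda>j. y (i - 1 + j))) * (y (i - 1) - y (i - 1 + arity t)) else 0) = 0"
      using * by auto
  qed
next
  case (comp_right x i z)
  show ?case unfolding free_value_comp[OF comp_right.prems]
  proof (rule sum.neutral, rule ballI)
    fix s
    let ?q = "m + 1 - arity s"
    have *: "free_value ?q x (\<lambda>j. y (i - 1 + j)) = 0" if "1 \<le> i" "i \<le> arity s" and le: "arity s \<le> m + 1"
      by (rule comp_right.IH) (rule inj_shift[OF comp_right.prems], use arity_pos[of s] that le in auto)
    have "(\<Sum>t\<in>Poly_Mapping.keys x. if 1 \<le> i \<and> i \<le> arity s \<and> arity s + arity t = m + 1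
       then of_rat (Poly_Mapping.lookup z s) * tree_frac s (collapse i (arity t) y) *
         (of_rat (Poly_Mapping.lookup x t) * tree_frac t (\<lambda>j. y (i - 1 + j))) * (y (i - 1) - y (i - 1 + arity t)) else 0)
      = (if 1 \<le> i \<and> i \<le> arity s \<and> arity s \<le> m + 1 then (of_rat (Poly_Mapping.lookup z s) * tree_frac s (collapse i ?q y) * (y (i - 1) - y (i - 1 + ?q))) * free_value ?q x (\<lambda>j. y (i - 1 + j)) else 0)"
      unfolding free_value_def
      by (cases "1 \<le> i \<and> i \<le> arity s \<and> arity s \<le> m + 1") (auto simp: sum_distrib_left intro!: sum.cong sum.neutral)
    then show "(\<Sum>t\<in>Poly_Mapping.keys x. if 1 \<le> i \<and> i \<le> arity s \<and> arity s + arity t = m + 1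
       then of_rat (Poly_Mapping.lookup z s) * tree_frac s (collapse i (arity t) y) *
         (of_rat (Poly_Mapping.lookup x t) * tree_frac t (\<lambda>j. y (i - 1 + j))) * (y (i - 1) - y (i - 1 + arity t)) else 0) = 0"
      using * by auto
  qed
qed (auto simp: free_value_0 free_value_add free_value_scale)

text \<open>
  The fractions satisfy the dendriform relations only where the denominators do not vanish, hence
  the default value \<open>0\<close> at the other points.
\<close>

lift_definition dend_value :: "nat \<Rightarrow> dend \<Rightarrow> (nat \<Rightarrow> real) \<Rightarrow> real" is
  "\<lambda>m x y. if inj_on y {..m} then free_value m x y else 0"
proof -
  fix m and x x' :: "dtree \<Rightarrow>\<^sub>0 rat"
  assume "x - x' \<in> dend_ideal"
  then show "(\<lambda>y. if inj_on y {..m} then free_value m x y else 0) = (\<lambda>y. if inj_on y {..m} then free_value m x' y else 0)"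
    using free_value_ideal by (fastforce simp: free_value_diff)
qed

lemma dend_value_add: "dend_value m (x + z) y = dend_value m x y + dend_value m z y"
  by transfer (simp add: free_value_add)

lemma dend_value_scale: "dend_value m (dend_scale c x) y = of_rat c * dend_value m x y"
  by transfer (simp add: free_value_scale)

lemma dend_value_zero: "dend_value m 0 y = 0"
  by transfer (simp add: free_value_0)

lemma dend_value_sum: "dend_value m (sum f A) y = (\<Sum>a\<in>A. dend_value m (f a) y)"
  by (induction A rule: infinite_finite_induct) (auto simp: dend_value_zero dend_value_add)

lemma dend_value_uminus: "dend_value m (- x) y = - dend_value m x y"
  using dend_value_add[of m x "- x" y] by (simp add: dend_value_zero)

lemma dend_value_diff: "dend_value m (x - z) y = dend_value m x y - dend_value m z y"
  using dend_value_add[of m "x - z" z y] by simp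

lemma dend_value_class: "inj_on y {..arity t} \<Longrightarrow> dend_value (arity t) (tree_class t) y = tree_frac t y"
  by transfer (simp add: free_value_single)

lemma dend_value_comp:
  assumes "x \<in> Dend p" "z \<in> Dend q" "1 \<le> i" "i \<le> p" "inj_on y {..p + q - 1}" "p \<ge> 1" "q \<ge> 1"
  shows "dend_value (p + q - 1) (dend_comp i x z) y = dend_value p x (collapse i q y) * dend_value q z (\<lambda>j. y (i - 1 + j)) * (y (i - 1) - y (i - 1 + q))"
proof -
  obtain a b where a: "a \<in> free_component p" "x = abs_dend a" and b: "b \<in> free_component q" "z = abs_dend b"
    using assms unfolding Dend_def by auto
  have i1: "inj_on (collapse i q y) {..p}" by (rule inj_collapse) (use assms in auto)
  have i2: "inj_on (\<lambda>j. y (i - 1 + j)) {..q}" by (rule inj_shift[OF assms(5)]) (use assms in auto)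
  have "free_value (p + q - 1) (free_comp i a b) y =
     (\<Sum>s\<in>Poly_Mapping.keys a. \<Sum>t\<in>Poly_Mapping.keys b.
        (if arity s = p then of_rat (Poly_Mapping.lookup a s) * tree_frac s (collapse i q y) else 0) *
        (if arity t = q then of_rat (Poly_Mapping.lookup b t) * tree_frac t (\<lambda>j. y (i - 1 + j)) else 0) * (y (i - 1) - y (i - 1 + q)))"
    unfolding free_value_comp[OF assms(5)] using a(1) b(1) assms
    by (intro sum.cong refl) (auto simp: free_component_def)
  also have "\<dots> = free_value p a (collapse i q y) * free_value q b (\<lambda>j. y (i - 1 + j)) * (y (i - 1) - y (i - 1 + q))"
    unfolding free_value_def sum_product by (simp add: sum_distrib_right)
  finally show ?thesis using i1 i2 assms(5) by (simp add: a b dend_comp.abs_eq dend_value.abs_eq)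
qed

lemma dend_value_cong: "(\<And>j. j \<le> m \<Longrightarrow> y j = z j) \<Longrightarrow> dend_value m x y = dend_value m x z"
proof (transfer fixing: m y z)
  fix x :: "dtree \<Rightarrow>\<^sub>0 rat"
  assume yz: "\<And>j. j \<le> m \<Longrightarrow> y j = z j"
  have "inj_on y {..m} \<longleftrightarrow> inj_on z {..m}" by (rule inj_on_cong) (use yz in auto)
  moreover have "free_value m x y = free_value m x z"
    unfolding free_value_def by (intro sum.cong refl) (use yz in \<open>auto intro!: tree_frac_cong\<close>)
  ultimately show "(if inj_on y {..m} then free_value m x y else 0) = (if inj_on z {..m} then free_value m x z else 0)" by simp
qed

definition rot :: "nat \<Rightarrow> (nat \<Rightarrow> real) \<Rightarrow> nat \<Rightarrow> real" where
  "rot m y j = (if j < m then y (j + 1) else y 0)"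

lemma inj_rot: assumes "inj_on y {..m}" shows "inj_on (rot m y) {..m}"
proof (rule inj_onI)
  fix a b assume ab: "a \<in> {..m}" "b \<in> {..m}" "rot m y a = rot m y b"
  define f where "f = (\<lambda>j. if j < m then j + 1 else 0)"
  have "y (f a) = y (f b)" using ab(3) by (auto simp: rot_def f_def)
  moreover have "f a \<le> m" "f b \<le> m" by (auto simp: f_def)
  ultimately have "f a = f b" using assms by (auto dest: inj_onD)
  then show "a = b" using ab by (auto simp: f_def split: if_splits)
qed

context
  fixes \<tau> assumes ac: "anticyclic_structure \<tau>"
begin

lemma tau_linear: "Vector_Spaces.linear dend_scale dend_scale \<tau>"
  using ac by (simp add: anticyclic_structure_def)

lemma tau_Dend: "m \<ge> 1 \<Longrightarrow> x \<in> Dend m \<Longrightarrow> \<tau> x \<in> Dend m"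
  using ac by (auto simp: anticyclic_structure_def)

lemma tau_comp:
  assumes "x \<in> Dend p" "y \<in> Dend q" "p \<ge> 1" "q \<ge> 1"
  shows "1 \<le> i \<Longrightarrow> i < p \<Longrightarrow> \<tau> (dend_comp i x y) = dend_comp (i + 1) (\<tau> x) y"
    and "\<tau> (dend_comp p x y) = - dend_comp 1 (\<tau> y) (\<tau> x)"
proof -
  have *: "\<forall>p\<ge>1. \<forall>q\<ge>1. \<forall>x \<in> Dend p. \<forall>y \<in> Dend q.
        (\<forall>i. 1 \<le> i \<and> i \<le> p - 1 \<longrightarrow> \<tau> (dend_comp i x y) = dend_comp (i + 1) (\<tau> x) y) \<and>
        \<tau> (dend_comp p x y) = - dend_comp 1 (\<tau> y) (\<tau> x)"
    using ac unfolding anticyclic_structure_def by blast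
  then show "\<tau> (dend_comp p x y) = - dend_comp 1 (\<tau> y) (\<tau> x)" using assms by blast
  assume "1 \<le> i" "i < p"
  then have "1 \<le> i \<and> i \<le> p - 1" by auto
  then show "\<tau> (dend_comp i x y) = dend_comp (i + 1) (\<tau> x) y" using * assms by blast
qed

lemma dend_value_tau_gen:
  assumes "inj_on y {..2}"
  shows "(y 1 - y 2) * (y 2 - y 0) * dend_value 2 (\<tau> (dend_gen g)) y = corner g (y 1) (y 2) (y 0)"
proof -
  have d: "y 0 \<noteq> y 1" "y 0 \<noteq> y 2" "y 1 \<noteq> y 2" using assms by (auto dest: inj_onD)
  have "dend_value 2 (dend_gen g) y = tree_frac (Node g Leaf Leaf) y" for g
    unfolding dend_gen_eq using dend_value_class[of y "Node g Leaf Leaf"] assms by (simp add: numeral_2_eq_2)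
  from this[of GPrec] this[of GSucc]
  have e: "dend_value 2 dend_prec y = 1 / ((y 1 - y 2) * (y 0 - y 2))" "dend_value 2 dend_succ y = 1 / ((y 0 - y 1) * (y 0 - y 2))"
    using d unfolding dend_gen_simps by (auto simp: numeral_2_eq_2 divide_simps) (auto simp: algebra_simps)
  have t: "\<tau> dend_prec = dend_succ" "\<tau> dend_succ = - (dend_prec + dend_succ)"
    using ac by (auto simp: anticyclic_structure_def)
  show ?thesis
  proof (cases g)
    case GPrec
    show ?thesis using d unfolding GPrec dend_gen_simps t
      by (simp add: e divide_simps) (simp add: algebra_simps)
  next
    case GSucc
    show ?thesis using d unfolding GSucc dend_gen_simps t
      by (simp add: e dend_value_uminus dend_value_diff dend_value_add divide_simps)
        (simp add: algebra_simps)
  qed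
qed

text \<open>
  Write \<open>Node g l r\<close> as \<open>(g \<circ>\<^sub>2 r) \<circ>\<^sub>1 l\<close>. The axioms give \<open>- (\<tau> r \<circ>\<^sub>1 \<tau> g) \<circ>\<^sub>2 l\<close> for its
  image: the two polygons and the triangle have been rotated as one figure. The sign is that of
  the side shared by \<open>r\<close> and the triangle, whose direction is reversed.
\<close>

lemma dend_value_tau_class:
  "inj_on y {..arity t} \<Longrightarrow> dend_value (arity t) (\<tau> (tree_class t)) y = tree_frac t (rot (arity t) y)"
proof (induction t arbitrary: y)
  case Leaf
  have "tree_class Leaf = dend_unit" by transfer (simp add: dend_ideal.zero)
  moreover have "\<tau> dend_unit = - dend_unit" using ac by (simp add: anticyclic_structure_def)
  moreover have "y 0 \<noteq> y 1" using Leaf by (auto dest: inj_onD)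
  ultimately show ?case using dend_value_class[of y Leaf] Leaf
    by (simp add: dend_value_uminus rot_def divide_simps) (simp add: algebra_simps)
next
  case (Node g l r)
  let ?p = "arity l" and ?q = "arity r"
  note pos = arity_pos[of l] arity_pos[of r]
  have g: "dend_gen g \<in> Dend 2" unfolding dend_gen_eq using tree_class_in_Dend[of "Node g Leaf Leaf"] by (simp add: numeral_2_eq_2)
  note lD = tree_class_in_Dend[of l] and rD = tree_class_in_Dend[of r]
  let ?X = "dend_comp 2 (dend_gen g) (tree_class r)"
  have X: "?X \<in> Dend (?q + 1)" using dend_comp_in_Dend[OF g rD, of 2] by (simp add: add.commute)
  have tg: "\<tau> (dend_gen g) \<in> Dend 2" and tr: "\<tau> (tree_class r) \<in> Dend ?q"
    using tau_Dend g rD pos by auto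
  let ?Y = "dend_comp 1 (\<tau> (tree_class r)) (\<tau> (dend_gen g))"
  have Y: "?Y \<in> Dend (?q + 1)" using dend_comp_in_Dend[OF tr tg, of 1] pos by simp
  have tX: "\<tau> ?X = - ?Y" using tau_comp(2)[OF g rD] pos by simp
  have "tree_class (Node g l r) = dend_comp 1 ?X (tree_class l)"
    using dmul_class[of g l r] by (simp add: dmul_def)
  also have "\<tau> \<dots> = dend_comp 2 (- ?Y) (tree_class l)"
    using tau_comp(1)[OF X lD, of 1] pos tX by (simp add: numeral_2_eq_2)
  also have "\<dots> = - dend_comp 2 ?Y (tree_class l)"
  proof -
    interpret l2: Vector_Spaces.linear dend_scale dend_scale "\<lambda>x. dend_comp 2 x (tree_class l)" by (rule dend_comp_linear_left)
    show ?thesis by (rule l2.neg)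
  qed
  finally have t: "\<tau> (tree_class (Node g l r)) = - dend_comp 2 ?Y (tree_class l)" .
  let ?z = "collapse 2 ?p y"
  have inj: "inj_on y {..?p + ?q}" using Node.prems by simp
  have injz: "inj_on ?z {..?q + 1}" by (rule inj_collapse[OF inj]) (use pos in auto)
  have 1: "dend_value (?p + ?q) (dend_comp 2 ?Y (tree_class l)) y
     = dend_value (?q + 1) ?Y ?z * dend_value ?p (tree_class l) (\<lambda>j. y (1 + j)) * (y 1 - y (1 + ?p))"
    using dend_value_comp[OF Y lD, of 2 y] pos inj by (simp add: add.commute)
  have 2: "dend_value (?q + 1) ?Y ?z = dend_value ?q (\<tau> (tree_class r)) (collapse 1 2 ?z) * dend_value 2 (\<tau> (dend_gen g)) ?z * (?z 0 - ?z 2)"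
    using dend_value_comp[OF tr tg, of 1 ?z] pos injz by (simp add: numeral_2_eq_2)
  have l: "dend_value ?p (tree_class l) (\<lambda>j. y (1 + j)) = tree_frac l (\<lambda>j. y (1 + j))"
    by (rule dend_value_class) (rule inj_shift[OF inj], use pos in auto)
  have r: "dend_value ?q (\<tau> (tree_class r)) (collapse 1 2 ?z) = tree_frac r (rot ?q (collapse 1 2 ?z))"
    by (rule Node.IH, rule inj_collapse[OF injz]) (use pos in auto)
  have r': "tree_frac r (rot ?q (collapse 1 2 ?z)) = tree_frac r (\<lambda>j. rot (?p + ?q) y (?p + j))"
    by (rule tree_frac_cong) (use pos in \<open>auto simp: rot_def collapse_def add.commute intro!: arg_cong[of _ _ y]\<close>)
  have l': "tree_frac l (\<lambda>j. y (1 + j)) = tree_frac l (rot (?p + ?q) y)"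
    by (rule tree_frac_cong) (use pos in \<open>auto simp: rot_def\<close>)
  have z: "?z 0 = y 0" "?z 1 = y 1" "?z 2 = y (1 + ?p)" using pos by (auto simp: collapse_def)
  have zz: "(y 1 - y (1 + ?p)) * (y (1 + ?p) - y 0) * dend_value 2 (\<tau> (dend_gen g)) ?z = corner g (y 1) (y (1 + ?p)) (y 0)"
    using dend_value_tau_gen[of ?z g, OF inj_on_subset[OF injz]] pos unfolding z by auto
  have w: "rot (?p + ?q) y 0 = y 1" "rot (?p + ?q) y ?p = y (1 + ?p)" "rot (?p + ?q) y (?p + ?q) = y 0"
    using pos by (auto simp: rot_def)
  have "dend_value (?p + ?q) (\<tau> (tree_class (Node g l r))) y =
     tree_frac l (rot (?p + ?q) y) * tree_frac r (\<lambda>j. rot (?p + ?q) y (?p + j)) * ((y 1 - y (1 + ?p)) * (y (1 + ?p) - y 0) * dend_value 2 (\<tau> (dend_gen g)) ?z)"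
    unfolding t dend_value_uminus 1 2 l r r' l' z by (simp add: algebra_simps)
  also have "\<dots> = tree_frac (Node g l r) (rot (?p + ?q) y)" unfolding zz by (simp add: w)
  finally show ?case by simp
qed

lemma dend_value_tau:
  assumes "x \<in> Dend m" "inj_on y {..m}"
  shows "dend_value m (\<tau> x) y = dend_value m x (rot m y)"
proof -
  interpret l: Vector_Spaces.linear dend_scale dend_scale \<tau> by (rule tau_linear)
  show ?thesis using assms(1) unfolding Dend_eq_span
  proof (induction rule: dend.span_induct_alt)
    case base then show ?case by (simp add: l.zero dend_value_zero)
  next
    case (step c b a)
    then obtain t where "b = tree_class t" "arity t = m" by auto
    then have "dend_value m (\<tau> b) y = dend_value m b (rot m y)"
      using dend_value_tau_class[of y t] dend_value_class[of "rot m y" t] inj_rot assms(2) by simp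
    then show ?case using step by (simp add: l.add l.scale dend_value_add dend_value_scale)
  qed
qed

end

section \<open>Fractions of binary trees\<close>

fun btree_frac :: "btree \<Rightarrow> (nat \<Rightarrow> real) \<Rightarrow> real" where
  "btree_frac Tip y = 1"
| "btree_frac (Join l r) y = btree_frac l y * btree_frac r (\<lambda>j. y (tips l + j)) / (y 0 - y (tips l + tips r - 1))"

lemma btree_frac_cong: "(\<And>j. j < tips b \<Longrightarrow> y j = z j) \<Longrightarrow> btree_frac b y = btree_frac b z"
proof (induction b arbitrary: y z)
  case (Join l r)
  have "btree_frac l y = btree_frac l z" by (rule Join.IH) (use Join.prems in auto)
  moreover have "btree_frac r (\<lambda>j. y (tips l + j)) = btree_frac r (\<lambda>j. z (tips l + j))"
    by (rule Join.IH) (use Join.prems in auto)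
  ultimately show ?case using Join.prems tips_pos[of l] tips_pos[of r] by simp
qed simp

lemma btree_frac_translate: "btree_frac b (\<lambda>j. y j + t) = btree_frac b y"
  by (induction b arbitrary: y) auto

text \<open>
  In \<open>(l \<succ> Y) \<prec> r\<close> the numerator of the corner of \<open>\<succ>\<close> cancels the fraction of \<open>Y\<close>, and the
  numerator of the corner of \<open>\<prec>\<close> cancels the denominator of the corner of \<open>\<succ>\<close>.
\<close>

lemma tree_frac_nf_tree:
  assumes "b \<noteq> Tip" "inj_on y {..<tips b}"
  shows "tree_frac (nf_tree b) y = btree_frac b y"
  using assms
proof (induction b arbitrary: y)
  case (Join l r)
  note pos = tips_pos[of l] tips_pos[of r]
  have ne: "y i \<noteq> y j" if "i < tips l + tips r" "j < tips l + tips r" "i \<noteq> j" for i j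
    using Join.prems that by (auto dest: inj_onD)
  have ar: "arity (half l) = tips l"
    using arity_nf_tree[of l] by auto
  have half: "tree_frac (half l) y = btree_frac l y / (y 0 - y (tips l))" if "tips l < tips l + tips r"
  proof (cases "l = Tip")
    case False
    have "tree_frac (nf_tree l) y = btree_frac l y"
      by (rule Join.IH(1)) (use False Join.prems in \<open>auto elim!: inj_on_subset\<close>)
    moreover have "y (arity (nf_tree l)) \<noteq> y (arity (nf_tree l) + 1)"
      using False arity_nf_tree[of l] that by (intro ne) auto
    ultimately show ?thesis using False arity_nf_tree[of l] by simp
  qed simp
  show ?case
  proof (cases "r = Tip")
    case True
    then show ?thesis using half by (simp add: nf_tree_Join del: nf_tree.simps)
  next
    case False
    have "tree_frac (nf_tree r) (\<lambda>j. y (tips l + j)) = btree_frac r (\<lambda>j. y (tips l + j))"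
    proof (rule Join.IH(2)[OF False], rule inj_onI)
      fix a b assume "a \<in> {..<tips r}" "b \<in> {..<tips r}" "y (tips l + a) = y (tips l + b)"
      then show "a = b" using ne[of "tips l + a" "tips l + b"] by auto
    qed
    moreover have "y 0 \<noteq> y (tips l)" using pos by (intro ne) auto
    moreover have "tips l + arity (nf_tree r) = tips l + tips r - 1"
      using arity_nf_tree[OF False] by simp
    ultimately show ?thesis using False half pos
      by (simp add: nf_tree_Join ar del: nf_tree.simps)
  qed
qed simp

lemma dend_value_nf:
  assumes "b \<noteq> Tip" "tips b = m + 1" "inj_on y {..m}"
  shows "dend_value m (nf b) y = btree_frac b y"
proof -
  have a: "arity (nf_tree b) = m" using arity_nf_tree[OF assms(1)] assms(2) by simp
  have "dend_value m (nf b) y = tree_frac (nf_tree b) y"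
    using dend_value_class[of y "nf_tree b"] assms(3) unfolding a by simp
  also have "\<dots> = btree_frac b y"
    by (rule tree_frac_nf_tree) (use assms in \<open>simp_all add: lessThan_Suc_atMost\<close>)
  finally show ?thesis .
qed

definition btrees :: "nat \<Rightarrow> btree set" where "btrees n = {b. tips b = n}"

lemma btrees_0: "btrees 0 = {}"
proof -
  have "tips b \<noteq> 0" for b using tips_pos[of b] by simp
  then show ?thesis by (simp add: btrees_def)
qed

lemma btrees_1: "btrees (Suc 0) = {Tip}"
proof -
  have "tips b = Suc 0 \<longleftrightarrow> b = Tip" for b
  proof (cases b)
    case (Join l r)
    then show ?thesis using tips_pos[of l] tips_pos[of r] by auto
  qed auto
  then show ?thesis by (auto simp: btrees_def)
qed

lemma btrees_rec:
  assumes "n \<ge> 2"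
  shows "btrees n = (\<lambda>(p, l, r). Join l r) ` (SIGMA p:{1..<n}. btrees p \<times> btrees (n - p))"
proof (intro equalityI subsetI)
  fix b assume "b \<in> btrees n"
  then obtain l r where b: "b = Join l r" "tips l + tips r = n" using assms by (cases b) (auto simp: btrees_def)
  then show "b \<in> (\<lambda>(p, l, r). Join l r) ` (SIGMA p:{1..<n}. btrees p \<times> btrees (n - p))"
    using tips_pos[of l] tips_pos[of r]
    by (intro image_eqI[of _ _ "(tips l, l, r)"]) (auto simp: btrees_def)
qed (auto simp: btrees_def)

lemma finite_btrees: "finite (btrees n)"
proof (induction n rule: less_induct)
  case (less n)
  show ?case
  proof (cases "n \<ge> 2")
    case True
    have "finite (SIGMA p:{1..<n}. btrees p \<times> btrees (n - p))"
      using less by (intro finite_SigmaI finite_cartesian_product) auto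
    then show ?thesis unfolding btrees_rec[OF True] by (rule finite_imageI)
  next
    case False
    then have "n = 0 \<or> n = Suc 0" by auto
    then show ?thesis by (auto simp: btrees_0 btrees_1)
  qed
qed

lemma sum_btrees:
  fixes f :: "btree \<Rightarrow> 'c::comm_monoid_add"
  assumes "n \<ge> 2"
  shows "sum f (btrees n) = (\<Sum>p\<in>{1..<n}. \<Sum>l\<in>btrees p. \<Sum>r\<in>btrees (n - p). f (Join l r))"
proof -
  have inj: "inj_on (\<lambda>(p, l, r). Join l r) (SIGMA p:{1..<n}. btrees p \<times> btrees (n - p))"
    by (auto simp: inj_on_def btrees_def)
  have "sum f (btrees n) = (\<Sum>(p, l, r)\<in>(SIGMA p:{1..<n}. btrees p \<times> btrees (n - p)). f (Join l r))"
    unfolding btrees_rec[OF assms] by (subst sum.reindex[OF inj]) (simp add: case_prod_unfold)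
  also have "\<dots> = (\<Sum>p\<in>{1..<n}. \<Sum>(l, r)\<in>btrees p \<times> btrees (n - p). f (Join l r))"
    by (subst sum.Sigma) (auto simp: finite_btrees case_prod_unfold)
  also have "\<dots> = (\<Sum>p\<in>{1..<n}. \<Sum>l\<in>btrees p. \<Sum>r\<in>btrees (n - p). f (Join l r))"
    by (simp add: sum.cartesian_product)
  finally show ?thesis .
qed

definition spread :: "nat \<Rightarrow> real \<Rightarrow> (nat \<Rightarrow> real) \<Rightarrow> nat \<Rightarrow> real" where
  "spread p t y j = (if j < p then y j else y j + t)"

text \<open>
  The root factor has a denominator that tends to infinity if the cut \<open>p\<close> is inside
  the tree. Otherwise all points move together, or none does.
\<close>

lemma btree_frac_spread_tendsto:
  "((\<lambda>t. btree_frac b (spread p t y)) \<longlongrightarrow> (if 0 < p \<and> p < tips b then 0 else btree_frac b y)) at_top"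
proof (induction b arbitrary: p y)
  case Tip
  show ?case by (cases "p = 0") simp_all
next
  case (Join l r)
  note pos = tips_pos[of l] tips_pos[of r]
  let ?n = "tips l + tips r"
  consider "p = 0" | "p \<ge> ?n" | "0 < p" "p < ?n" by linarith
  then show ?case
  proof cases
    case 1
    have "btree_frac (Join l r) (spread p t y) = btree_frac (Join l r) (\<lambda>j. y j + t)" for t
      by (rule btree_frac_cong) (simp add: spread_def 1)
    then show ?thesis using btree_frac_translate[of "Join l r" y] 1 by (simp del: btree_frac.simps)
  next
    case 2
    have "btree_frac (Join l r) (spread p t y) = btree_frac (Join l r) y" for t
      by (rule btree_frac_cong) (use 2 in \<open>simp add: spread_def\<close>)
    then show ?thesis using 2 by (simp del: btree_frac.simps)
  next
    case 3
    have r: "(\<lambda>j. spread p t y (tips l + j)) = spread (p - tips l) t (\<lambda>j. y (tips l + j))" for t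
      by (auto simp: spread_def fun_eq_iff)
    obtain L1 L2 where L: "((\<lambda>t. btree_frac l (spread p t y)) \<longlongrightarrow> L1) at_top"
       "((\<lambda>t. btree_frac r (\<lambda>j. spread p t y (tips l + j))) \<longlongrightarrow> L2) at_top"
      unfolding r using Join.IH by blast
    have "filterlim (\<lambda>t. (y 0 - y (?n - 1)) + - t) at_bot at_top"
      by (rule iffD2[OF filterlim_tendsto_add_at_bot_iff[OF tendsto_const] filterlim_uminus_at_bot_at_top])
    then have "filterlim (\<lambda>t. y 0 - (y (?n - 1) + t)) at_infinity at_top"
      by (intro filterlim_mono[OF _ at_bot_le_at_infinity order_refl]) (simp add: algebra_simps)
    then have "((\<lambda>t. btree_frac l (spread p t y) * btree_frac r (\<lambda>j. spread p t y (tips l + j)) / (y 0 - (y (?n - 1) + t))) \<longlongrightarrow> 0) at_top"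
      by (rule tendsto_divide_0[OF tendsto_mult[OF L]])
    moreover have "spread p t y 0 = y 0" "spread p t y (?n - 1) = y (?n - 1) + t" for t
      using 3 by (auto simp: spread_def)
    ultimately show ?thesis using 3 by simp
  qed
qed

text \<open>
  Cancel the root factor, which is common to all trees with \<open>n\<close> tips, and move the points from
  number \<open>p\<close> on to infinity: only the trees whose left subtree has \<open>p\<close> tips survive. For these
  the left and the right subtrees involve different points, so induction applies to
  both.
\<close>

lemma btree_frac_independent:
  assumes "\<And>y. inj_on y {..<n} \<Longrightarrow> (\<Sum>b\<in>btrees n. c b * btree_frac b y) = 0" "b \<in> btrees n"
  shows "c b = 0"
  using assms
proof (induction n arbitrary: c b rule: less_induct)
  case (less n)
  have "n \<noteq> 0" using less.prems(2) btrees_0 by (cases n) auto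
  then consider "n = Suc 0" | "n \<ge> 2" by linarith
  then show ?case
  proof cases
    case 1
    then show ?thesis using less.prems(1)[of real] less.prems(2) by (auto simp: btrees_1)
  next
    case 2
    have part: "(\<Sum>l\<in>btrees p. \<Sum>r\<in>btrees (n - p). c (Join l r) * (btree_frac l y * btree_frac r (\<lambda>j. y (p + j)))) = 0"
      if p: "p \<in> {1..<n}" and y: "inj_on y {..<n}" for p y
    proof -
      let ?F = "\<lambda>q l r z. c (Join l r) * (btree_frac l z * btree_frac r (\<lambda>j. z (q + j)))"
      let ?S = "\<lambda>t. \<Sum>q\<in>{1..<n}. \<Sum>l\<in>btrees q. \<Sum>r\<in>btrees (n - q). ?F q l r (spread p t y)"
      have "\<forall>\<^sub>F t in at_top. \<forall>a\<in>{..<n}. \<forall>b\<in>{..<n}. y a - y b < t"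
        by (intro eventually_ball_finite ballI eventually_gt_at_top) auto
      then have "\<forall>\<^sub>F t in at_top. ?S t = 0"
      proof eventually_elim
        case (elim t)
        have inj: "inj_on (spread p t y) {..<n}"
        proof (rule inj_onI)
          fix a b assume ab: "a \<in> {..<n}" "b \<in> {..<n}" "spread p t y a = spread p t y b"
          from elim ab have "y a - y b < t" "y b - y a < t" by auto
          with ab have "y a = y b" by (auto simp: spread_def split: if_splits)
          then show "a = b" using ab y by (auto dest: inj_onD)
        qed
        let ?d = "spread p t y 0 - spread p t y (n - 1)"
        have d: "?d \<noteq> 0" using inj_onD[OF inj, of 0 "n - 1"] 2 by auto
        have "0 = ?d * (\<Sum>b\<in>btrees n. c b * btree_frac b (spread p t y))" using less.prems(1)[OF inj] by simp
        also have "\<dots> = ?S t" unfolding sum_btrees[OF 2] sum_distrib_left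
        proof (intro sum.cong refl)
          fix q l r assume "q \<in> {1..<n}" "l \<in> btrees q" "r \<in> btrees (n - q)"
          then have "tips l = q" "tips l + tips r = n" by (auto simp: btrees_def)
          then show "?d * (c (Join l r) * btree_frac (Join l r) (spread p t y)) = ?F q l r (spread p t y)"
            using d by simp
        qed
        finally show ?case by simp
      qed
      then have lim0: "(?S \<longlongrightarrow> 0) at_top" by (simp add: tendsto_eventually)
      have "(?S \<longlongrightarrow> (\<Sum>q\<in>{1..<n}. \<Sum>l\<in>btrees q. \<Sum>r\<in>btrees (n - q). if q = p then ?F q l r y else 0)) at_top"
      proof (intro tendsto_sum)
        fix q l r assume q: "q \<in> {1..<n}" and lr: "l \<in> btrees q" "r \<in> btrees (n - q)"
        then have t: "tips l = q" "tips r = n - q" by (auto simp: btrees_def)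
        have r: "(\<lambda>j. spread p t y (q + j)) = spread (p - q) t (\<lambda>j. y (q + j))" for t
          by (auto simp: spread_def fun_eq_iff)
        have "((\<lambda>t. ?F q l r (spread p t y)) \<longlongrightarrow> c (Join l r) * ((if 0 < p \<and> p < tips l then 0 else btree_frac l y) *
           (if 0 < p - q \<and> p - q < tips r then 0 else btree_frac r (\<lambda>j. y (q + j))))) at_top"
          unfolding r by (intro tendsto_intros btree_frac_spread_tendsto)
        also have "c (Join l r) * ((if 0 < p \<and> p < tips l then 0 else btree_frac l y) *
           (if 0 < p - q \<and> p - q < tips r then 0 else btree_frac r (\<lambda>j. y (q + j)))) = (if q = p then ?F q l r y else 0)"
          using p q t by auto
        finally show "((\<lambda>t. ?F q l r (spread p t y)) \<longlongrightarrow> (if q = p then ?F q l r y else 0)) at_top" .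
      qed
      from tendsto_unique[OF _ lim0 this]
      have "0 = (\<Sum>q\<in>{1..<n}. \<Sum>l\<in>btrees q. \<Sum>r\<in>btrees (n - q). if q = p then ?F q l r y else 0)" by simp
      also have "\<dots> = (\<Sum>q\<in>{1..<n}. if q = p then \<Sum>l\<in>btrees q. \<Sum>r\<in>btrees (n - q). ?F q l r y else 0)"
        by (intro sum.cong refl) simp
      finally show ?thesis using p by simp
    qed
    obtain l r where b: "b = Join l r" "tips l + tips r = n"
      using less.prems(2) 2 by (cases b) (auto simp: btrees_def)
    define p where "p = tips l"
    have p: "p \<in> {1..<n}" "tips r = n - p" using b tips_pos[of l] tips_pos[of r] by (auto simp: p_def)
    have "(\<Sum>r\<in>btrees (n - p). c (Join l r) * btree_frac r y2) = 0" if y2: "inj_on y2 {..<n - p}" for y2 :: "nat \<Rightarrow> real"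
    proof (rule less.IH[of p "\<lambda>l. \<Sum>r\<in>btrees (n - p). c (Join l r) * btree_frac r y2" l])
      fix y1 :: "nat \<Rightarrow> real" assume y1: "inj_on y1 {..<p}"
      have "finite ((\<lambda>(a, b). y1 a - y2 b) ` ({..<p} \<times> {..<n - p}))" by auto
      then obtain t where t: "t \<notin> (\<lambda>(a, b). y1 a - y2 b) ` ({..<p} \<times> {..<n - p})"
        using ex_new_if_finite[OF infinite_UNIV_char_0] by blast
      define y where "y = (\<lambda>j. if j < p then y1 j else y2 (j - p) + t)"
      have t': "y1 a \<noteq> y2 b + t" if "a < p" "b < n - p" for a b
      proof
        assume "y1 a = y2 b + t"
        then have "t = y1 a - y2 b" by simp
        then show False using t that by auto
      qed
      have "inj_on y {..<n}"
      proof (rule inj_onI)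
        fix a b assume ab: "a \<in> {..<n}" "b \<in> {..<n}" "y a = y b"
        show "a = b"
        proof (cases "a < p"; cases "b < p")
          assume "a < p" "b < p" then show ?thesis using ab y1 by (auto simp: y_def dest: inj_onD)
        next
          assume "a < p" "\<not> b < p" then show ?thesis using ab t'[of a "b - p"] by (auto simp: y_def)
        next
          assume "\<not> a < p" "b < p"
          moreover from this have "a - p < n - p" using ab by auto
          ultimately show ?thesis using ab t'[of b "a - p"] by (simp add: y_def)
        next
          assume "\<not> a < p" "\<not> b < p"
          then have "a - p = b - p" using ab by (intro inj_onD[OF y2]) (auto simp: y_def)
          then show ?thesis using \<open>\<not> a < p\<close> \<open>\<not> b < p\<close> by simp
        qed
      qed
      from part[OF p(1) this]
      have "0 = (\<Sum>l\<in>btrees p. \<Sum>r\<in>btrees (n - p). c (Join l r) * (btree_frac l y * btree_frac r (\<lambda>j. y (p + j))))" by simp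
      also have "\<dots> = (\<Sum>l\<in>btrees p. (\<Sum>r\<in>btrees (n - p). c (Join l r) * btree_frac r y2) * btree_frac l y1)"
        unfolding sum_distrib_right
      proof (intro sum.cong refl)
        fix l r assume lr: "l \<in> btrees p" "r \<in> btrees (n - p)"
        have "btree_frac l y = btree_frac l y1" by (rule btree_frac_cong) (use lr in \<open>auto simp: y_def btrees_def\<close>)
        moreover have "(\<lambda>j. y (p + j)) = (\<lambda>j. y2 j + t)" by (auto simp: y_def)
        ultimately show "c (Join l r) * (btree_frac l y * btree_frac r (\<lambda>j. y (p + j))) = c (Join l r) * btree_frac r y2 * btree_frac l y1"
          by (simp add: btree_frac_translate)
      qed
      finally show "(\<Sum>l\<in>btrees p. (\<Sum>r\<in>btrees (n - p). c (Join l r) * btree_frac r y2) * btree_frac l y1) = 0" by simp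
    qed (use p in \<open>auto simp: btrees_def p_def\<close>)
    then have "c (Join l r) = 0"
      by (rule less.IH[of "n - p" "\<lambda>r. c (Join l r)" r, rotated]) (use p in \<open>auto simp: btrees_def\<close>)
    then show ?thesis by (simp add: b)
  qed
qed

section \<open>Catalan numbers\<close>

definition num_trees :: "nat \<Rightarrow> nat" where "num_trees m = card (btrees (m + 1))"

lemma num_trees_0: "num_trees 0 = 1" by (simp add: num_trees_def btrees_1)

lemma num_trees_Suc: "num_trees (Suc m) = (\<Sum>i\<le>m. num_trees i * num_trees (m - i))"
proof -
  have "num_trees (Suc m) = (\<Sum>p\<in>{1..<m + 2}. card (btrees p) * card (btrees (m + 2 - p)))"
    using sum_btrees[of "m + 2" "\<lambda>_. 1::nat"] by (simp add: num_trees_def)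
  also have "\<dots> = (\<Sum>i\<in>{..m}. card (btrees (i + 1)) * card (btrees (m - i + 1)))"
    by (rule sum.reindex_bij_witness[of _ "\<lambda>i. i + 1" "\<lambda>p. p - 1"]) (auto simp: Suc_diff_le)
  finally show ?thesis by (simp add: num_trees_def)
qed

text \<open>
  The generating function satisfies \<open>S = 1 + X S\<^sup>2\<close>, so \<open>T = 1 - 2 X S\<close> is a square root of
  \<open>1 - 4 X\<close>. Differentiation gives \<open>T S' = S\<^sup>2\<close> and then the linear differential equation
  \<open>X (1 - 4 X) S' = 1 - S + 2 X S\<close>, whose coefficients are this recurrence.
\<close>

lemma num_trees_linear_rec: "(m + 2) * num_trees (Suc m) = (4 * m + 2) * num_trees m"
proof -
  define S where "S = Abs_fps (\<lambda>m. rat_of_nat (num_trees m))"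
  let ?X = "fps_X :: rat fps"
  have S: "S = 1 + ?X * S\<^sup>2"
  proof (rule fps_ext)
    fix k show "S $ k = (1 + ?X * S\<^sup>2) $ k"
    proof (cases k)
      case (Suc m)
      have "(?X * S\<^sup>2) $ Suc m = (S * S) $ m" by (simp add: power2_eq_square)
      also have "\<dots> = S $ Suc m" by (simp add: S_def num_trees_Suc fps_mult_nth atLeast0AtMost)
      finally show ?thesis by (simp add: Suc)
    qed (simp add: S_def num_trees_0)
  qed
  define D where "D = fps_deriv S"
  have D: "D = S\<^sup>2 + ?X * (2 * S * D)"
  proof -
    have "D = fps_deriv (1 + ?X * S\<^sup>2)" unfolding D_def by (subst S) simp
    then show ?thesis by (simp add: D_def power2_eq_square algebra_simps)
  qed
  define T where "T = 1 - 2 * ?X * S"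
  have XS: "?X * S\<^sup>2 = S - 1" using S by (simp add: algebra_simps)
  have T2: "T\<^sup>2 = 1 - 4 * ?X"
  proof -
    have "T\<^sup>2 = 1 - 4 * ?X * S + 4 * ?X * (?X * S\<^sup>2)" by (simp add: T_def power2_eq_square algebra_simps)
    then show ?thesis unfolding XS by (simp add: algebra_simps)
  qed
  have TD: "T * D = S\<^sup>2"
  proof -
    have "T * D = D - ?X * (2 * S * D)" by (simp add: T_def algebra_simps)
    then show ?thesis using D by (metis add_diff_cancel_right')
  qed
  have "?X * (1 - 4 * ?X) * D = ?X * (T * (T * D))" unfolding T2[symmetric] by (simp add: power2_eq_square algebra_simps)
  also have "\<dots> = T * (?X * S\<^sup>2)" unfolding TD by (simp add: algebra_simps)
  also have "\<dots> = T * (S - 1)" unfolding XS ..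
  also have "\<dots> = (S - 1) - 2 * (?X * S\<^sup>2) + 2 * ?X * S" by (simp add: T_def power2_eq_square algebra_simps)
  also have "\<dots> = 1 - S + 2 * ?X * S" unfolding XS by (simp add: algebra_simps)
  finally have "?X * D + S = 1 + ?X * (2 * S) + ?X * (?X * (4 * D))" by (simp add: algebra_simps)
  then have "(?X * D + S) $ Suc m = (1 + ?X * (2 * S) + ?X * (?X * (4 * D))) $ Suc m" by simp
  moreover have "(4 * D) $ k = 4 * (D $ k)" "(2 * S) $ k = 2 * (S $ k)" for k
    using fps_mult_left_const_nth[of "4::rat" D k] fps_mult_left_const_nth[of "2::rat" S k]
    by (simp_all add: fps_numeral_fps_const)
  ultimately have "of_nat (Suc m) * S $ Suc m + S $ Suc m = 2 * S $ m + 4 * of_nat m * S $ m"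
    by (cases m) (simp_all add: D_def algebra_simps)
  then have "rat_of_nat ((m + 2) * num_trees (Suc m)) = rat_of_nat ((4 * m + 2) * num_trees m)"
    by (simp add: S_def algebra_simps)
  then show ?thesis by (simp only: of_nat_eq_iff)
qed

lemma central_binomial_rec: "(m + 1) * (2 * Suc m choose Suc m) = (4 * m + 2) * (2 * m choose m)"
proof -
  have 1: "Suc m * (2 * Suc m choose Suc m) = 2 * Suc m * (2 * m + 1 choose m)"
    using Suc_times_binomial_eq[of "2 * m + 1" m] by simp
  have 2: "(2 * m + 1 choose m) = (2 * m + 1 choose Suc m)"
    using binomial_symmetric[of m "2 * m + 1"] by simp
  have "Suc m * (2 * m + 1 choose Suc m) = (2 * m + 1) * (2 * m choose m)"
    using Suc_times_binomial_eq[of "2 * m" m] by simp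
  then show ?thesis using 1 2 by (simp add: algebra_simps)
qed

lemma num_trees_central: "(m + 1) * num_trees m = (2 * m choose m)"
proof (induction m)
  case (Suc m)
  have "(m + 1) * ((m + 2) * num_trees (Suc m)) = (4 * m + 2) * ((m + 1) * num_trees m)"
    unfolding num_trees_linear_rec by (simp add: algebra_simps)
  also have "\<dots> = (m + 1) * (2 * Suc m choose Suc m)" unfolding Suc central_binomial_rec ..
  finally have "(m + 2) * num_trees (Suc m) = (2 * Suc m choose Suc m)"
    by (metis add_is_0 mult_left_cancel one_neq_zero)
  then show ?case by simp
qed (simp add: num_trees_0)

lemma catalan_eq_num_trees: "catalan m = num_trees m"
  unfolding catalan_def num_trees_central[symmetric] by (rule nonzero_mult_div_cancel_left) simp

section \<open>Periodic tilings\<close>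

text \<open>
  A tile is a tree \<open>t\<close>; it covers \<open>tips t\<close> consecutive numbers. A tiling maps each number to
  its tile and its position in that tile, so that being a tiling is a condition on neighbours.
\<close>

definition next_cell :: "btree \<times> nat \<Rightarrow> btree \<times> nat \<Rightarrow> bool" where
  "next_cell a b \<longleftrightarrow> snd a < tips (fst a) \<and>
     (if Suc (snd a) < tips (fst a) then b = (fst a, Suc (snd a)) else snd b = 0)"

definition tilings :: "nat \<Rightarrow> (nat \<Rightarrow> btree \<times> nat) set" where
  "tilings g = {u. (\<forall>i. next_cell (u i) (u (Suc i))) \<and> (\<forall>i. u (i + g) = u i)}"

definition cells :: "btree \<Rightarrow> (btree \<times> nat) list" where
  "cells t = map (Pair t) [0..<tips t]"

abbreviation row :: "btree list \<Rightarrow> (btree \<times> nat) list" where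
  "row ts \<equiv> concat (map cells ts)"

lemma length_cells [simp]: "length (cells t) = tips t" by (simp add: cells_def)

lemma nth_cells: "i < tips t \<Longrightarrow> cells t ! i = (t, i)" by (simp add: cells_def)

lemma length_row: "length (row ts) = sum_list (map tips ts)"
  by (induction ts) auto

lemma nth_row_Cons: "i < tips t \<Longrightarrow> row (t # ts) ! i = (t, i)"
  by (simp add: nth_append nth_cells)

lemma tile_forward:
  assumes "\<And>i. next_cell (u i) (u (Suc i))" "u i = (t, j)" "j + k < tips t"
  shows "u (i + k) = (t, j + k)"
  using assms(3)
proof (induction k)
  case (Suc k)
  then show ?case using assms(1)[of "i + k"] by (simp add: next_cell_def)
qed (use assms in simp)

lemma tile_backward:
  assumes "\<And>i. next_cell (u i) (u (Suc i))" "u (i + k) = (t, j + k)"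
  shows "u i = (t, j)"
  using assms(2)
proof (induction k)
  case (Suc k)
  then show ?case using assms(1)[of "i + k"]
    by (auto simp: next_cell_def prod_eq_iff split: if_splits)
qed simp

lemma tile_parse:
  assumes "\<And>i. next_cell (u i) (u (Suc i))" "snd (u i) = 0" "snd (u (i + L)) = 0"
  shows "\<exists>ts. map u [i..<i + L] = row ts"
  using assms(2,3)
proof (induction L arbitrary: i rule: less_induct)
  case (less L)
  show ?case
  proof (cases "L = 0")
    case True
    then show ?thesis by (intro exI[of _ "[]"]) simp
  next
    case False
    define t where "t = fst (u i)"
    have ui: "u i = (t, 0)" using less.prems by (simp add: t_def prod_eq_iff)
    have fw: "u (i + k) = (t, k)" if "k < tips t" for k
      using tile_forward[of u, OF assms(1) ui, of k] that by simp
    have le: "tips t \<le> L" using fw[of L] less.prems False by (cases "L < tips t") auto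
    have "snd (u (i + tips t)) = 0"
      using assms(1)[of "i + (tips t - 1)"] fw[of "tips t - 1"] tips_pos[of t] by (simp add: next_cell_def)
    moreover have "snd (u (i + tips t + (L - tips t))) = 0" using less.prems le by simp
    ultimately obtain ts where ts: "map u [i + tips t..<i + tips t + (L - tips t)] = row ts"
      using less.IH[of "L - tips t" "i + tips t"] tips_pos[of t] False by auto
    have "map u [i..<i + tips t] = cells t"
      by (rule nth_equalityI) (auto simp: fw nth_cells)
    moreover have "[i..<i + L] = [i..<i + tips t] @ [i + tips t..<i + tips t + (L - tips t)]"
      using le upt_add_eq_append[of i "i + tips t" "L - tips t"] by simp
    ultimately have "map u [i..<i + L] = row (t # ts)" using ts by simp
    then show ?thesis by blast
  qed
qed

lemma cells_nonempty: "cells t \<noteq> []" using tips_pos[of t] by (auto simp: cells_def)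

lemma row_inject: "row ts = row ts' \<Longrightarrow> ts = ts'"
proof (induction ts arbitrary: ts')
  case Nil
  then show ?case using cells_nonempty by (cases ts') auto
next
  case (Cons t ts)
  then obtain t' ts'' where ts': "ts' = t' # ts''" using cells_nonempty by (cases ts') auto
  have "t = t'" using Cons.prems nth_row_Cons[of 0 t ts] nth_row_Cons[of 0 t' ts''] tips_pos[of t] tips_pos[of t']
    by (simp add: ts' del: concat.simps)
  then show ?case using Cons by (auto simp: ts')
qed

lemma next_cell_row:
  assumes "i < length (row ts)" "snd x = 0"
  shows "next_cell (row ts ! i) ((row ts @ [x]) ! Suc i)"
  using assms
proof (induction ts arbitrary: i)
  case (Cons t ts)
  have hd: "snd ((row ts @ [x]) ! 0) = 0"
  proof (cases ts)
    case (Cons t' ts')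
    then show ?thesis using tips_pos[of t'] by (simp add: nth_append nth_cells)
  qed (use Cons.prems in simp)
  consider "Suc i < tips t" | "Suc i = tips t" | "i \<ge> tips t" by linarith
  then show ?case
  proof cases
    case 1
    then show ?thesis by (simp add: nth_append nth_cells next_cell_def)
  next
    case 2
    then have "(row (t # ts) @ [x]) ! Suc i = (row ts @ [x]) ! 0" by (simp add: nth_append)
    then show ?thesis using 2 hd by (simp add: nth_append nth_cells next_cell_def)
  next
    case 3
    then have "(row (t # ts) @ [x]) ! Suc i = (row ts @ [x]) ! Suc (i - tips t)"
      by (simp add: nth_append Suc_diff_le)
    then show ?thesis using 3 Cons.IH[of "i - tips t"] Cons.prems by (simp add: nth_append)
  qed
qed simp

definition wrap :: "btree list \<Rightarrow> nat \<Rightarrow> btree \<times> nat" where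
  "wrap ts i = row ts ! (i mod length (row ts))"

lemma wrap_tiling:
  assumes "ts \<noteq> []" "sum_list (map tips ts) = g"
  shows "wrap ts \<in> tilings g"
proof -
  obtain t ts' where ts: "ts = t # ts'" using assms by (cases ts) auto
  have g: "length (row ts) = g" "g > 0" using assms tips_pos[of t] by (simp_all add: length_row ts)
  have x: "snd (row ts ! 0) = 0" using tips_pos[of t] by (simp add: ts nth_append nth_cells)
  have "next_cell (wrap ts i) (wrap ts (Suc i))" for i
  proof -
    have "(row ts @ [row ts ! 0]) ! Suc (i mod g) = row ts ! (Suc i mod g)"
    proof (cases "Suc (i mod g) = g")
      case True
      then have "Suc i mod g = 0" by (simp add: mod_Suc)
      then show ?thesis using True g(1) by (simp add: nth_append del: concat.simps)
    next
      case False
      moreover from this have "Suc (i mod g) < g" using mod_less_divisor[OF g(2), of i] by linarith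
      ultimately have "Suc i mod g = Suc (i mod g)" "Suc (i mod g) < g" by (auto simp: mod_Suc)
      then show ?thesis using g(1) by (simp add: nth_append)
    qed
    then show ?thesis using next_cell_row[of "i mod g" ts "row ts ! 0"] g x by (simp add: wrap_def)
  qed
  then show ?thesis using g by (simp add: tilings_def wrap_def)
qed

lemma shift_tiling: assumes "u \<in> tilings g" shows "(\<lambda>i. u (i + s)) \<in> tilings g"
proof -
  have "u (i + g + s) = u (i + s)" for i
  proof -
    have "i + g + s = (i + s) + g" by simp
    then show ?thesis using assms unfolding tilings_def by (simp only: mem_Collect_eq)
  qed
  then show ?thesis using assms unfolding tilings_def by simp
qed

lemma periodic_mult:
  fixes u :: "nat \<Rightarrow> 'z"
  assumes "\<And>i. u (i + g) = u i"
  shows "u (i + g * k) = u i"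
proof (induction k)
  case (Suc k)
  have "i + g * Suc k = (i + g * k) + g" by simp
  then show ?case using assms[of "i + g * k"] Suc by (simp only:)
qed simp

lemma periodic_mod: "(\<And>i. u (i + g) = u i) \<Longrightarrow> u (i mod g) = u i" for u :: "nat \<Rightarrow> 'z"
  using periodic_mult[of u g "i mod g" "i div g"] by simp

lemma periodic_gcd:
  fixes u :: "nat \<Rightarrow> 'z"
  assumes "\<And>i. u (i + a) = u i" "\<And>i. u (i + b) = u i" "b \<noteq> 0"
  shows "u (i + gcd a b) = u i"
proof -
  obtain x y where xy: "b * x = a * y + gcd b a" using bezout_nat[OF assms(3), of a] by blast
  have "u (i + gcd a b) = u (i + gcd a b + a * y)" using periodic_mult[of u a, OF assms(1)] by simp
  also have "\<dots> = u (i + b * x)" using xy by (simp add: gcd.commute algebra_simps)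
  also have "\<dots> = u i" using periodic_mult[of u b, OF assms(2)] by simp
  finally show ?thesis .
qed

text \<open>
  A tiling with period \<open>g\<close> is determined by the tile at \<open>0\<close>, the position of \<open>0\<close> in it, and the
  other tiles in one period.
\<close>

definition tile_data :: "nat \<Rightarrow> (btree \<times> nat \<times> btree list) set" where
  "tile_data g = {(t, j, ts). j < tips t \<and> tips t + sum_list (map tips ts) = g}"

definition tile_fun :: "btree \<times> nat \<times> btree list \<Rightarrow> nat \<Rightarrow> btree \<times> nat" where
  "tile_fun = (\<lambda>(t, j, ts) i. wrap (t # ts) (i + j))"

lemma tile_fun_0: "(t, j, ts) \<in> tile_data g \<Longrightarrow> tile_fun (t, j, ts) 0 = (t, j)"
  by (auto simp: tile_data_def tile_fun_def wrap_def length_row nth_append nth_cells)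

lemma bij_tile_fun:
  assumes "g \<ge> 1"
  shows "bij_betw tile_fun (tile_data g) (tilings g)"
proof (rule bij_betw_imageI)
  show "inj_on tile_fun (tile_data g)"
  proof (rule inj_onI)
    fix a b assume a: "a \<in> tile_data g" and b: "b \<in> tile_data g" and eq: "tile_fun a = tile_fun b"
    obtain t j ts t' j' ts' where ab: "a = (t, j, ts)" "b = (t', j', ts')" by (cases a; cases b) auto
    have tj: "t = t'" "j = j'" using tile_fun_0 a b eq ab by (metis prod.inject)+
    have len: "length (row (t # ts)) = g" "length (row (t # ts')) = g"
      using a b by (auto simp: ab tj tile_data_def length_row)
    have "row (t # ts) = row (t # ts')"
    proof (rule nth_equalityI)
      fix i assume "i < length (row (t # ts))"
      then have i: "i < g" using len by simp
      have "j < g" using a by (auto simp: ab tile_data_def)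
      have "(i + (g - j) + j) mod g = i" using i \<open>j < g\<close> by simp
      then show "row (t # ts) ! i = row (t # ts') ! i"
        using fun_cong[OF eq, of "i + (g - j)"] len by (simp add: ab tj tile_fun_def wrap_def del: concat.simps list.map)
    qed (use len in simp)
    then have "t # ts = t # ts'" by (rule row_inject)
    then show "a = b" by (simp add: ab tj)
  qed
  show "tile_fun ` tile_data g = tilings g"
  proof (intro equalityI subsetI)
    fix u assume "u \<in> tile_fun ` tile_data g"
    then obtain t j ts where "(t, j, ts) \<in> tile_data g" "u = tile_fun (t, j, ts)" by auto
    then show "u \<in> tilings g"
      using shift_tiling[OF wrap_tiling[of "t # ts" g], of j] by (auto simp: tile_data_def tile_fun_def)
  next
    fix u assume u: "u \<in> tilings g"
    then have st: "next_cell (u i) (u (Suc i))" and per: "u (i + g) = u i" for i by (auto simp: tilings_def)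
    obtain t j where tj: "u 0 = (t, j)" by (cases "u 0") auto
    have j: "j < tips t" using st[of 0] tj by (simp add: next_cell_def)
    define v where "v = (\<lambda>i. u (i + (g * j - j)))"
    have v: "v \<in> tilings g" unfolding v_def by (rule shift_tiling[OF u])
    then have stv: "next_cell (v i) (v (Suc i))" and perv: "v (i + g) = v i" for i by (auto simp: tilings_def)
    have uv: "u i = v (i + j)" for i
    proof -
      have "j \<le> g * j" using assms by simp
      then show ?thesis using periodic_mult[of u g i j, OF per] by (simp add: v_def)
    qed
    have v0: "v 0 = (t, 0)"
      using tile_backward[of v, OF stv, of 0 j t 0] uv[of 0] tj by simp
    have "snd (v 0) = 0" "snd (v (0 + g)) = 0" using v0 perv[of 0] by simp_all
    from tile_parse[of v, OF stv this] obtain T where T: "map v [0..<g] = row T" by auto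
    have len: "length (row T) = g" using T by (metis length_map length_upt diff_zero)
    then obtain t' ts where T': "T = t' # ts" using assms by (cases T) auto
    have vi: "v i = row T ! (i mod g)" for i
    proof -
      have "row T ! (i mod g) = v (i mod g)" using assms by (simp add: T[symmetric])
      then show ?thesis using periodic_mod[of v g i, OF perv] by simp
    qed
    have "t' = t" using vi[of 0] v0 tips_pos[of t'] by (simp add: T' nth_append nth_cells)
    then have "(t, j, ts) \<in> tile_data g" using len j by (simp add: tile_data_def T' length_row)
    moreover have "u = tile_fun (t, j, ts)"
      unfolding tile_fun_def using uv vi len by (simp add: fun_eq_iff wrap_def T' \<open>t' = t\<close> del: concat.simps list.map)
    ultimately show "u \<in> tile_fun ` tile_data g" by blast
  qed
qed

lemma tile_le_period: assumes "u \<in> tilings g" "g \<ge> 1" shows "tips (fst (u i)) \<le> g"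
proof -
  have "(\<lambda>k. u (k + i)) \<in> tile_fun ` tile_data g"
    using shift_tiling[OF assms(1), of i] bij_tile_fun[OF assms(2)] by (simp add: bij_betw_def)
  then obtain t j ts where d: "(t, j, ts) \<in> tile_data g" "(\<lambda>k. u (k + i)) = tile_fun (t, j, ts)" by auto
  have "u i = (t, j)" using tile_fun_0[OF d(1)] fun_cong[OF d(2), of 0] by simp
  then show ?thesis using d(1) by (simp add: tile_data_def)
qed

text \<open>
  The right subtrees along the left spine. A tree with \<open>m + 1\<close> tips has a spine that ends in a
  tip, so rows of tiles of total length \<open>m\<close> are as numerous as these trees.
\<close>

fun unspine :: "btree \<Rightarrow> btree list" where
  "unspine Tip = []"
| "unspine (Join l r) = unspine l @ [r]"

lemma card_rows: "finite {ts. sum_list (map tips ts) = m}" "card {ts. sum_list (map tips ts) = m} = num_trees m"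
proof -
  have 1: "foldl Join Tip (unspine b) = b" for b by (induction b) auto
  have 2: "unspine (foldl Join Tip ts) = ts" for ts by (induction ts rule: rev_induct) auto
  have 3: "tips (foldl Join Tip ts) = sum_list (map tips ts) + 1" for ts by (induction ts rule: rev_induct) auto
  have bij: "bij_betw (foldl Join Tip) {ts. sum_list (map tips ts) = m} (btrees (m + 1))"
  proof (rule bij_betw_byWitness[where f' = unspine])
    show "unspine ` btrees (m + 1) \<subseteq> {ts. sum_list (map tips ts) = m}"
    proof safe
      fix b assume "b \<in> btrees (m + 1)"
      then show "sum_list (map tips (unspine b)) = m" using 3[of "unspine b"] 1[of b] by (simp add: btrees_def)
    qed
  qed (use 1 2 3 in \<open>auto simp: btrees_def\<close>)
  show "finite {ts. sum_list (map tips ts) = m}" using bij_betw_finite[OF bij] finite_btrees by simp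
  show "card {ts. sum_list (map tips ts) = m} = num_trees m" using bij_betw_same_card[OF bij] by (simp add: num_trees_def)
qed

lemma tile_data_eq:
  "tile_data g = (SIGMA t:(\<Union>a\<in>{1..g}. btrees a). {..<tips t} \<times> {ts. sum_list (map tips ts) = g - tips t})"
  using tips_pos by (auto simp: tile_data_def btrees_def)

text \<open>
  With \<open>a\<close> the size of the tile at \<open>0\<close>, the count is the sum of \<open>a c\<^sub>a\<^sub>-\<^sub>1 c\<^sub>g\<^sub>-\<^sub>a\<close>. Adding the same sum with
  \<open>a\<close> replaced by \<open>g + 1 - a\<close> turns the factor \<open>a\<close> into the constant \<open>g + 1\<close>, and Segner's
  recurrence applies.
\<close>

lemma
  assumes "g \<ge> 1"
  shows finite_tilings: "finite (tilings g)" and card_tilings: "2 * card (tilings g) = (2 * g choose g)"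
proof -
  have fin: "finite (\<Union>a\<in>{1..g}. btrees a)" by (simp add: finite_btrees)
  have "finite (tile_data g)" unfolding tile_data_eq using fin card_rows(1) by blast
  then show "finite (tilings g)" using bij_betw_finite[OF bij_tile_fun[OF assms]] by simp
  have "card (tilings g) = card (tile_data g)" using bij_betw_same_card[OF bij_tile_fun[OF assms]] by simp
  also have "\<dots> = (\<Sum>t\<in>(\<Union>a\<in>{1..g}. btrees a). tips t * num_trees (g - tips t))"
    unfolding tile_data_eq using fin card_rows by (subst card_SigmaI) (auto simp: card_cartesian_product)
  also have "\<dots> = (\<Sum>a\<in>{1..g}. \<Sum>t\<in>btrees a. tips t * num_trees (g - tips t))"
    by (rule sum.UNION_disjoint) (use finite_btrees in \<open>auto simp: btrees_def\<close>)
  also have "\<dots> = (\<Sum>a\<in>{1..g}. a * (num_trees (a - 1) * num_trees (g - a)))"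
  proof (intro sum.cong refl)
    fix a assume a: "a \<in> {1..g}"
    have "(\<Sum>t\<in>btrees a. tips t * num_trees (g - tips t)) = (\<Sum>t\<in>btrees a. a * num_trees (g - a))"
      by (intro sum.cong refl) (simp add: btrees_def)
    also have "\<dots> = a * (num_trees (a - 1) * num_trees (g - a))" using a by (simp add: num_trees_def)
    finally show "(\<Sum>t\<in>btrees a. tips t * num_trees (g - tips t)) = a * (num_trees (a - 1) * num_trees (g - a))" .
  qed
  finally have 1: "card (tilings g) = (\<Sum>a\<in>{1..g}. a * (num_trees (a - 1) * num_trees (g - a)))" .
  have "\<dots> = (\<Sum>a\<in>{1..g}. (g + 1 - a) * (num_trees (a - 1) * num_trees (g - a)))"
    by (rule sum.reindex_bij_witness[of _ "\<lambda>a. g + 1 - a" "\<lambda>a. g + 1 - a"]) (auto simp: mult.commute)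
  then have "2 * card (tilings g) = (\<Sum>a\<in>{1..g}. a * (num_trees (a - 1) * num_trees (g - a)) +
      (g + 1 - a) * (num_trees (a - 1) * num_trees (g - a)))"
    unfolding sum.distrib using 1 by linarith
  also have "\<dots> = (\<Sum>a\<in>{1..g}. (g + 1) * (num_trees (a - 1) * num_trees (g - a)))"
    by (intro sum.cong refl, subst add_mult_distrib[symmetric]) simp
  also have "\<dots> = (g + 1) * (\<Sum>i\<le>g - 1. num_trees i * num_trees (g - 1 - i))"
    unfolding sum_distrib_left
    by (rule sum.reindex_bij_witness[of _ "\<lambda>i. i + 1" "\<lambda>a. a - 1"]) (use assms in auto)
  also have "\<dots> = (g + 1) * num_trees g" using num_trees_Suc[of "g - 1"] assms by simp
  finally show "2 * card (tilings g) = (2 * g choose g)" by (simp only: num_trees_central)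
qed

lemma card_tilings_btrees:
  assumes "n \<ge> 1"
  shows "card (tilings n) = (2 * n - 1) * card (btrees n)"
proof -
  obtain m where m: "n = Suc m" using assms by (cases n) auto
  have "2 * card (tilings n) = (2 * Suc m choose Suc m)" using card_tilings[of n] assms unfolding m by simp
  then have "(m + 1) * (2 * card (tilings n)) = (4 * m + 2) * ((m + 1) * num_trees m)"
    by (simp only: central_binomial_rec num_trees_central)
  also have "\<dots> = (m + 1) * (2 * ((2 * m + 1) * num_trees m))" by (simp add: algebra_simps)
  finally have "2 * card (tilings n) = 2 * ((2 * m + 1) * num_trees m)"
    by (simp only: mult_cancel1) simp
  moreover have "2 * m + 1 = 2 * n - 1" "num_trees m = card (btrees n)" by (simp_all add: m num_trees_def)
  ultimately have "2 * card (tilings n) = 2 * ((2 * n - 1) * card (btrees n))" by (simp only:)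
  then show ?thesis by simp
qed

text \<open>
  The condition excludes a single tile that covers the whole circle of length \<open>n\<close>.
\<close>

definition short_tilings :: "nat \<Rightarrow> (nat \<Rightarrow> btree \<times> nat) set" where
  "short_tilings n = {u \<in> tilings n. \<forall>i. tips (fst (u i)) < n}"

text \<open>
  The tilings that are left out are determined by a tree with \<open>n\<close> tips and its position.
\<close>

lemma card_short_tilings:
  assumes "n \<ge> 2"
  shows "card (short_tilings n) \<le> (n - 1) * card (btrees n)"
proof -
  let ?D = "(\<lambda>(t, j). (t, j, [])) ` (btrees n \<times> {..<n})"
  have D: "?D \<subseteq> tile_data n" by (auto simp: tile_data_def btrees_def)
  have bij: "bij_betw tile_fun (tile_data n) (tilings n)" by (rule bij_tile_fun) (use assms in simp)
  then have inj: "inj_on tile_fun ?D" using D by (auto simp: bij_betw_def intro: inj_on_subset)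
  have "card (tile_fun ` ?D) = card (btrees n) * n"
    by (subst card_image[OF inj], subst card_image) (auto simp: inj_on_def card_cartesian_product)
  moreover have sub: "tile_fun ` ?D \<subseteq> tilings n" using D bij by (auto simp: bij_betw_def)
  moreover have fin: "finite (tilings n)" using finite_tilings assms by simp
  moreover have "short_tilings n \<subseteq> tilings n - tile_fun ` ?D"
  proof
    fix u assume u: "u \<in> short_tilings n"
    have "u \<notin> tile_fun ` ?D"
    proof
      assume "u \<in> tile_fun ` ?D"
      then obtain t j where tj: "t \<in> btrees n" "(t, j, []) \<in> tile_data n" "u = tile_fun (t, j, [])" using D by auto
      then have "u 0 = (t, j)" using tile_fun_0 by simp
      then show False using u tj(1) by (auto simp: short_tilings_def btrees_def dest: spec[of _ 0])
    qed
    then show "u \<in> tilings n - tile_fun ` ?D" using u by (simp add: short_tilings_def)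
  qed
  ultimately have "card (short_tilings n) \<le> card (tilings n) - card (btrees n) * n"
    using card_mono[of "tilings n - tile_fun ` ?D" "short_tilings n"]
      card_Diff_subset[OF finite_subset[OF sub fin] sub] by simp
  moreover have "card (tilings n) = (2 * n - 1) * card (btrees n)"
    by (rule card_tilings_btrees) (use assms in simp)
  ultimately have "card (short_tilings n) \<le> (2 * n - 1) * card (btrees n) - n * card (btrees n)"
    by (simp only: mult.commute)
  also have "\<dots> = (n - 1) * card (btrees n)" by (simp add: diff_mult_distrib[symmetric])
  finally show ?thesis .
qed

text \<open>
  The shift by \<open>(n - 1) * k\<close> is the shift by \<open>- k\<close> on sequences with period \<open>n\<close>. A tiling with
  period less than \<open>n\<close> has no tile of size \<open>n\<close>, so the size condition holds by itself.
\<close>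

lemma fixed_short_tilings:
  assumes "n \<ge> 1" "\<not> n dvd k"
  shows "{u \<in> short_tilings n. (\<lambda>i. u (i + (n - 1) * k)) = u} = tilings (gcd k n)"
proof -
  let ?g = "gcd k n"
  have "?g \<noteq> n" using assms(2) by (metis gcd_dvd1)
  moreover have "?g \<le> n" using assms(1) by (intro gcd_le2_nat) simp
  moreover have "?g \<noteq> 0" using assms(1) by simp
  ultimately have g: "?g \<ge> 1" "?g < n" by linarith+
  have gcd: "gcd ((n - 1) * k) n = ?g"
  proof -
    have "coprime (n - 1) n" using assms coprime_diff_one_left_nat by simp
    then show ?thesis by (intro gcd_mult_left_left_cancel) (simp add: coprime_commute)
  qed
  show ?thesis
  proof (intro equalityI subsetI)
    fix u assume "u \<in> {u \<in> short_tilings n. (\<lambda>i. u (i + (n - 1) * k)) = u}"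
    then have u: "u \<in> tilings n" "\<And>i. u (i + (n - 1) * k) = u i" by (auto simp: short_tilings_def fun_eq_iff)
    have "u (i + n) = u i" for i using u(1) by (simp add: tilings_def)
    from periodic_gcd[of u, OF u(2) this] have "u (i + ?g) = u i" for i using gcd assms by simp
    then show "u \<in> tilings ?g" using u(1) by (simp add: tilings_def)
  next
    fix u assume u: "u \<in> tilings ?g"
    then have per: "u (i + ?g) = u i" for i by (simp add: tilings_def)
    have m: "u (i + a) = u i" if "?g dvd a" for a i
      using periodic_mult[of u ?g i, OF per] that by (auto simp: dvd_def)
    have "u \<in> tilings n" using u m[of n] by (simp add: tilings_def)
    moreover have "tips (fst (u i)) < n" for i using tile_le_period[OF u g(1), of i] g(2) by simp
    moreover have "(\<lambda>i. u (i + (n - 1) * k)) = u" using m[of "(n - 1) * k"] by auto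
    ultimately show "u \<in> {u \<in> short_tilings n. (\<lambda>i. u (i + (n - 1) * k)) = u}" by (simp add: short_tilings_def)
  qed
qed

section \<open>Functions of a circular configuration and a central point\<close>

text \<open>
  Real functions as a rational vector space: the coordinates of \<open>\<tau>\<close> are rational, while limits and
  partial fractions are taken over the reals.
\<close>

definition fscale :: "rat \<Rightarrow> ('x \<Rightarrow> real) \<Rightarrow> 'x \<Rightarrow> real" where
  "fscale q f = (\<lambda>x. of_rat q * f x)"

interpretation fs: vector_space fscale
  by unfold_locales (auto simp: fscale_def fun_eq_iff algebra_simps of_rat_add of_rat_mult)

lemma fs_sum_apply: "(\<Sum>i\<in>I. fscale (q i) (v i)) x = (\<Sum>i\<in>I. of_rat (q i) * v i x)"
  by (induction I rule: infinite_finite_induct) (auto simp: fscale_def)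

definition shift :: "nat \<Rightarrow> (nat \<Rightarrow> real) \<Rightarrow> nat \<Rightarrow> real" where "shift k y = (\<lambda>j. y (j + k))"

lemma shift_shift: "shift a (shift b y) = shift (a + b) y" by (simp add: shift_def add.assoc)

text \<open>
  Configurations of \<open>n\<close> different points on a circle, as periodic sequences. Rotation is then a
  plain shift.
\<close>

definition circular :: "nat \<Rightarrow> (nat \<Rightarrow> real) set" where
  "circular n = {y. (\<forall>j. y (j + n) = y j) \<and> inj_on y {..<n}}"

lemma circular_periodic: "y \<in> circular n \<Longrightarrow> y (j + n * k) = y j"
  by (rule periodic_mult) (simp add: circular_def)

lemma circular_eq_iff: assumes "y \<in> circular n" "n \<ge> 1" shows "y i = y j \<longleftrightarrow> i mod n = j mod n"
proof -
  have m: "y (i mod n) = y i" for i by (rule periodic_mod) (use assms in \<open>simp add: circular_def\<close>)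
  have "y i = y j \<longleftrightarrow> y (i mod n) = y (j mod n)" by (simp add: m)
  also have "\<dots> \<longleftrightarrow> i mod n = j mod n"
    using assms by (intro inj_on_eq_iff[of y "{..<n}"]) (auto simp: circular_def)
  finally show ?thesis .
qed

lemma shift_circular: assumes "y \<in> circular n" "n \<ge> 1" shows "shift k y \<in> circular n"
proof -
  have "shift k y (j + n) = shift k y j" for j
    unfolding shift_def using circular_eq_iff[OF assms, of "j + n + k" "j + k"]
    by (metis add.commute add.left_commute mod_add_self1)
  moreover have "inj_on (shift k y) {..<n}"
  proof (rule inj_onI)
    fix a b assume ab: "a \<in> {..<n}" "b \<in> {..<n}" "shift k y a = shift k y b"
    then have "(a + k) mod n = (b + k) mod n" using circular_eq_iff[OF assms] by (simp add: shift_def)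
    then have "a mod n = b mod n" by (simp add: mod_eq_dvd_iff_nat mod_add_right_eq nat_mod_eq_iff)
    then show "a = b" using ab by simp
  qed
  ultimately show ?thesis by (simp add: circular_def)
qed

lemma circular_extend:
  assumes "inj_on y {..<n}" "n \<ge> 1"
  shows "(\<lambda>j. y (j mod n)) \<in> circular n"
proof -
  have "inj_on (\<lambda>j. y (j mod n)) {..<n}" using assms(1) by (auto simp: inj_on_def)
  then show ?thesis by (simp add: circular_def)
qed

lemma circular_inj: "y \<in> circular n \<Longrightarrow> inj_on y {..<n}" by (simp add: circular_def)

lemma btree_frac_independent_circular:
  assumes "n \<ge> 1" "\<And>y. y \<in> circular n \<Longrightarrow> (\<Sum>b\<in>btrees n. c b * btree_frac b y) = 0" "b \<in> btrees n"
  shows "c b = 0"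
proof (rule btree_frac_independent[OF _ assms(3)])
  fix y :: "nat \<Rightarrow> real" assume "inj_on y {..<n}"
  then have "(\<Sum>b\<in>btrees n. c b * btree_frac b (\<lambda>j. y (j mod n))) = 0"
    by (intro assms(2) circular_extend assms(1))
  moreover have "btree_frac b (\<lambda>j. y (j mod n)) = btree_frac b y" if "b \<in> btrees n" for b
    by (rule btree_frac_cong) (use that in \<open>simp add: btrees_def\<close>)
  ultimately show "(\<Sum>b\<in>btrees n. c b * btree_frac b y) = 0" by simp
qed

lemma nf_basis:
  assumes "m \<ge> 1"
  shows "inj_on nf (btrees (m + 1))" "dend.independent (nf ` btrees (m + 1))" "dend.span (nf ` btrees (m + 1)) = Dend m"
proof -
  have ne: "b \<noteq> Tip" if "b \<in> btrees (m + 1)" for b using that assms by (auto simp: btrees_def)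
  have *: "q b = 0" if z: "(\<Sum>b\<in>btrees (m + 1). dend_scale (q b) (nf b)) = 0" and b: "b \<in> btrees (m + 1)" for q b
  proof -
    have "real_of_rat (q b) = 0"
    proof (rule btree_frac_independent[OF _ b])
      fix y :: "nat \<Rightarrow> real" assume y: "inj_on y {..<m + 1}"
      then have y': "inj_on y {..m}" by (simp add: lessThan_Suc_atMost)
      have "0 = dend_value m (\<Sum>b\<in>btrees (m + 1). dend_scale (q b) (nf b)) y" by (simp only: z dend_value_zero)
      also have "\<dots> = (\<Sum>b\<in>btrees (m + 1). of_rat (q b) * btree_frac b y)"
        unfolding dend_value_sum dend_value_scale
        by (intro sum.cong refl) (use ne y' in \<open>auto simp: dend_value_nf btrees_def\<close>)
      finally show "(\<Sum>b\<in>btrees (m + 1). real_of_rat (q b) * btree_frac b y) = 0" by simp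
    qed
    then show ?thesis by simp
  qed
  show "inj_on nf (btrees (m + 1))" "dend.independent (nf ` btrees (m + 1))"
    by (rule dend.family_independent[OF finite_btrees], rule *, assumption+)+
  have "{b. b \<noteq> Tip \<and> tips b = m + 1} = btrees (m + 1)" using ne by (auto simp: btrees_def)
  then show "dend.span (nf ` btrees (m + 1)) = Dend m" by (simp add: Dend_eq_nf_span nf_span_def)
qed

lemma partial_fractions_zero:
  fixes y h :: "nat \<Rightarrow> real"
  assumes "finite J" "inj_on y J" "\<And>c. c \<notin> y ` J \<Longrightarrow> (\<Sum>j\<in>J. h j / (c - y j)) = 0" "i \<in> J"
  shows "h i = 0"
proof -
  let ?f = "\<lambda>c. h i + (\<Sum>j\<in>J - {i}. h j * (c - y i) / (c - y j))"
  have ev: "\<forall>\<^sub>F c in at (y i). c \<notin> y ` J"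
  proof -
    have op: "open (- (y ` J - {y i}))"
      by (intro open_Compl finite_imp_closed) (use assms(1) in auto)
    have "\<forall>\<^sub>F c in at (y i). c \<in> - (y ` J - {y i}) - {y i}"
      unfolding eventually_at_topological
      by (intro exI[of _ "- (y ` J - {y i})"]) (use op in auto)
    then show ?thesis by eventually_elim auto
  qed
  have "\<forall>\<^sub>F c in at (y i). ?f c = 0"
    using ev
  proof eventually_elim
    case (elim c)
    then have ci: "c \<noteq> y i" using assms(4) by auto
    have "0 = (c - y i) * (\<Sum>j\<in>J. h j / (c - y j))" using assms(3)[OF elim] by simp
    also have "\<dots> = (c - y i) * (h i / (c - y i) + (\<Sum>j\<in>J - {i}. h j / (c - y j)))"
      by (subst sum.remove[OF assms(1,4)]) simp
    also have "\<dots> = ?f c" using ci by (simp add: distrib_left sum_distrib_left mult.commute)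
    finally show ?case by simp
  qed
  then have "(?f \<longlongrightarrow> 0) (at (y i))" by (simp add: tendsto_eventually)
  moreover have "(?f \<longlongrightarrow> h i + (\<Sum>j\<in>J - {i}. h j * (y i - y i) / (y i - y j))) (at (y i))"
    by (intro tendsto_intros) (use assms(2,4) in \<open>auto dest: inj_onD\<close>)
  ultimately have "0 = h i + (\<Sum>j\<in>J - {i}. h j * (y i - y i) / (y i - y j))"
    by (intro tendsto_unique) auto
  then show ?thesis by simp
qed

text \<open>
  The added point must avoid the circle. Functions are set to \<open>0\<close> outside the configurations, so
  that equality of fractions is equality of functions.
\<close>

definition configs :: "nat \<Rightarrow> ((nat \<Rightarrow> real) \<times> real) set" where
  "configs n = {(y, c). y \<in> circular n \<and> c \<notin> range y}"

definition on_configs :: "nat \<Rightarrow> ((nat \<Rightarrow> real) \<Rightarrow> real \<Rightarrow> real) \<Rightarrow> (nat \<Rightarrow> real) \<times> real \<Rightarrow> real" where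
  "on_configs n F = (\<lambda>p. if p \<in> configs n then F (fst p) (snd p) else 0)"

lemma on_configs_eqI: "(\<And>y c. y \<in> circular n \<Longrightarrow> c \<notin> range y \<Longrightarrow> F y c = G y c) \<Longrightarrow> on_configs n F = on_configs n G"
  by (auto simp: on_configs_def configs_def fun_eq_iff)

text \<open>
  The elements of the first basis.
\<close>

definition cauchy :: "nat \<Rightarrow> btree \<Rightarrow> nat \<Rightarrow> (nat \<Rightarrow> real) \<times> real \<Rightarrow> real" where
  "cauchy n b j = on_configs n (\<lambda>y c. btree_frac b y / (c - y j))"

text \<open>
  The product over the cells of one period has one factor for each tile.
\<close>

definition weight :: "btree \<times> nat \<Rightarrow> (nat \<Rightarrow> real) \<Rightarrow> real \<Rightarrow> real" where
  "weight a y c = (if snd a = 0 then btree_frac (fst a) y / (c - y (tips (fst a) - 1)) else 1)"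

definition tiling_fun :: "nat \<Rightarrow> (nat \<Rightarrow> btree \<times> nat) \<Rightarrow> (nat \<Rightarrow> real) \<times> real \<Rightarrow> real" where
  "tiling_fun n u = on_configs n (\<lambda>y c. \<Prod>i<n. weight (u i) (shift i y) c)"

lemma range_shift: assumes "y \<in> circular n" "n \<ge> 1" shows "range (shift k y) = range y"
proof -
  have "y j \<in> range (shift k y)" for j
  proof -
    have "k \<le> n * k" using assms(2) by simp
    then have "n * k - k + k = n * k" by (rule le_add_diff_inverse2)
    then have "j + (n * k - k) + k = j + n * k" by (simp only: add.assoc)
    then have "y j = shift k y (j + (n * k - k))"
      unfolding shift_def using circular_periodic[OF assms(1), of j k] by (simp only:)
    then show ?thesis by blast
  qed
  then show ?thesis by (auto simp: shift_def)
qed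

definition turn :: "nat \<Rightarrow> nat \<Rightarrow> ((nat \<Rightarrow> real) \<times> real \<Rightarrow> real) \<Rightarrow> (nat \<Rightarrow> real) \<times> real \<Rightarrow> real" where
  "turn n k f = on_configs n (\<lambda>y c. f (shift k y, c))"

lemma turn_linear: "Vector_Spaces.linear fscale fscale (turn n k)"
  by unfold_locales (auto simp: turn_def fscale_def fun_eq_iff on_configs_def)

lemma turn_on_configs: "n \<ge> 1 \<Longrightarrow> turn n k (on_configs n F) = on_configs n (\<lambda>y c. F (shift k y) c)"
  unfolding turn_def by (rule on_configs_eqI) (simp add: on_configs_def configs_def shift_circular range_shift)

lemma turn_turn: "n \<ge> 1 \<Longrightarrow> turn n a (turn n b f) = turn n (a + b) f"
  unfolding turn_def by (rule on_configs_eqI) (simp add: on_configs_def configs_def shift_circular range_shift shift_shift add.commute)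

lemma prod_periodic_shift:
  fixes f :: "nat \<Rightarrow> 'z::comm_monoid_mult"
  assumes "\<And>i. f (i + n) = f i"
  shows "(\<Prod>i<n. f (i + k)) = (\<Prod>i<n. f i)"
proof (induction k)
  case (Suc k)
  show ?case
  proof (cases n)
    case (Suc m)
    have "(\<Prod>i<n. f (i + Suc k)) = (\<Prod>i<m. f (Suc i + k)) * f (m + Suc k)"
      by (simp add: Suc)
    also have "f (m + Suc k) = f (0 + k)" using assms[of k] by (simp add: Suc add.commute)
    also have "(\<Prod>i<m. f (Suc i + k)) * f (0 + k) = (\<Prod>i<n. f (i + k))"
      unfolding Suc prod.lessThan_Suc_shift by (simp add: mult.commute)
    finally show ?thesis using Suc.IH by simp
  qed simp
qed simp

text \<open>
  Moving the points by \<open>k\<close> moves the tiling by \<open>- k\<close>, here written as \<open>(n - 1) * k\<close>.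
\<close>

lemma turn_tiling_fun:
  assumes "n \<ge> 1" "\<And>i. u (i + n) = u i"
  shows "turn n k (tiling_fun n u) = tiling_fun n (\<lambda>i. u (i + (n - 1) * k))"
  unfolding tiling_fun_def turn_on_configs[OF assms(1)]
proof (rule on_configs_eqI)
  fix y c assume y: "y \<in> circular n"
  let ?f = "\<lambda>i. weight (u (i + (n - 1) * k)) (shift i y) c"
  have e: "i + k + (n - 1) * k = i + n * k" for i using assms(1) by (cases n) auto
  have f: "?f (i + k) = weight (u i) (shift i (shift k y)) c" for i
    unfolding e shift_shift periodic_mult[of u n i k, OF assms(2)] ..
  have "?f (i + n) = ?f i" for i
  proof -
    have "i + n + (n - 1) * k = i + (n - 1) * k + n" by simp
    then have "u (i + n + (n - 1) * k) = u (i + (n - 1) * k)" using assms(2) by (simp only:)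
    moreover have "shift (i + n) y = shift i y"
      using circular_periodic[OF y, of _ 1] by (simp add: shift_def fun_eq_iff add.assoc[symmetric])
    ultimately show ?thesis by (simp only:)
  qed
  from prod_periodic_shift[of ?f n k, OF this]
  show "(\<Prod>i<n. weight (u i) (shift i (shift k y)) c) = (\<Prod>i<n. ?f i)" by (simp only: f)
qed

fun row_weight :: "(btree \<times> nat) list \<Rightarrow> (nat \<Rightarrow> real) \<Rightarrow> real \<Rightarrow> real" where
  "row_weight [] y c = 1"
| "row_weight (a # w) y c = weight a y c * row_weight w (shift 1 y) c"

lemma row_weight_eq_prod: "row_weight w y c = (\<Prod>i<length w. weight (w ! i) (shift i y) c)"
  by (induction w arbitrary: y) (simp_all add: prod.lessThan_Suc_shift shift_shift del: prod.lessThan_Suc, simp add: shift_def)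

lemma row_weight_append: "row_weight (v @ w) y c = row_weight v y c * row_weight w (shift (length v) y) c"
  by (induction v arbitrary: y) (simp_all add: shift_shift, simp add: shift_def)

lemma row_weight_cells: "row_weight (cells t) y c = btree_frac t y / (c - y (tips t - 1))"
proof -
  obtain m where m: "tips t = Suc m" using tips_pos[of t] by (cases "tips t") auto
  have "row_weight (cells t) y c = (\<Prod>i<Suc m. weight (t, i) (shift i y) c)"
    unfolding row_weight_eq_prod by (simp add: m nth_cells del: prod.lessThan_Suc)
  also have "\<dots> = weight (t, 0) y c"
    unfolding prod.lessThan_Suc_shift by (simp add: weight_def shift_def)
  finally show ?thesis by (simp add: weight_def)
qed

text \<open>
  The rows obtained by splitting off the right subtrees one after the other, from the whole tree
  down to its leftmost tip.
\<close>

fun left_spine :: "btree \<Rightarrow> btree list list" where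
  "left_spine Tip = [[Tip]]"
| "left_spine (Join l r) = [Join l r] # map (\<lambda>ts. ts @ [r]) (left_spine l)"

lemma left_spine_sum: "ts \<in> set (left_spine b) \<Longrightarrow> ts \<noteq> [] \<and> sum_list (map tips ts) = tips b"
  by (induction b arbitrary: ts) auto

text \<open>
  For \<open>Join l r\<close> with last point \<open>y\<^sub>e\<close>, the root factor times \<open>1 / (c - y\<^sub>0)\<close> is the root factor
  times \<open>1 / (c - y\<^sub>e)\<close> plus \<open>1 / ((c - y\<^sub>0) (c - y\<^sub>e))\<close>. The first term is the row with the
  single tile \<open>Join l r\<close>; in the second one \<open>r\<close> is a tile, and induction applies to \<open>l\<close>.
\<close>

lemma sum_left_spine:
  assumes "inj_on y {..<tips b}" "\<And>j. j < tips b \<Longrightarrow> c \<noteq> y j"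
  shows "(\<Sum>ts\<leftarrow>left_spine b. row_weight (row ts) y c) = btree_frac b y / (c - y 0)"
  using assms
proof (induction b)
  case Tip
  show ?case by (simp add: row_weight_cells cells_def weight_def)
next
  case (Join l r)
  note pos = tips_pos[of l] tips_pos[of r]
  let ?e = "tips l + tips r - 1"
  have IH: "(\<Sum>ts\<leftarrow>left_spine l. row_weight (row ts) y c) = btree_frac l y / (c - y 0)"
    by (rule Join.IH) (use Join.prems in \<open>auto elim!: inj_on_subset\<close>)
  have ne: "y 0 \<noteq> y ?e" "c \<noteq> y 0" "c \<noteq> y ?e"
    using Join.prems pos inj_onD[OF Join.prems(1), of 0 ?e] by auto
  let ?R = "row_weight (cells r) (shift (tips l) y) c"
  have R: "?R = btree_frac r (\<lambda>j. y (tips l + j)) / (c - y ?e)"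
    using pos by (simp add: row_weight_cells shift_def add.commute)
  have "(\<Sum>ts\<leftarrow>left_spine l. row_weight (row (ts @ [r])) y c) = (\<Sum>ts\<leftarrow>left_spine l. row_weight (row ts) y c * ?R)"
    by (rule arg_cong[of _ _ sum_list], rule map_cong[OF refl])
       (use left_spine_sum in \<open>auto simp: row_weight_append length_row\<close>)
  also have "\<dots> = btree_frac l y / (c - y 0) * ?R"
    unfolding IH[symmetric] by (rule sum_list_mult_const)
  finally have "(\<Sum>ts\<leftarrow>left_spine (Join l r). row_weight (row ts) y c) =
      btree_frac (Join l r) y / (c - y ?e) + btree_frac l y / (c - y 0) * ?R"
    by (simp add: row_weight_cells comp_def del: btree_frac.simps)
  also have "\<dots> = btree_frac (Join l r) y / (c - y 0)"
    using ne by (simp add: R divide_simps) (simp add: algebra_simps)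
  finally show ?case .
qed

lemma tiling_fun_wrap:
  assumes "sum_list (map tips ts) = n"
  shows "tiling_fun n (wrap ts) = on_configs n (\<lambda>y c. row_weight (row ts) y c)"
proof -
  have "length (row ts) = n" using assms by (simp add: length_row)
  then show ?thesis unfolding tiling_fun_def row_weight_eq_prod
    by (intro on_configs_eqI prod.cong) (auto simp: wrap_def)
qed

lemma short_wrap:
  assumes "sum_list (map tips ts) = n" "length ts \<ge> 2"
  shows "wrap ts \<in> short_tilings n"
proof -
  have "tips t < n" if "t \<in> set ts" for t
  proof -
    obtain us vs where ts: "ts = us @ t # vs" using \<open>t \<in> set ts\<close> by (auto simp: in_set_conv_decomp)
    obtain s where "s \<in> set (us @ vs)" using assms(2) ts by (cases us; cases vs) auto
    then have "tips s \<le> sum_list (map tips (us @ vs))" by (intro member_le_sum_list) auto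
    then show ?thesis using tips_pos[of s] assms(1) by (simp add: ts)
  qed
  moreover have "fst (wrap ts i) \<in> set ts" for i
  proof -
    have "row ts \<noteq> []" using assms(2) cells_nonempty by (cases ts) auto
    then have "wrap ts i \<in> set (row ts)" unfolding wrap_def by (intro nth_mem) simp
    then show ?thesis by (auto simp: cells_def)
  qed
  moreover have "wrap ts \<in> tilings n" by (rule wrap_tiling) (use assms in auto)
  ultimately show ?thesis by (simp add: short_tilings_def)
qed

text \<open>
  The single-tile row of the left spine is \<open>cauchy n b (n - 1)\<close>; all other rows have at least
  two tiles.
\<close>

lemma cauchy_first_minus_last:
  assumes "n \<ge> 2" "b \<in> btrees n"
  shows "cauchy n b 0 - cauchy n b (n - 1) \<in> fs.span (tiling_fun n ` short_tilings n)"
proof -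
  obtain l r where b: "b = Join l r" "tips l + tips r = n" using assms by (cases b) (auto simp: btrees_def)
  have span: "on_configs n (\<lambda>y c. \<Sum>ts\<leftarrow>L. row_weight (row ts) y c) \<in> fs.span (tiling_fun n ` short_tilings n)"
    if "\<And>ts. ts \<in> set L \<Longrightarrow> sum_list (map tips ts) = n \<and> length ts \<ge> 2" for L
    using that
  proof (induction L)
    case Nil
    have *: "on_configs n (\<lambda>y c. \<Sum>ts\<leftarrow>[]. row_weight (row ts) y c) = 0"
      by (auto simp: on_configs_def fun_eq_iff)
    show ?case unfolding * by (rule fs.span_zero)
  next
    case (Cons ts L)
    have "on_configs n (\<lambda>y c. \<Sum>ts\<leftarrow>ts # L. row_weight (row ts) y c) =
       tiling_fun n (wrap ts) + on_configs n (\<lambda>y c. \<Sum>ts\<leftarrow>L. row_weight (row ts) y c)"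
      using Cons.prems[of ts] by (auto simp: tiling_fun_wrap on_configs_def fun_eq_iff)
    also have "\<dots> \<in> fs.span (tiling_fun n ` short_tilings n)"
    proof (rule fs.span_add)
      show "tiling_fun n (wrap ts) \<in> fs.span (tiling_fun n ` short_tilings n)"
        using Cons.prems by (intro fs.span_base imageI short_wrap) auto
    qed (use Cons in auto)
    finally show ?case .
  qed
  let ?L = "map (\<lambda>ts. ts @ [r]) (left_spine l)"
  have "cauchy n b 0 - cauchy n b (n - 1) = on_configs n (\<lambda>y c. \<Sum>ts\<leftarrow>?L. row_weight (row ts) y c)"
  proof -
    have "btree_frac b y / (c - y 0) - btree_frac b y / (c - y (n - 1)) = (\<Sum>ts\<leftarrow>?L. row_weight (row ts) y c)"
      if y: "y \<in> circular n" "c \<notin> range y" for y c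
    proof -
      have "(\<Sum>ts\<leftarrow>left_spine b. row_weight (row ts) y c) = btree_frac b y / (c - y 0)"
        by (rule sum_left_spine) (use y assms(2) circular_inj in \<open>auto simp: btrees_def\<close>)
      moreover have "(\<Sum>ts\<leftarrow>left_spine b. row_weight (row ts) y c) =
        btree_frac b y / (c - y (n - 1)) + (\<Sum>ts\<leftarrow>?L. row_weight (row ts) y c)"
        using b row_weight_cells[of b y c] by simp
      ultimately show ?thesis by simp
    qed
    then show ?thesis by (auto simp: cauchy_def on_configs_def configs_def fun_eq_iff)
  qed
  also have "\<dots> \<in> fs.span (tiling_fun n ` short_tilings n)"
  proof (rule span)
    fix ts assume "ts \<in> set ?L"
    then obtain us where us: "us \<in> set (left_spine l)" "ts = us @ [r]" by auto
    show "sum_list (map tips ts) = n \<and> length ts \<ge> 2"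
      using left_spine_sum[OF us(1)] b(2) by (simp add: us(2) Suc_le_eq)
  qed
  finally show ?thesis .
qed

section \<open>The trace of a power of the anticyclic operator\<close>

context
  fixes \<tau> :: "dend \<Rightarrow> dend" and n :: nat
  assumes ac: "anticyclic_structure \<tau>" and n: "n \<ge> 2"
begin

lemma n_bounds: "n \<ge> 1" "n - 1 \<ge> 1" "n - 1 + 1 = n" using n by auto

text \<open>
  The matrix of the \<open>k\<close>-th power of \<open>\<tau>\<close> in the basis of normal forms; row \<open>b'\<close>, column \<open>b\<close>.
\<close>

definition tau_coef :: "nat \<Rightarrow> btree \<Rightarrow> btree \<Rightarrow> rat" where
  "tau_coef k b' b = dend.representation (nf ` btrees n) ((\<tau> ^^ k) (nf b)) (nf b')"

lemma nf_basis_n: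
  "inj_on nf (btrees n)" "dend.independent (nf ` btrees n)" "dend.span (nf ` btrees n) = Dend (n - 1)"
  using nf_basis[OF n_bounds(2)] unfolding n_bounds(3) .

lemma tau_pow_linear: "Vector_Spaces.linear dend_scale dend_scale (\<tau> ^^ k)"
proof (induction k)
  case 0 show ?case unfolding funpow.simps(1) by (rule dend.linear_id)
next
  case (Suc k)
  have "Vector_Spaces.linear dend_scale dend_scale (\<tau> \<circ> (\<tau> ^^ k))"
    by (rule Vector_Spaces.linear_compose[OF Suc tau_linear[OF ac]])
  then show ?case by (simp only: funpow.simps(2))
qed

lemma tau_pow_Dend: "x \<in> Dend (n - 1) \<Longrightarrow> (\<tau> ^^ k) x \<in> Dend (n - 1)"
proof (induction k)
  case (Suc k)
  then show ?case using tau_Dend[OF ac n_bounds(2)] by (simp only: funpow.simps o_apply)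
qed simp

lemma nf_in_Dend: "b \<in> btrees n \<Longrightarrow> nf b \<in> Dend (n - 1)"
  unfolding nf_basis_n(3)[symmetric] by (intro dend.span_base imageI)

lemma circular_inj_atMost: "y \<in> circular n \<Longrightarrow> inj_on y {..n - 1}"
proof -
  have "{..n - 1} = {..<n}" using n by auto
  then show "y \<in> circular n \<Longrightarrow> inj_on y {..n - 1}" using circular_inj[of y n] by simp
qed

lemma dend_value_tau_pow:
  "y \<in> circular n \<Longrightarrow> x \<in> Dend (n - 1) \<Longrightarrow> dend_value (n - 1) ((\<tau> ^^ k) x) y = dend_value (n - 1) x (shift k y)"
proof (induction k arbitrary: y)
  case 0
  then show ?case by (simp add: shift_def)
next
  case (Suc k)
  have "dend_value (n - 1) ((\<tau> ^^ Suc k) x) y = dend_value (n - 1) ((\<tau> ^^ k) x) (rot (n - 1) y)"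
    using dend_value_tau[OF ac tau_pow_Dend[OF Suc.prems(2)] circular_inj_atMost[OF Suc.prems(1)]] by simp
  also have "\<dots> = dend_value (n - 1) ((\<tau> ^^ k) x) (shift 1 y)"
  proof (rule dend_value_cong)
    fix j assume "j \<le> n - 1"
    moreover have "y n = y 0" using circular_periodic[OF Suc.prems(1), of 0 1] by simp
    ultimately show "rot (n - 1) y j = shift 1 y j" using n by (cases "j = n - 1") (auto simp: rot_def shift_def)
  qed
  also have "\<dots> = dend_value (n - 1) x (shift k (shift 1 y))"
    by (rule Suc.IH) (use Suc.prems shift_circular n in auto)
  finally show ?case by (simp add: shift_shift)
qed

lemma dend_value_nf_circular: "b \<in> btrees n \<Longrightarrow> y \<in> circular n \<Longrightarrow> dend_value (n - 1) (nf b) y = btree_frac b y"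
  by (rule dend_value_nf) (use n circular_inj_atMost in \<open>auto simp: btrees_def\<close>)

lemma btree_frac_shift:
  assumes "b \<in> btrees n" "y \<in> circular n"
  shows "btree_frac b (shift k y) = (\<Sum>b'\<in>btrees n. of_rat (tau_coef k b' b) * btree_frac b' y)"
proof -
  have "(\<tau> ^^ k) (nf b) \<in> dend.span (nf ` btrees n)"
    using nf_basis_n(3) tau_pow_Dend nf_in_Dend[OF assms(1)] by simp
  from dend.representation_family_sum[OF finite_btrees nf_basis_n(1,2) this]
  have e: "(\<tau> ^^ k) (nf b) = (\<Sum>b'\<in>btrees n. dend_scale (tau_coef k b' b) (nf b'))"
    by (simp add: tau_coef_def)
  have "btree_frac b (shift k y) = dend_value (n - 1) ((\<tau> ^^ k) (nf b)) y"
    using dend_value_nf_circular[OF assms(1) shift_circular[OF assms(2) n_bounds(1)]] dend_value_tau_pow[OF assms(2) nf_in_Dend[OF assms(1)]] by simp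
  also have "\<dots> = (\<Sum>b'\<in>btrees n. of_rat (tau_coef k b' b) * btree_frac b' y)"
    unfolding e dend_value_sum dend_value_scale
  proof (rule sum.cong[OF refl])
    fix b' assume b': "b' \<in> btrees n"
    show "of_rat (tau_coef k b' b) * dend_value (n - 1) (nf b') y = of_rat (tau_coef k b' b) * btree_frac b' y"
      unfolding dend_value_nf_circular[OF b' assms(2)] ..
  qed
  finally show ?thesis .
qed

lemma trace_eq_sum_tau_coef: "trace_on dend_scale (Dend (n - 1)) (\<tau> ^^ k) = (\<Sum>b\<in>btrees n. tau_coef k b b)"
proof -
  have "trace_on dend_scale (Dend (n - 1)) (\<tau> ^^ k) =
      (\<Sum>x\<in>nf ` btrees n. dend.representation (nf ` btrees n) ((\<tau> ^^ k) x) x)"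
    by (rule dend.trace_on_eq_basis_trace[OF _ nf_basis_n(2,3) tau_pow_linear])
       (use finite_btrees tau_pow_Dend in auto)
  then show ?thesis by (simp add: sum.reindex[OF nf_basis_n(1)] tau_coef_def)
qed

lemma trace_identity:
  assumes "n dvd k"
  shows "trace_on dend_scale (Dend (n - 1)) (\<tau> ^^ k) = of_nat (card (btrees n))"
proof -
  have "tau_coef k b b = 1" if b: "b \<in> btrees n" for b
  proof -
    have "real_of_rat (tau_coef k b b) - (if b = b then 1 else 0) = 0"
    proof (rule btree_frac_independent_circular[of n "\<lambda>b'. real_of_rat (tau_coef k b' b) - (if b' = b then 1 else 0)", OF n_bounds(1) _ b])
      fix y assume y: "y \<in> circular n"
      have "shift k y = y" using assms circular_periodic[OF y] by (auto simp: shift_def dvd_def)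
      then have "(\<Sum>b'\<in>btrees n. real_of_rat (tau_coef k b' b) * btree_frac b' y) = btree_frac b y"
        using btree_frac_shift[OF b y, of k] by simp
      moreover have "(\<Sum>b'\<in>btrees n. (if b' = b then 1 else 0) * btree_frac b' y) = (\<Sum>b'\<in>btrees n. if b' = b then btree_frac b' y else 0)"
        by (intro sum.cong refl) simp
      ultimately show "(\<Sum>b'\<in>btrees n. (real_of_rat (tau_coef k b' b) - (if b' = b then 1 else 0)) * btree_frac b' y) = 0"
        using b by (simp add: left_diff_distrib sum_subtractf finite_btrees)
    qed
    then have "real_of_rat (tau_coef k b b) = real_of_rat 1" by simp
    then show ?thesis by (simp only: of_rat_eq_iff)
  qed
  then show ?thesis unfolding trace_eq_sum_tau_coef by simp
qed

definition cauchy_index :: "(btree \<times> nat) set" where "cauchy_index = btrees n \<times> {..<n}"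

abbreviation cauchy_pair where "cauchy_pair \<equiv> \<lambda>(b, j). cauchy n b j"

lemma cauchy_mod: "cauchy n b (j mod n) = cauchy n b j"
  unfolding cauchy_def
proof (rule on_configs_eqI)
  fix y c assume "y \<in> circular n"
  then have "y (j mod n) = y j" using circular_eq_iff[of y n "j mod n" j] n_bounds(1) by simp
  then show "btree_frac b y / (c - y (j mod n)) = btree_frac b y / (c - y j)" by simp
qed

lemma cauchy_independent:
  "inj_on cauchy_pair cauchy_index" "fs.independent (cauchy_pair ` cauchy_index)"
proof -
  have *: "q i = 0" if z: "(\<Sum>i\<in>cauchy_index. fscale (q i) (cauchy_pair i)) = 0" and i: "i \<in> cauchy_index" for q i
  proof -
    obtain b j where bj: "i = (b, j)" "b \<in> btrees n" "j < n" using i by (auto simp: cauchy_index_def)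
    have "real_of_rat (q (b, j)) = 0"
    proof (rule btree_frac_independent_circular[OF n_bounds(1) _ bj(2)])
      fix y assume y: "y \<in> circular n"
      let ?h = "\<lambda>j. \<Sum>b\<in>btrees n. real_of_rat (q (b, j)) * btree_frac b y"
      show "?h j = 0"
      proof (rule partial_fractions_zero[of "{..<n}" y ?h])
        fix c assume c: "c \<notin> y ` {..<n}"
        have "c \<notin> range y"
        proof
          assume "c \<in> range y"
          then obtain j where "c = y j" by auto
          then have "c = y (j mod n)" using circular_eq_iff[OF y n_bounds(1), of j "j mod n"] by simp
          then show False using c n by auto
        qed
        then have g: "(y, c) \<in> configs n" using y by (simp add: configs_def)
        have "0 = (\<Sum>i\<in>cauchy_index. fscale (q i) (cauchy_pair i)) (y, c)" by (simp only: z) simp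
        also have "\<dots> = (\<Sum>b\<in>btrees n. \<Sum>j<n. of_rat (q (b, j)) * (btree_frac b y / (c - y j)))"
          unfolding fs_sum_apply cauchy_index_def sum.cartesian_product
          by (intro sum.cong refl) (use g in \<open>auto simp: cauchy_def on_configs_def\<close>)
        also have "\<dots> = (\<Sum>j<n. ?h j / (c - y j))"
          by (subst sum.swap) (simp add: sum_divide_distrib)
        finally show "(\<Sum>j<n. ?h j / (c - y j)) = 0" by simp
      qed (use y bj circular_inj in auto)
    qed
    then show ?thesis by (simp add: bj)
  qed
  have fin: "finite cauchy_index" by (simp add: cauchy_index_def finite_btrees)
  show "inj_on cauchy_pair cauchy_index" "fs.independent (cauchy_pair ` cauchy_index)"
    by (rule fs.family_independent[OF fin], rule *, assumption+)+
qed

lemma turn_cauchy: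
  assumes "b \<in> btrees n"
  shows "turn n k (cauchy n b j) = (\<Sum>b'\<in>btrees n. fscale (tau_coef k b' b) (cauchy n b' (j + k)))"
proof
  fix p :: "(nat \<Rightarrow> real) \<times> real"
  obtain y c where p: "p = (y, c)" by (cases p) auto
  show "turn n k (cauchy n b j) p = (\<Sum>b'\<in>btrees n. fscale (tau_coef k b' b) (cauchy n b' (j + k))) p"
  proof (cases "p \<in> configs n")
    case True
    then have y: "y \<in> circular n" by (simp add: p configs_def)
    have "turn n k (cauchy n b j) p = btree_frac b (shift k y) / (c - y (j + k))"
      unfolding cauchy_def turn_on_configs[OF n_bounds(1)] using True by (simp add: on_configs_def p shift_def)
    then show ?thesis using True
      by (simp add: btree_frac_shift[OF assms y] fs_sum_apply cauchy_def on_configs_def p sum_divide_distrib)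
  next
    case False
    then show ?thesis by (simp add: turn_def on_configs_def fs_sum_apply cauchy_def)
  qed
qed

abbreviation tile_span where "tile_span \<equiv> fs.span (tiling_fun n ` short_tilings n)"

lemma turn_tiling: "u \<in> short_tilings n \<Longrightarrow> turn n k (tiling_fun n u) = tiling_fun n (\<lambda>i. u (i + (n - 1) * k))"
  by (rule turn_tiling_fun) (use n in \<open>auto simp: short_tilings_def tilings_def\<close>)

lemma shift_short: "u \<in> short_tilings n \<Longrightarrow> (\<lambda>i. u (i + s)) \<in> short_tilings n"
  using shift_tiling by (auto simp: short_tilings_def)

lemma turn_tile_span:
  assumes "f \<in> tile_span" shows "turn n k f \<in> tile_span"
proof -
  interpret l: Vector_Spaces.linear fscale fscale "turn n k" by (rule turn_linear)
  show ?thesis using assms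
  proof (induction rule: fs.span_induct_alt)
    case base then show ?case by (simp only: l.zero fs.span_zero)
  next
    case (step c f g)
    then obtain u where u: "u \<in> short_tilings n" "f = tiling_fun n u" by auto
    have "turn n k f \<in> tile_span" unfolding u(2) turn_tiling[OF u(1)]
      by (intro fs.span_base imageI shift_short u(1))
    then show ?case using step by (simp only: l.add l.scale fs.span_add fs.span_scale)
  qed
qed

text \<open>
  This is \<open>cauchy_first_minus_last\<close> up to a rotation. Rotating \<open>cauchy n b\<close> mixes the trees with
  the matrix of \<open>\<tau>\<close>, so the difference is first rotated to the place where the lemma applies to all
  trees, and then rotated back.
\<close>

lemma cauchy_succ_minus:
  assumes b: "b \<in> btrees n"
  shows "cauchy n b (Suc i) - cauchy n b i \<in> tile_span"
proof -
  let ?s = "(n - 1) * Suc i"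
  have s1: "(Suc i + ?s) mod n = 0"
  proof -
    have "Suc i + ?s = n * Suc i" using n by (cases n) auto
    then show ?thesis by simp
  qed
  have s2: "(i + ?s) mod n = n - 1"
  proof -
    have "i + ?s = (n - 1) + n * i" using n by (cases n) auto
    then show ?thesis using n by (simp only: mod_mult_self2) simp
  qed
  let ?f = "cauchy n b (Suc i) - cauchy n b i"
  interpret l: Vector_Spaces.linear fscale fscale "turn n k" for k by (rule turn_linear)
  have "turn n ?s ?f = (\<Sum>b'\<in>btrees n. fscale (tau_coef ?s b' b) (cauchy n b' 0 - cauchy n b' (n - 1)))"
    unfolding l.diff turn_cauchy[OF b] sum_subtractf[symmetric] fs.scale_right_diff_distrib[symmetric]
    using cauchy_mod[of _ "Suc i + ?s"] cauchy_mod[of _ "i + ?s"] unfolding s1 s2 by simp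
  also have "\<dots> \<in> tile_span"
    by (intro fs.span_sum fs.span_scale cauchy_first_minus_last n)
  finally have "turn n (Suc i) (turn n ?s ?f) \<in> tile_span" by (rule turn_tile_span)
  moreover have "turn n (Suc i) (turn n ?s ?f) = ?f"
  proof -
    have e: "Suc i + ?s = n * Suc i" using n by (cases n) auto
    have "turn n (n * Suc i) (cauchy n b j) = cauchy n b j" for j
    proof -
      have "shift (n * Suc i) y = y" if "y \<in> circular n" for y
        using circular_periodic[OF that, of _ "Suc i"] by (simp only: shift_def)
      then show ?thesis unfolding cauchy_def turn_on_configs[OF n_bounds(1)] by (intro on_configs_eqI) simp
    qed
    then show ?thesis unfolding turn_turn[OF n_bounds(1)] e l.diff by simp
  qed
  ultimately show ?thesis by simp
qed

lemma cauchy_minus_first: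
  assumes b: "b \<in> btrees n"
  shows "cauchy n b i - cauchy n b 0 \<in> tile_span"
proof (induction i)
  case 0 show ?case by (simp only: diff_self fs.span_zero)
next
  case (Suc i)
  have "cauchy n b (Suc i) - cauchy n b 0 = (cauchy n b (Suc i) - cauchy n b i) + (cauchy n b i - cauchy n b 0)"
    by simp
  then show ?case using fs.span_add[OF cauchy_succ_minus[OF b] Suc] by (simp only:)
qed

text \<open>
  The set \<open>?E\<close> is the first basis of the space \<open>Z\<close> described at the beginning; the rotation moves
  the index \<open>j\<close> of \<open>cauchy n b j\<close> to \<open>j + k\<close>, so all diagonal entries vanish. In the second
  basis \<open>?F\<close> the elements of \<open>?Z\<close> are permuted and contribute the fixed tilings, and modulo the span
  of \<open>?Z\<close> the elements of \<open>?A\<close> are transformed by the matrix of the \<open>k\<close>-th power of \<open>\<tau>\<close>.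
\<close>

lemma trace_nonidentity:
  assumes k: "\<not> n dvd k"
  shows "trace_on dend_scale (Dend (n - 1)) (\<tau> ^^ k) = - of_nat (card (tilings (gcd k n)))"
proof -
  interpret l: Vector_Spaces.linear fscale fscale "turn n k" by (rule turn_linear)
  let ?E = "cauchy_pair ` cauchy_index"
  let ?A = "(\<lambda>b. cauchy n b 0) ` btrees n" and ?Z = "tiling_fun n ` short_tilings n"
  let ?F = "?A \<union> ?Z"
  have finI: "finite cauchy_index" by (simp add: cauchy_index_def finite_btrees)
  have finS: "finite (short_tilings n)"
    using finite_subset[OF _ finite_tilings[OF n_bounds(1)]] by (auto simp: short_tilings_def)
  have finF: "finite ?F" using finite_btrees finS by auto
  have cE: "card ?E = card (btrees n) * n"
    using card_image[OF cauchy_independent(1)] by (simp add: cauchy_index_def card_cartesian_product)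
  have EF: "?E \<subseteq> fs.span ?F"
  proof safe
    fix b j assume "(b, j) \<in> cauchy_index"
    then have b: "b \<in> btrees n" by (simp add: cauchy_index_def)
    have "cauchy n b j - cauchy n b 0 \<in> fs.span ?F"
      using cauchy_minus_first[OF b, of j] fs.span_mono[of ?Z ?F] by auto
    moreover have "cauchy n b 0 \<in> fs.span ?F" using b by (intro fs.span_base) auto
    ultimately have "(cauchy n b j - cauchy n b 0) + cauchy n b 0 \<in> fs.span ?F" by (rule fs.span_add)
    then show "cauchy n b j \<in> fs.span ?F" by simp
  qed
  have cA: "card ?A \<le> card (btrees n)" and cZ: "card ?Z \<le> card (short_tilings n)"
    by (rule card_image_le, simp add: finite_btrees finS)+
  have cS: "card (short_tilings n) \<le> (n - 1) * card (btrees n)" by (rule card_short_tilings[OF n])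
  have cE': "card ?E = card (btrees n) + (n - 1) * card (btrees n)" unfolding cE using n by (cases n) auto
  have cF: "card ?F \<le> card ?A + card ?Z" by (rule card_Un_le)
  \<comment> \<open>\<open>?F\<close> spans \<open>?E\<close> and cannot be larger than it, so it is a basis, and the families that make it up have no repetitions\<close>
  have "card ?F \<le> card ?E" using cF cA cZ cS cE' by linarith
  note F = fs.spanning_family_independent[OF cauchy_independent(2) finF EF this]
  have eqs: "card ?A = card (btrees n)" "card ?Z = card (short_tilings n)" "card ?F = card ?A + card ?Z"
    using F(3) cF cA cZ cS cE' by linarith+
  have injA: "inj_on (\<lambda>b. cauchy n b 0) (btrees n)" by (rule eq_card_imp_inj_on[OF finite_btrees eqs(1)])
  have injZ: "inj_on (tiling_fun n) (short_tilings n)" by (rule eq_card_imp_inj_on[OF finS eqs(2)])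
  have disj: "?A \<inter> ?Z = {}"
    using card_Un_Int[of ?A ?Z] finite_btrees finS eqs(3) by simp
  have indA: "fs.independent ?A" and indZ: "fs.independent ?Z"
    by (rule fs.independent_mono[OF F(1)], simp)+
  define u where "u = (\<lambda>v i. v (i + (n - 1) * k) :: btree \<times> nat)"
  have uS: "u v \<in> short_tilings n" if "v \<in> short_tilings n" for v
    unfolding u_def by (rule shift_short[OF that])
  have turnE: "turn n k e \<in> fs.span ?E" if "e \<in> ?E" for e
  proof -
    obtain b j where e: "e = cauchy n b j" "b \<in> btrees n"
      using \<open>e \<in> ?E\<close> by (auto simp: cauchy_index_def)
    show ?thesis unfolding e(1) turn_cauchy[OF e(2)]
    proof (intro fs.span_sum fs.span_scale)
      fix b' assume "b' \<in> btrees n"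
      then have "cauchy n b' ((j + k) mod n) \<in> ?E"
        using n by (intro image_eqI[of _ _ "(b', (j + k) mod n)"]) (auto simp: cauchy_index_def)
      then show "cauchy n b' (j + k) \<in> fs.span ?E" by (simp only: cauchy_mod fs.span_base)
    qed
  qed
  have "(\<Sum>e\<in>?E. fs.representation ?E (turn n k e) e) = 0"
  proof (rule sum.neutral, rule ballI)
    fix e assume "e \<in> ?E"
    then obtain b j where e: "e = cauchy n b j" "b \<in> btrees n" "j < n" by (auto simp: cauchy_index_def)
    define q where "q = (\<lambda>(b', j'). if j' = (j + k) mod n then tau_coef k b' b else 0)"
    have "turn n k e = (\<Sum>b'\<in>btrees n. fscale (tau_coef k b' b) (cauchy n b' ((j + k) mod n)))"
      unfolding e(1) turn_cauchy[OF e(2)] cauchy_mod ..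
    also have "\<dots> = (\<Sum>b'\<in>btrees n. \<Sum>j'<n. fscale (q (b', j')) (cauchy n b' j'))"
    proof (intro sum.cong refl)
      fix b'
      have "(\<Sum>j'<n. fscale (q (b', j')) (cauchy n b' j')) =
         (\<Sum>j'<n. if j' = (j + k) mod n then fscale (tau_coef k b' b) (cauchy n b' j') else 0)"
        by (intro sum.cong refl) (auto simp: q_def)
      then show "fscale (tau_coef k b' b) (cauchy n b' ((j + k) mod n)) = (\<Sum>j'<n. fscale (q (b', j')) (cauchy n b' j'))"
        using n by simp
    qed
    also have "\<dots> = (\<Sum>i\<in>cauchy_index. fscale (q i) (cauchy_pair i))"
      unfolding cauchy_index_def sum.cartesian_product by (simp add: case_prod_unfold)
    finally have "turn n k e = (\<Sum>i\<in>cauchy_index. fscale (q i) (cauchy_pair i))" .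
    moreover have "fs.representation ?E (\<Sum>i\<in>cauchy_index. fscale (q i) (cauchy_pair i)) (cauchy_pair (b, j)) = q (b, j)"
      by (rule fs.family_representation[OF finI cauchy_independent]) (use e in \<open>simp add: cauchy_index_def\<close>)
    moreover have "j \<noteq> (j + k) mod n"
    proof
      assume "j = (j + k) mod n"
      then have "n * ((j + k) div n) + j = j + k" using mult_div_mod_eq[of n "j + k"] by simp
      then have "k = n * ((j + k) div n)" by simp
      then show False using k by (metis dvd_triv_left)
    qed
    ultimately show "fs.representation ?E (turn n k e) e = 0" by (simp add: e(1) q_def)
  qed
  moreover have "(\<Sum>e\<in>?E. fs.representation ?E (turn n k e) e) = (\<Sum>e\<in>?F. fs.representation ?F (turn n k e) e)"
    by (rule fs.basis_trace_unique[OF _ cauchy_independent(2) finF F(1,2) turn_linear turnE]) (use finI in auto)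
  moreover have "(\<Sum>e\<in>?F. fs.representation ?F (turn n k e) e) =
     (\<Sum>b\<in>btrees n. fs.representation ?F (turn n k (cauchy n b 0)) (cauchy n b 0)) +
     (\<Sum>v\<in>short_tilings n. fs.representation ?F (turn n k (tiling_fun n v)) (tiling_fun n v))"
    using disj finite_btrees finS by (subst sum.union_disjoint) (auto simp: sum.reindex[OF injA] sum.reindex[OF injZ])
  moreover have "(\<Sum>b\<in>btrees n. fs.representation ?F (turn n k (cauchy n b 0)) (cauchy n b 0)) = (\<Sum>b\<in>btrees n. tau_coef k b b)"
  proof (intro sum.cong refl)
    fix b assume b: "b \<in> btrees n"
    let ?g = "\<Sum>b'\<in>btrees n. fscale (tau_coef k b' b) (cauchy n b' 0)"
    let ?h = "\<Sum>b'\<in>btrees n. fscale (tau_coef k b' b) (cauchy n b' k - cauchy n b' 0)"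
    have "turn n k (cauchy n b 0) = ?g + ?h"
      unfolding turn_cauchy[OF b] sum.distrib[symmetric] fs.scale_right_distrib[symmetric] by simp
    moreover have g: "?g \<in> fs.span ?A" by (intro fs.span_sum fs.span_scale fs.span_base) auto
    moreover have h: "?h \<in> fs.span ?Z" by (intro fs.span_sum fs.span_scale cauchy_minus_first)
    moreover have "?g \<in> fs.span ?F" "?h \<in> fs.span ?F" using g h fs.span_mono[of ?A ?F] fs.span_mono[of ?Z ?F] by auto
    ultimately have "fs.representation ?F (turn n k (cauchy n b 0)) (cauchy n b 0) =
       fs.representation ?F ?g (cauchy n b 0) + fs.representation ?F ?h (cauchy n b 0)"
      by (simp only: fs.representation_add[OF F(1)])
    also have "fs.representation ?F ?g = fs.representation ?A ?g"
      by (rule fs.representation_extend[OF F(1) g]) simp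
    also have "fs.representation ?F ?h = fs.representation ?Z ?h"
      by (rule fs.representation_extend[OF F(1) h]) simp
    also have "fs.representation ?A ?g (cauchy n b 0) = tau_coef k b b"
      by (rule fs.family_representation[OF finite_btrees injA indA b])
    also have "fs.representation ?Z ?h (cauchy n b 0) = 0"
    proof -
      have "cauchy n b 0 \<notin> ?Z" using disj b by auto
      then show ?thesis using fs.representation_ne_zero by blast
    qed
    finally show "fs.representation ?F (turn n k (cauchy n b 0)) (cauchy n b 0) = tau_coef k b b" by simp
  qed
  moreover have "(\<Sum>v\<in>short_tilings n. fs.representation ?F (turn n k (tiling_fun n v)) (tiling_fun n v)) =
      of_nat (card (tilings (gcd k n)))"
  proof -
    have "(\<Sum>v\<in>short_tilings n. fs.representation ?F (turn n k (tiling_fun n v)) (tiling_fun n v)) =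
       (\<Sum>v\<in>short_tilings n. if u v = v then 1 else 0)"
    proof (intro sum.cong refl)
      fix v assume v: "v \<in> short_tilings n"
      have t: "turn n k (tiling_fun n v) = tiling_fun n (u v)" unfolding u_def by (rule turn_tiling[OF v])
      have "tiling_fun n (u v) \<in> ?F" using uS[OF v] by auto
      then have "fs.representation ?F (tiling_fun n (u v)) = (\<lambda>w. if w = tiling_fun n (u v) then 1 else 0)"
        by (rule fs.representation_basis[OF F(1)])
      moreover have "tiling_fun n v = tiling_fun n (u v) \<longleftrightarrow> u v = v"
        using inj_on_eq_iff[OF injZ v uS[OF v]] by auto
      ultimately show "fs.representation ?F (turn n k (tiling_fun n v)) (tiling_fun n v) = (if u v = v then 1 else 0)"
        unfolding t by simp
    qed
    also have "\<dots> = of_nat (card {v \<in> short_tilings n. u v = v})"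
      using finS by (simp add: sum.If_cases Int_def)
    also have "{v \<in> short_tilings n. u v = v} = tilings (gcd k n)"
      unfolding u_def by (rule fixed_short_tilings[OF n_bounds(1) k])
    finally show ?thesis .
  qed
  ultimately show ?thesis unfolding trace_eq_sum_tau_coef by linarith
qed

end

section \<open>Moebius inversion and tilings with a given least period\<close>

text \<open>
  The squarefree divisors of \<open>m\<close> are the products of sets of prime factors, so the sum is
  \<open>(1 - 1)\<close> to the number of prime factors.
\<close>

lemma sum_moebius:
  assumes "m \<ge> 1"
  shows "(\<Sum>d | d dvd m. moebius d) = (if m = 1 then 1 else 0)"
proof -
  let ?P = "prime_factors m"
  have m0: "m \<noteq> 0" using assms by simp
  have fin: "finite {d. d dvd m}" using m0 by simp
  have pf: "prime_factors (\<Prod>S) = S \<and> squarefree (\<Prod>S)" if S: "S \<subseteq> ?P" for S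
  proof -
    have fS: "finite S" by (rule finite_subset[OF S]) simp
    have pr: "\<And>p. p \<in> S \<Longrightarrow> prime p" using S by auto
    have "prime_factorization (\<Prod>S) = (\<Sum>p\<in>S. prime_factorization p)"
      by (rule prime_factorization_prod[OF fS]) (use pr in \<open>auto dest: prime_gt_0_nat\<close>)
    also have "\<dots> = (\<Sum>p\<in>S. {#p#})"
      by (intro sum.cong refl prime_factorization_prime pr)
    also have "\<dots> = mset_set S" using fS by (induction S rule: finite_induct) auto
    finally have f: "prime_factorization (\<Prod>S) = mset_set S" .
    have ne: "\<Prod>S \<noteq> 0" using fS pr by (auto dest: prime_gt_0_nat)
    have "squarefree (\<Prod>S)"
      unfolding squarefree_factorial_semiring''[OF ne]
    proof safe
      fix p :: nat assume "prime p"
      then have "multiplicity p (\<Prod>S) = count (mset_set S) p"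
        using f count_prime_factorization_prime[of p "\<Prod>S"] by simp
      then show "multiplicity p (\<Prod>S) \<le> 1" using fS by (cases "p \<in> S") auto
    qed
    then show ?thesis using f fS by simp
  qed
  have bij: "bij_betw (\<lambda>S. \<Prod>S) (Pow ?P) {d. d dvd m \<and> squarefree d}"
  proof (rule bij_betw_byWitness[where f' = prime_factors])
    show "\<forall>S\<in>Pow ?P. prime_factors (\<Prod>S) = S" using pf by blast
    show "\<forall>d\<in>{d. d dvd m \<and> squarefree d}. \<Prod>(prime_factors d) = d"
    proof
      fix d assume d: "d \<in> {d. d dvd m \<and> squarefree d}"
      then have d0: "d \<noteq> 0" using m0 by auto
      have "\<Prod>(prime_factors d) = (\<Prod>p\<in>prime_factors d. p ^ multiplicity p d)"
      proof (intro prod.cong refl)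
        fix p assume p: "p \<in> prime_factors d"
        then have "multiplicity p d \<le> 1" using d d0 squarefree_factorial_semiring'' by auto
        moreover have "multiplicity p d \<ge> 1" using p by (simp add: prime_factors_multiplicity)
        ultimately have "multiplicity p d = 1" by simp
        then show "p = p ^ multiplicity p d" by simp
      qed
      also have "\<dots> = d" using prod_prime_factors[OF d0] by simp
      finally show "\<Prod>(prime_factors d) = d" .
    qed
    show "(\<lambda>S. \<Prod>S) ` Pow ?P \<subseteq> {d. d dvd m \<and> squarefree d}"
    proof safe
      fix S assume S: "S \<subseteq> ?P"
      show "squarefree (\<Prod>S)" using pf[OF S] by simp
      have "prime_factorization (\<Prod>S) \<subseteq># prime_factorization m"
      proof (rule mset_subset_eqI)
        fix p
        have "count (prime_factorization (\<Prod>S)) p \<le> (if p \<in> S then 1 else 0)"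
        proof (cases "p \<in> S")
          case True
          then have "prime p" using S by auto
          moreover have "\<Prod>S \<noteq> 0" using pf[OF S] by (metis not_squarefree_0)
          ultimately show ?thesis using pf[OF S] True
            by (auto simp: squarefree_factorial_semiring'' count_prime_factorization)
        next
          case False
          then have "p \<notin># prime_factorization (\<Prod>S)" using pf[OF S] by simp
          then show ?thesis using False by (simp add: not_in_iff)
        qed
        also have "\<dots> \<le> count (prime_factorization m) p"
          using S by (auto simp: Suc_le_eq)
        finally show "count (prime_factorization (\<Prod>S)) p \<le> count (prime_factorization m) p" .
      qed
      moreover have "\<Prod>S \<noteq> 0" using pf[OF S] by (metis not_squarefree_0)
      ultimately show "\<Prod>S dvd m" using m0 by (simp add: prime_factorization_subset_iff_dvd)
    qed
    show "prime_factors ` {d. d dvd m \<and> squarefree d} \<subseteq> Pow ?P"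
      using m0 dvd_prime_factors by blast
  qed
  have "(\<Sum>d | d dvd m. moebius d) = (\<Sum>d | d dvd m \<and> squarefree d. moebius d)"
    using fin by (intro sum.mono_neutral_right) (auto simp: moebius_def)
  also have "\<dots> = (\<Sum>S\<in>Pow ?P. moebius (\<Prod>S))"
    by (rule sum.reindex_bij_betw[OF bij, symmetric])
  also have "\<dots> = (\<Sum>S\<in>Pow ?P. (- 1) ^ card S)"
    by (intro sum.cong refl) (use pf in \<open>simp add: moebius_def\<close>)
  also have "\<dots> = (\<Sum>S\<in>Pow ?P. \<Prod>p\<in>S. - 1)" by (intro sum.cong refl) simp
  also have "\<dots> = (\<Prod>p\<in>?P. - 1 + 1)" using prod_add[of ?P "\<lambda>_. - 1 :: int" "\<lambda>_. 1"] by simp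
  also have "\<dots> = (if ?P = {} then 1 else 0)" by (simp add: card_gt_0_iff)
  also have "?P = {} \<longleftrightarrow> m = 1" using m0 by (simp add: prime_factorization_empty_iff)
  finally show ?thesis .
qed

text \<open>
  Moebius inversion: exchange the sums over \<open>e\<close> dividing \<open>d\<close> dividing \<open>g\<close> and put \<open>d = e * c\<close>; then
  the sum over \<open>c\<close> vanishes unless \<open>e = g\<close>.
\<close>

lemma divisor_sum_a_num:
  assumes "g \<ge> 1"
  shows "(\<Sum>d | d dvd g. of_nat d * a_num d) = of_nat (card (tilings g))"
proof -
  define F where "F = (\<lambda>e. rat_of_nat (2 * e choose e))"
  have fin: "finite {d. d dvd g}" using assms by simp
  have "(\<Sum>d | d dvd g. of_nat d * a_num d) = (\<Sum>d | d dvd g. \<Sum>e | e dvd d. of_int (moebius (d div e)) * F e / 2)"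
  proof (intro sum.cong refl)
    fix d assume "d \<in> {d. d dvd g}"
    then have "d \<noteq> 0" using assms by auto
    then show "of_nat d * a_num d = (\<Sum>e | e dvd d. of_int (moebius (d div e)) * F e / 2)"
      by (simp add: a_num_def F_def sum_divide_distrib sum_distrib_left)
  qed
  also have "\<dots> = (\<Sum>(d, e)\<in>(SIGMA d:{d. d dvd g}. {e. e dvd d}). of_int (moebius (d div e)) * F e / 2)"
  proof (rule sum.Sigma[OF fin], rule ballI)
    fix d assume "d \<in> {d. d dvd g}"
    then have "d \<noteq> 0" using assms by auto
    then show "finite {e. e dvd d}" by simp
  qed
  also have "\<dots> = (\<Sum>(e, c)\<in>(SIGMA e:{e. e dvd g}. {c. c dvd g div e}). of_int (moebius c) * F e / 2)"
  proof (rule sum.reindex_bij_witness[of _ "\<lambda>(e, c). (e * c, e)" "\<lambda>(d, e). (e, d div e)"])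
    fix a assume "a \<in> (SIGMA d:{d. d dvd g}. {e. e dvd d})"
    then obtain d e where a: "a = (d, e)" "d dvd g" "e dvd d" by auto
    have "e \<noteq> 0" using a assms by (cases "e = 0") auto
    show "(case case a of (d, e) \<Rightarrow> (e, d div e) of (e, c) \<Rightarrow> (e * c, e)) = a" using a by simp
    show "(case a of (d, e) \<Rightarrow> (e, d div e)) \<in> (SIGMA e:{e. e dvd g}. {c. c dvd g div e})"
      using a dvd_trans[OF a(3,2)] by (auto simp: div_dvd_div)
    show "(case case a of (d, e) \<Rightarrow> (e, d div e) of (e, c) \<Rightarrow> of_int (moebius c) * F e / 2) =
         (case a of (d, e) \<Rightarrow> of_int (moebius (d div e)) * F e / 2)" using a by simp
  next
    fix b assume "b \<in> (SIGMA e:{e. e dvd g}. {c. c dvd g div e})"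
    then obtain e c where b: "b = (e, c)" "e dvd g" "c dvd g div e" by auto
    have "e \<noteq> 0" using b assms by (cases "e = 0") auto
    moreover have "e * c dvd e * (g div e)" using b(3) by (rule mult_dvd_mono[OF dvd_refl])
    ultimately show "(case b of (e, c) \<Rightarrow> (e * c, e)) \<in> (SIGMA d:{d. d dvd g}. {e. e dvd d})"
      using b by simp
    show "(case case b of (e, c) \<Rightarrow> (e * c, e) of (d, e) \<Rightarrow> (e, d div e)) = b"
      using b \<open>e \<noteq> 0\<close> by simp
  qed
  also have "\<dots> = (\<Sum>e | e dvd g. \<Sum>c | c dvd g div e. of_int (moebius c) * F e / 2)"
  proof (rule sum.Sigma[symmetric, OF fin], rule ballI)
    fix e assume "e \<in> {e. e dvd g}"
    then have "g div e \<noteq> 0" using assms by (auto elim!: dvdE)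
    then show "finite {c. c dvd g div e}" by simp
  qed
  also have "\<dots> = (\<Sum>e | e dvd g. if e = g then F e / 2 else 0)"
  proof (intro sum.cong refl)
    fix e assume "e \<in> {e. e dvd g}"
    then obtain h where h: "g = e * h" by auto
    then have eh: "e \<noteq> 0" "h \<noteq> 0" using assms by auto
    have "(\<Sum>c | c dvd g div e. rat_of_int (moebius c) * F e / 2) = of_int (\<Sum>c | c dvd h. moebius c) * (F e / 2)"
      using eh by (simp add: h sum_distrib_right)
    also have "\<dots> = (if e = g then F e / 2 else 0)" using eh by (subst sum_moebius) (auto simp: h)
    finally show "(\<Sum>c | c dvd g div e. rat_of_int (moebius c) * F e / 2) = (if e = g then F e / 2 else 0)" .
  qed
  also have "\<dots> = F g / 2" using fin by simp
  also have "\<dots> = of_nat (card (tilings g))"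
    unfolding F_def card_tilings[OF assms, symmetric] by simp
  finally show ?thesis .
qed

definition primitive_tilings :: "nat \<Rightarrow> (nat \<Rightarrow> btree \<times> nat) set" where
  "primitive_tilings d = {u \<in> tilings d. \<forall>j. 0 < j \<and> j < d \<longrightarrow> (\<lambda>i. u (i + j)) \<noteq> u}"

lemma tilings_eq_UN_primitive:
  assumes "g \<ge> 1"
  shows "tilings g = (\<Union>d\<in>{d. d dvd g}. primitive_tilings d)"
proof (intro equalityI subsetI)
  fix u assume u: "u \<in> tilings g"
  define P where "P = (\<lambda>d. 0 < d \<and> (\<lambda>i. u (i + d)) = u)"
  define d where "d = (LEAST d. P d)"
  have Pg: "P g" using u assms by (auto simp: P_def tilings_def)
  have Pd: "P d" unfolding d_def by (rule LeastI[of P, OF Pg])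
  have least: "\<not> P j" if "j < d" for j using not_less_Least that unfolding d_def by blast
  have "P (gcd d g)"
  proof -
    have a: "u (i + d) = u i" for i using Pd fun_cong[of "\<lambda>i. u (i + d)" u i] by (simp add: P_def)
    have b: "u (i + g) = u i" for i using u by (simp add: tilings_def)
    show ?thesis using periodic_gcd[of u d g, OF a b] assms Pd by (auto simp: P_def fun_eq_iff)
  qed
  then have "gcd d g \<ge> d" using least by (meson not_le)
  moreover have "gcd d g \<le> d" using Pd by (intro gcd_le1_nat) (simp add: P_def)
  ultimately have "d dvd g" by (metis gcd_dvd2 le_antisym)
  moreover have "u \<in> primitive_tilings d"
    using u Pd least by (auto simp: primitive_tilings_def tilings_def P_def fun_eq_iff)
  ultimately show "u \<in> (\<Union>d\<in>{d. d dvd g}. primitive_tilings d)" by blast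
next
  fix u assume "u \<in> (\<Union>d\<in>{d. d dvd g}. primitive_tilings d)"
  then obtain d k where d: "g = d * k" "u \<in> tilings d" by (auto simp: primitive_tilings_def)
  then have "u (i + g) = u i" for i using periodic_mult[of u d i k] by (simp add: tilings_def)
  then show "u \<in> tilings g" using d(2) by (simp add: tilings_def)
qed

lemma primitive_disjoint:
  assumes "u \<in> primitive_tilings d" "u \<in> primitive_tilings e" "d \<ge> 1" "e \<ge> 1"
  shows "d = e"
proof -
  have "\<not> d < e" if "u \<in> primitive_tilings d" "u \<in> primitive_tilings e" "d \<ge> 1" for d e
  proof -
    have "(\<lambda>i. u (i + d)) = u" using that(1) by (auto simp: primitive_tilings_def tilings_def)
    then show ?thesis using that(2,3) by (auto simp: primitive_tilings_def)
  qed
  then show ?thesis using assms by (meson linorder_neqE_nat)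
qed

lemma finite_primitive: "d \<ge> 1 \<Longrightarrow> finite (primitive_tilings d)"
  using finite_subset[OF _ finite_tilings[of d]] by (auto simp: primitive_tilings_def)

lemma card_tilings_eq_sum_primitive:
  assumes "g \<ge> 1"
  shows "card (tilings g) = (\<Sum>d | d dvd g. card (primitive_tilings d))"
proof -
  have pos: "d \<ge> 1" if "d dvd g" for d using that assms by (cases d) auto
  show ?thesis unfolding tilings_eq_UN_primitive[OF assms]
  proof (rule card_UN_disjoint)
    show "finite {d. d dvd g}" using assms by simp
    show "\<forall>d\<in>{d. d dvd g}. finite (primitive_tilings d)" using pos finite_primitive by blast
    show "\<forall>d\<in>{d. d dvd g}. \<forall>e\<in>{d. d dvd g}. d \<noteq> e \<longrightarrow> primitive_tilings d \<inter> primitive_tilings e = {}"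
      using pos primitive_disjoint by blast
  qed
qed

text \<open>
  Both sides have the same sums over the divisors of every number.
\<close>

lemma a_num_primitive:
  "d \<ge> 1 \<Longrightarrow> of_nat d * a_num d = of_nat (card (primitive_tilings d))"
proof (induction d rule: less_induct)
  case (less d)
  have fin: "finite {e. e dvd d}" using less.prems by simp
  have "(\<Sum>e | e dvd d. of_nat e * a_num e) = (\<Sum>e | e dvd d. rat_of_nat (card (primitive_tilings e)))"
    using divisor_sum_a_num[OF less.prems] card_tilings_eq_sum_primitive[OF less.prems] by simp
  moreover have "(\<Sum>e\<in>{e. e dvd d} - {d}. of_nat e * a_num e) = (\<Sum>e\<in>{e. e dvd d} - {d}. rat_of_nat (card (primitive_tilings e)))"
  proof (intro sum.cong refl less.IH)
    fix e assume e: "e \<in> {e. e dvd d} - {d}"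
    then show "e < d" using less.prems dvd_imp_le[of e d] by auto
    show "e \<ge> 1" using e less.prems by (cases e) auto
  qed
  moreover have "d \<in> {e. e dvd d}" by simp
  ultimately show ?case
    using sum.remove[OF fin, of d "\<lambda>e. of_nat e * a_num e"] sum.remove[OF fin, of d "\<lambda>e. rat_of_nat (card (primitive_tilings e))"]
    by simp
qed

text \<open>
  The cyclic group of order \<open>d\<close> acts freely on the tilings with least period \<open>d\<close>.
\<close>

lemma dvd_card_primitive:
  assumes d: "d \<ge> 1"
  shows "d dvd card (primitive_tilings d)"
proof (rule equiv_imp_dvd_card[OF finite_primitive[OF d]])
  let ?s = "\<lambda>(s :: nat) u i. u (i + s) :: btree \<times> nat"
  define r where "r = {(u, v). u \<in> primitive_tilings d \<and> v \<in> primitive_tilings d \<and> (\<exists>s. v = ?s s u)}"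
  have per: "?s (s mod d) u = ?s s u" if "u \<in> tilings d" for s u
  proof
    fix i
    have "i + s = (i + s mod d) + d * (s div d)" by simp
    then show "?s (s mod d) u i = ?s s u i"
      using periodic_mult[of u d "i + s mod d" "s div d"] that by (simp only: tilings_def mem_Collect_eq)
  qed
  have inj: "s = t" if u: "u \<in> primitive_tilings d" and eq: "?s s u = ?s t u" "s < d" "t < d" for u s t
  proof -
    have "\<not> s < t" if "?s s u = ?s t u" "t < d" for s t
    proof
      assume "s < t"
      have "u (i + (t - s)) = u i" for i
      proof -
        have p: "u (i + d * s) = u i" for i using u by (intro periodic_mult) (simp add: primitive_tilings_def tilings_def)
        have "s \<le> d * s" using d by simp
        then have e: "i + (d * s - s) + s = i + d * s" "i + (d * s - s) + t = (i + (t - s)) + d * s"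
          using \<open>s < t\<close> by linarith+
        show ?thesis using fun_cong[OF that(1), of "i + (d * s - s)"] p[of i] p[of "i + (t - s)"] unfolding e by simp
      qed
      then have "(\<lambda>i. u (i + (t - s))) = u" by auto
      moreover have "0 < t - s" "t - s < d" using \<open>s < t\<close> that(2) by auto
      ultimately show False using u unfolding primitive_tilings_def by blast
    qed
    then show ?thesis using eq by (metis linorder_neqE_nat)
  qed
  have shift: "?s s u \<in> primitive_tilings d" if u: "u \<in> primitive_tilings d" for s u
  proof -
    have "?s s u \<in> tilings d" using u shift_tiling by (auto simp: primitive_tilings_def)
    moreover have "(\<lambda>i. ?s s u (i + j)) \<noteq> ?s s u" if j: "0 < j" "j < d" for j
    proof
      assume "(\<lambda>i. ?s s u (i + j)) = ?s s u"
      then have "?s ((s + j) mod d) u = ?s (s mod d) u"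
        using u per[of u] by (auto simp: primitive_tilings_def fun_eq_iff add.assoc add.commute[of j])
      then have "(s + j) mod d = s mod d" by (rule inj[OF u]) (use d in auto)
      then have "d * ((s + j) div d) + s mod d = d * (s div d) + s mod d + j"
        using mult_div_mod_eq[of d "s + j"] mult_div_mod_eq[of d s] by simp
      then have "j = d * ((s + j) div d) - d * (s div d)" by linarith
      then have "d dvd j" by (metis diff_mult_distrib2 dvd_triv_left)
      then show False using j by (auto dest: dvd_imp_le)
    qed
    ultimately show ?thesis by (simp add: primitive_tilings_def)
  qed
  have comp: "?s a (?s b u) = ?s (a + b) u" for a b u by (simp add: add.assoc)
  show "equiv (primitive_tilings d) r"
  proof (rule equivI)
    show "r \<subseteq> primitive_tilings d \<times> primitive_tilings d" by (auto simp: r_def)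
    show "refl_on (primitive_tilings d) r" by (auto simp: refl_on_def r_def intro!: exI[of _ 0])
    show "sym r"
    proof (rule symI)
      fix u v assume "(u, v) \<in> r"
      then obtain s where s: "u \<in> primitive_tilings d" "v \<in> primitive_tilings d" "v = ?s s u" by (auto simp: r_def)
      have "s \<le> d * s" using d by simp
      then have "?s (d * s - s) v = ?s (d * s) u" unfolding s(3) comp by simp
      also have "\<dots> = u" using periodic_mult[of u d _ s] s(1) by (auto simp: primitive_tilings_def tilings_def)
      finally have "u = ?s (d * s - s) v" by (rule sym)
      then show "(v, u) \<in> r" using s(1,2) unfolding r_def by blast
    qed
    show "trans r"
    proof (rule transI)
      fix u v w assume "(u, v) \<in> r" "(v, w) \<in> r"
      then obtain s t where st: "v = ?s s u" "w = ?s t v" "u \<in> primitive_tilings d" "w \<in> primitive_tilings d" by (auto simp: r_def)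
      then have "w = ?s (t + s) u" by (simp only: comp)
      then show "(u, w) \<in> r" using st by (auto simp: r_def)
    qed
  qed
  fix X assume "X \<in> primitive_tilings d // r"
  then obtain u where u: "u \<in> primitive_tilings d" "X = r `` {u}" by (auto elim: quotientE)
  have "X = (\<lambda>s. ?s s u) ` {..<d}"
  proof (intro equalityI subsetI)
    fix v assume "v \<in> X"
    then obtain s where "v = ?s s u" using u by (auto simp: r_def)
    then have "v = ?s (s mod d) u" using per[of u s] u(1) by (simp add: primitive_tilings_def)
    then show "v \<in> (\<lambda>s. ?s s u) ` {..<d}" using d by (intro image_eqI[of _ _ "s mod d"]) auto
  next
    fix v assume "v \<in> (\<lambda>s. ?s s u) ` {..<d}"
    then show "v \<in> X" using u shift by (auto simp: r_def)
  qed
  moreover have "inj_on (\<lambda>s. ?s s u) {..<d}" using inj[OF u(1)] by (auto intro!: inj_onI)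
  ultimately show "d dvd card X" by (simp add: card_image)
qed

lemma a_num_nat: assumes "d \<ge> 1" shows "of_nat (nat \<lfloor>a_num d\<rfloor>) = a_num d"
proof -
  obtain k where "card (primitive_tilings d) = d * k" using dvd_card_primitive[OF assms] by blast
  then have "a_num d = of_nat k" using a_num_primitive[OF assms] assms by simp
  then show ?thesis by simp
qed

section \<open>Characteristic polynomials and power sums\<close>

lemma sum_list_diag_mult:
  assumes A: "A \<in> carrier_mat n m" and B: "B \<in> carrier_mat m n"
  shows "sum_list (diag_mat (A * B)) = sum_list (diag_mat (B * A :: 'a :: comm_semiring_0 mat))"
proof -
  have "sum_list (diag_mat (A * B)) = (\<Sum>i<n. \<Sum>j<m. A $$ (i, j) * B $$ (j, i))"
    using A B by (simp add: diag_mat_def sum_list_sum_nth scalar_prod_def atLeast0LessThan)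
  also have "\<dots> = (\<Sum>j<m. \<Sum>i<n. B $$ (j, i) * A $$ (i, j))"
    by (subst sum.swap) (simp add: mult.commute)
  also have "\<dots> = sum_list (diag_mat (B * A))"
    using A B by (simp add: diag_mat_def sum_list_sum_nth scalar_prod_def atLeast0LessThan)
  finally show ?thesis .
qed

lemma upper_triangular_mult:
  assumes A: "A \<in> carrier_mat n n" "upper_triangular A" and B: "B \<in> carrier_mat n n" "upper_triangular B"
  shows "upper_triangular (A * B)" "i < n \<Longrightarrow> (A * B) $$ (i, i) = A $$ (i, i) * (B $$ (i, i) :: 'a :: semiring_0)"
proof -
  have e: "(A * B) $$ (i, j) = (\<Sum>l<n. A $$ (i, l) * B $$ (l, j))" if "i < n" "j < n" for i j
    using that A B by (simp add: scalar_prod_def atLeast0LessThan)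
  have a: "A $$ (i, l) = 0" if "l < i" "i < n" for i l using that A by auto
  have b: "B $$ (l, j) = 0" if "j < l" "l < n" for l j using that B by auto
  show "upper_triangular (A * B)"
  proof (rule upper_triangularI)
    fix i j assume ij: "j < i" "i < dim_row (A * B)"
    then have "i < n" using A by simp
    have "(\<Sum>l<n. A $$ (i, l) * B $$ (l, j)) = 0"
    proof (rule sum.neutral, rule ballI)
      fix l assume "l \<in> {..<n}"
      then show "A $$ (i, l) * B $$ (l, j) = 0" using a[of l i] b[of j l] ij \<open>i < n\<close> by (cases "l < i") auto
    qed
    then show "(A * B) $$ (i, j) = 0" using e[of i j] ij \<open>i < n\<close> by simp
  qed
  assume i: "i < n"
  have "(\<Sum>l<n. A $$ (i, l) * B $$ (l, i)) = (\<Sum>l<n. if l = i then A $$ (i, i) * B $$ (i, i) else 0)"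
  proof (intro sum.cong refl)
    fix l assume "l \<in> {..<n}"
    then show "A $$ (i, l) * B $$ (l, i) = (if l = i then A $$ (i, i) * B $$ (i, i) else 0)"
      using a[of l i] b[of i l] i by (cases l i rule: linorder_cases) auto
  qed
  then show "(A * B) $$ (i, i) = A $$ (i, i) * B $$ (i, i)" using e[of i i] i by simp
qed

lemma upper_triangular_pow:
  assumes A: "A \<in> carrier_mat n n" "upper_triangular (A :: 'a :: semiring_1 mat)"
  shows "upper_triangular (A ^\<^sub>m k) \<and> (\<forall>i<n. (A ^\<^sub>m k) $$ (i, i) = A $$ (i, i) ^ k)"
proof (induction k)
  case (Suc k)
  have "A ^\<^sub>m k \<in> carrier_mat n n" using A by simp
  from upper_triangular_mult[OF this _ A] Suc show ?case by (simp add: power_commutes)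
qed (use A in auto)

lemma trace_pow_eq_power_sum:
  fixes A :: "complex mat"
  assumes A: "A \<in> carrier_mat n n" and es: "char_poly A = (\<Prod>e\<leftarrow>es. [:- e, 1:])"
  shows "sum_list (diag_mat (A ^\<^sub>m k)) = (\<Sum>e\<leftarrow>es. e ^ k)"
proof -
  obtain B P Q where s: "schur_decomposition A es = (B, P, Q)" by (cases "schur_decomposition A es") auto
  from schur_decomposition[OF A es s]
  have wit: "similar_mat_wit A B P Q" and B: "upper_triangular B" "diag_mat B = es" by auto
  note c = similar_mat_witD2[OF A wit]
  have Bk: "B ^\<^sub>m k \<in> carrier_mat n n" using c by simp
  have "A ^\<^sub>m k = P * (B ^\<^sub>m k * Q)"
    using similar_mat_wit_pow_id[OF wit, of k] c Bk by (simp add: assoc_mult_mat[of _ n n _ n _ n])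
  then have "sum_list (diag_mat (A ^\<^sub>m k)) = sum_list (diag_mat (P * (B ^\<^sub>m k * Q)))" by (simp only:)
  also have "\<dots> = sum_list (diag_mat ((B ^\<^sub>m k * Q) * P))"
    by (rule sum_list_diag_mult[of _ n n]) (use c(6,7) Bk in auto)
  also have "(B ^\<^sub>m k * Q) * P = B ^\<^sub>m k"
    using c Bk by (simp add: assoc_mult_mat[of _ n n _ n _ n])
  also have "diag_mat (B ^\<^sub>m k) = map (\<lambda>e. e ^ k) (diag_mat B)"
    using c(5) upper_triangular_pow[OF c(5) B(1), of k] by (simp add: diag_mat_def)
  finally show ?thesis by (simp add: B(2))
qed

definition power_sum :: "complex poly \<Rightarrow> nat \<Rightarrow> complex" where
  "power_sum p k = (\<Sum>x\<in>#proots p. x ^ k)"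

lemma power_sum_mult: "p \<noteq> 0 \<Longrightarrow> q \<noteq> 0 \<Longrightarrow> power_sum (p * q) k = power_sum p k + power_sum q k"
  by (simp add: power_sum_def proots_mult)

lemma power_sum_power: "p \<noteq> 0 \<Longrightarrow> power_sum (p ^ m) k = of_nat m * power_sum p k"
  by (induction m) (simp_all add: power_sum_mult algebra_simps, simp add: power_sum_def)

lemma power_sum_prod: "finite I \<Longrightarrow> (\<And>i. i \<in> I \<Longrightarrow> f i \<noteq> 0) \<Longrightarrow> power_sum (\<Prod>i\<in>I. f i) k = (\<Sum>i\<in>I. power_sum (f i) k)"
  by (induction I rule: finite_induct) (simp_all add: power_sum_mult, simp add: power_sum_def)

lemma power_sum_linear_factors: "power_sum (\<Prod>e\<leftarrow>es. [:- e, 1:]) k = (\<Sum>e\<leftarrow>es. e ^ k)"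
proof (induction es)
  case (Cons e es)
  have "(\<Prod>e\<leftarrow>es. [:- e, 1:]) \<noteq> (0 :: complex poly)" by (auto simp: prod_list_zero_iff)
  then have "power_sum ([:- e, 1:] * (\<Prod>e\<leftarrow>es. [:- e, 1:])) k = power_sum [:- e, 1:] k + power_sum (\<Prod>e\<leftarrow>es. [:- e, 1:]) k"
    by (intro power_sum_mult) auto
  then show ?case using Cons by (simp add: power_sum_def)
qed (simp add: power_sum_def)

text \<open>
  The multiplicity of a root \<open>z\<close> is read off from the sum of \<open>f x\<close> over the roots \<open>x\<close>, where the
  polynomial \<open>f\<close> vanishes at all roots other than \<open>z\<close>; this sum is a combination of power sums.
\<close>

lemma power_sums_determine_poly:
  assumes "lead_coeff p = 1" "lead_coeff q = 1" "\<And>k. power_sum p k = power_sum q k"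
  shows "p = q"
proof -
  have lin: "(\<Sum>x\<in>#M. poly f x) = (\<Sum>i\<le>degree f. coeff f i * (\<Sum>x\<in>#M. x ^ i))" for f :: "complex poly" and M
    by (induction M) (simp_all add: poly_altdef sum.distrib algebra_simps)
  have eq: "(\<Sum>x\<in>#proots p. poly f x) = (\<Sum>x\<in>#proots q. poly f x)" for f
    unfolding lin using assms(3) by (simp add: power_sum_def)
  have "proots p = proots q"
  proof (rule multiset_eqI)
    fix z
    define S where "S = insert z (set_mset (proots p) \<union> set_mset (proots q))"
    define f where "f = (\<Prod>s\<in>S - {z}. [:- s, 1:])"
    have fS: "finite S" by (simp add: S_def)
    have fz: "poly f z \<noteq> 0" using fS by (simp add: f_def poly_prod)
    have f0: "poly f x = 0" if "x \<in> S" "x \<noteq> z" for x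
      using fS that by (auto simp: f_def poly_prod intro!: prod_zero)
    have "(\<Sum>x\<in>#M. poly f x) = of_nat (count M z) * poly f z" if "set_mset M \<subseteq> S" for M
      using that by (induction M) (auto simp: f0 algebra_simps)
    then have "of_nat (count (proots p) z) * poly f z = of_nat (count (proots q) z) * poly f z"
      using eq[of f] by (simp add: S_def subset_insertI2)
    then show "count (proots p) z = count (proots q) z" using fz by simp
  qed
  then show ?thesis
    using complex_poly_decompose_multiset[of p] complex_poly_decompose_multiset[of q] assms by simp
qed

lemma lead_coeff_monom_minus_1: "d \<ge> 1 \<Longrightarrow> lead_coeff (monom 1 d - 1 :: 'a :: comm_ring_1 poly) = 1"
proof -
  assume d: "d \<ge> 1"
  have "degree (monom 1 d - 1 :: 'a poly) = d"
  proof -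
    have "degree (monom 1 d + - 1 :: 'a poly) = degree (monom 1 d :: 'a poly)"
      by (rule degree_add_eq_left) (use d in \<open>simp add: degree_monom_eq\<close>)
    then show ?thesis by (simp add: degree_monom_eq)
  qed
  then show ?thesis using d by simp
qed

lemma monom_minus_1_nonzero: "d \<ge> 1 \<Longrightarrow> monom 1 d - 1 \<noteq> (0 :: 'a :: comm_ring_1 poly)"
  using lead_coeff_monom_minus_1[of d, where 'a = 'a] by (metis leading_coeff_0_iff zero_neq_one)

lemma power_sum_monom_minus_1:
  assumes d: "d \<ge> 1"
  shows "power_sum (monom 1 d - 1) k = (if d dvd k then of_nat d else 0)"
proof -
  let ?p = "monom 1 d - 1 :: complex poly"
  let ?R = "{z :: complex. z ^ d = 1}"
  have p0: "?p \<noteq> 0" by (rule monom_minus_1_nonzero[OF d])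
  have fin: "finite ?R" and card: "card ?R = d"
    using d by (auto intro: finite_roots_unity simp: card_roots_unity_eq)
  have sub: "mset_set ?R \<subseteq># proots ?p"
  proof (rule mset_subset_eqI)
    fix z
    show "count (mset_set ?R) z \<le> count (proots ?p) z"
    proof (cases "z \<in> ?R")
      case True
      then have "poly ?p z = 0" by (simp add: poly_monom)
      then have "z \<in># proots ?p" using p0 by simp
      then show ?thesis using True fin by (simp add: Suc_le_eq del: count_proots set_count_proots)
    qed simp
  qed
  have "degree ?p = d"
  proof -
    have "degree (monom 1 d + - 1 :: complex poly) = degree (monom 1 d :: complex poly)"
      by (rule degree_add_eq_left) (use d in \<open>simp add: degree_monom_eq\<close>)
    then show ?thesis by (simp add: degree_monom_eq)
  qed
  then have "size (proots ?p) \<le> size (mset_set ?R)" using size_proots_le[of ?p] card by simp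
  with sub have "proots ?p = mset_set ?R" by (metis leD mset_subset_size subset_mset.le_imp_less_or_eq)
  then have "power_sum ?p k = (\<Sum>z\<in>?R. z ^ k)" by (simp add: power_sum_def sum_unfold_sum_mset)
  also have "\<dots> = (\<Sum>j<d. cis (2 * pi * real j / real d) ^ k)"
    using d by (intro sum.reindex_bij_betw[symmetric] bij_betw_roots_unity) simp
  also have "\<dots> = (\<Sum>j<d. cis (2 * pi * real k / real d) ^ j)"
    by (intro sum.cong refl) (simp add: DeMoivre mult_ac)
  also have "\<dots> = (if d dvd k then of_nat d else 0)"
  proof (cases "d dvd k")
    case True
    then obtain l where "k = d * l" by auto
    then have "cis (2 * pi * real k / real d) = cis (2 * pi * real l)" using d by (simp add: field_simps)
    also have "\<dots> = 1" by (metis cis_multiple_2pi Ints_of_nat)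
    finally show ?thesis using True by simp
  next
    case False
    let ?w = "cis (2 * pi * real k / real d)"
    have "?w \<noteq> 1"
    proof
      assume "?w = 1"
      then have "cos (2 * pi * real k / real d) = 1" by (simp add: complex_eq_iff)
      then obtain x :: int where "2 * pi * real k / real d = of_int x * 2 * pi" using cos_one_2pi_int by blast
      then have "real k = of_int x * real d" using d by (simp add: field_simps)
      then have "int k = x * int d" by (metis of_int_eq_iff of_int_mult of_int_of_nat_eq)
      then have "int d dvd int k" by simp
      then show False using False by simp
    qed
    moreover have "?w ^ d = 1" using d by (simp add: DeMoivre)
    ultimately show ?thesis using False by (simp add: geometric_sum)
  qed
  finally show ?thesis .
qed

interpretation of_rat_poly_hom: map_poly_inj_idom_hom "of_rat :: rat \<Rightarrow> complex" ..

text \<open>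
  The traces are those of a virtual permutation module, \<open>c\<close> copies of a cycle of length \<open>n\<close> minus
  \<open>a d\<close> cycles of length \<open>d\<close>, and \<open>x\<^sup>d - 1\<close> is the characteristic polynomial of such a
  cycle. Over the complex numbers both sides have the same power sums of roots.
\<close>

lemma char_poly_eq_of_traces:
  fixes A :: "rat mat"
  assumes A: "A \<in> carrier_mat N N" and n: "n \<ge> 1"
    and tr: "\<And>k. sum_list (diag_mat (A ^\<^sub>m k)) = of_nat c * (if n dvd k then of_nat n else 0) -
       (\<Sum>d | d dvd n. of_nat (a d) * (if d dvd k then of_nat d else 0))"
  shows "char_poly A * (\<Prod>d | d dvd n. (monom 1 d - 1) ^ a d) = (monom 1 n - 1) ^ c"
proof -
  let ?h = "of_rat :: rat \<Rightarrow> complex"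
  let ?A = "map_mat ?h A"
  have A': "?A \<in> carrier_mat N N" using A by simp
  have fin: "finite {d. d dvd n}" using n by simp
  have pos: "d \<ge> 1" if "d \<in> {d. d dvd n}" for d using that n by (cases d) auto
  obtain es where es: "char_poly ?A = (\<Prod>e\<leftarrow>es. [:- e, 1:])" using char_poly_factorized[OF A'] by blast
  have tr': "power_sum (char_poly ?A) k = ?h (sum_list (diag_mat (A ^\<^sub>m k)))" for k
  proof -
    have "power_sum (char_poly ?A) k = sum_list (diag_mat (?A ^\<^sub>m k))"
      unfolding trace_pow_eq_power_sum[OF A' es] unfolding es by (rule power_sum_linear_factors)
    also have "?A ^\<^sub>m k = map_mat ?h (A ^\<^sub>m k)" by (rule of_rat_hom.mat_hom_pow[OF A, symmetric])
    also have "sum_list (diag_mat (map_mat ?h (A ^\<^sub>m k))) = ?h (sum_list (diag_mat (A ^\<^sub>m k)))"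
    proof -
      have eq: "map (\<lambda>i. map_mat ?h (A ^\<^sub>m k) $$ (i, i)) [0..<N] = map (\<lambda>i. ?h ((A ^\<^sub>m k) $$ (i, i))) [0..<N]"
        by (rule map_cong[OF refl]) (use A in auto)
      have dims: "dim_row (map_mat ?h (A ^\<^sub>m k)) = N" "dim_row (A ^\<^sub>m k) = N" using A by simp_all
      show ?thesis unfolding diag_mat_def dims eq of_rat_hom.hom_sum_list by (simp add: comp_def)
    qed
    finally show ?thesis .
  qed
  let ?P = "\<Prod>d | d dvd n. (monom 1 d - 1 :: complex poly) ^ a d"
  have lcA: "lead_coeff (char_poly ?A) = 1" using degree_monic_char_poly[OF A'] by simp
  have lcP: "lead_coeff ?P = 1"
    unfolding lead_coeff_prod
  proof (rule prod.neutral, rule ballI)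
    fix d assume "d \<in> {d. d dvd n}"
    then show "lead_coeff ((monom 1 d - 1 :: complex poly) ^ a d) = 1"
      by (simp only: lead_coeff_power lead_coeff_monom_minus_1[OF pos] power_one)
  qed
  have nzA: "char_poly ?A \<noteq> 0" and nzP: "?P \<noteq> 0" using lcA lcP by (metis leading_coeff_0_iff zero_neq_one)+
  have "char_poly ?A * ?P = (monom 1 n - 1) ^ c"
  proof (rule power_sums_determine_poly)
    show "lead_coeff (char_poly ?A * ?P) = 1" using lcA lcP by (simp add: lead_coeff_mult)
    show "lead_coeff ((monom 1 n - 1 :: complex poly) ^ c) = 1"
      by (simp only: lead_coeff_power lead_coeff_monom_minus_1[OF n] power_one)
    fix k
    have "power_sum ?P k = (\<Sum>d | d dvd n. of_nat (a d) * (if d dvd k then of_nat d else 0))"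
      using fin pos monom_minus_1_nonzero
      by (subst power_sum_prod) (auto simp: power_sum_power power_sum_monom_minus_1 intro!: sum.cong)
    also have "\<dots> = ?h (\<Sum>d | d dvd n. of_nat (a d) * (if d dvd k then of_nat d else 0))"
      by (auto simp: of_rat_sum of_rat_mult intro!: sum.cong)
    finally have "power_sum (char_poly ?A * ?P) k = ?h (of_nat c * (if n dvd k then of_nat n else 0))"
      unfolding power_sum_mult[OF nzA nzP] tr' tr of_rat_diff by simp
    moreover have "power_sum ((monom 1 n - 1) ^ c) k = of_nat c * (if n dvd k then of_nat n else 0)"
      by (simp only: power_sum_power[OF monom_minus_1_nonzero[OF n]] power_sum_monom_minus_1[OF n])
    ultimately show "power_sum (char_poly ?A * ?P) k = power_sum ((monom 1 n - 1) ^ c) k"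
      by (simp add: of_rat_mult)
  qed
  then have "map_poly ?h (char_poly A) * ?P = (monom 1 n - 1) ^ c"
    unfolding of_rat_hom.char_poly_hom[OF A] .
  then have "map_poly ?h (char_poly A * (\<Prod>d | d dvd n. (monom 1 d - 1) ^ a d)) = map_poly ?h ((monom 1 n - 1) ^ c)"
    by (simp add: of_rat_poly_hom.hom_mult of_rat_poly_hom.hom_prod of_rat_poly_hom.hom_power of_rat_poly_hom.hom_minus map_poly_monom)
  then show ?thesis by (rule of_rat_poly_hom.injectivity)
qed

section \<open>The character and the characteristic polynomial\<close>

lemma sum_chi:
  assumes "n \<ge> 1"
  shows "(\<Sum>d | d dvd n. a_num d * chi n d k) = of_nat (card (tilings (gcd k n)))"
proof -
  have "(\<Sum>d | d dvd n. a_num d * chi n d k) = (\<Sum>d | d dvd n \<and> d dvd k. of_nat d * a_num d)"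
    using assms by (intro sum.mono_neutral_cong_right) (auto simp: chi_def)
  also have "{d. d dvd n \<and> d dvd k} = {d. d dvd gcd k n}" by auto
  also have "(\<Sum>d | d dvd gcd k n. of_nat d * a_num d) = of_nat (card (tilings (gcd k n)))"
    by (rule divisor_sum_a_num) (use assms in \<open>simp add: Suc_le_eq\<close>)
  finally show ?thesis .
qed

lemma trace_formula:
  assumes n: "n \<ge> 2" and ac: "anticyclic_structure \<tau>"
  shows "trace_on dend_scale (Dend (n - 1)) (\<tau> ^^ k) =
     2 * of_nat (catalan (n - 1)) * chi n n k - (\<Sum>d | d dvd n. a_num d * chi n d k)"
proof (cases "n dvd k")
  case True
  have c: "catalan (n - 1) = card (btrees n)" using n by (simp add: catalan_eq_num_trees num_trees_def)
  have "gcd k n = n" using True by (simp add: gcd_nat.absorb2)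
  then have "(\<Sum>d | d dvd n. a_num d * chi n d k) = of_nat ((2 * n - 1) * card (btrees n))"
    using sum_chi[of n k] card_tilings_btrees[of n] n by simp
  moreover have "rat_of_nat ((2 * n - 1) * card (btrees n)) = 2 * of_nat (card (btrees n)) * of_nat n - of_nat (card (btrees n))"
    using n by (simp add: of_nat_diff algebra_simps)
  ultimately show ?thesis using trace_identity[OF ac n True] True by (simp add: c[unfolded One_nat_def] chi_def)
next
  case False
  then show ?thesis using trace_nonidentity[OF ac n False] sum_chi[of n k] n by (simp add: chi_def)
qed

theorem theorem3p4:
  fixes n :: nat and \<tau> :: "dend \<Rightarrow> dend"
  assumes "n \<ge> 2"
    and "anticyclic_structure \<tau>"
  shows "(\<forall>k::nat. trace_on dend_scale (Dend (n - 1)) (\<tau> ^^ k) =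
            2 * of_nat (catalan (n - 1)) * chi n n k - (\<Sum>d | d dvd n. a_num d * chi n d k))
       \<and> Fract (charpoly_on dend_scale (Dend (n - 1)) \<tau>) 1 =
           Fract ((monom 1 n - 1) ^ (2 * catalan (n - 1)))
                 (\<Prod>d | d dvd n. (monom 1 d - 1) ^ nat \<lfloor>a_num d\<rfloor>)"
proof
  note n = assms(1) and ac = assms(2)
  show "\<forall>k::nat. trace_on dend_scale (Dend (n - 1)) (\<tau> ^^ k) =
            2 * of_nat (catalan (n - 1)) * chi n n k - (\<Sum>d | d dvd n. a_num d * chi n d k)"
    using trace_formula[OF n ac] by blast
  define bs where "bs = (SOME bs. ordered_basis dend_scale (Dend (n - 1)) bs)"
  have bs: "distinct bs" "dend.independent (set bs)" "dend.span (set bs) = Dend (n - 1)"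
    unfolding bs_def
    by (rule dend.ordered_basis_some[OF finite_imageI[OF finite_btrees] nf_basis_n(2,3)[OF ac n]])+
  define A where "A = endo_matrix dend_scale bs \<tau>"
  have A: "A \<in> carrier_mat (length bs) (length bs)" by (simp add: A_def endo_matrix_def)
  have pos: "d \<ge> 1" if "d dvd n" for d using that n by (cases d) auto
  have "char_poly A * (\<Prod>d | d dvd n. (monom 1 d - 1) ^ nat \<lfloor>a_num d\<rfloor>) = (monom 1 n - 1) ^ (2 * catalan (n - 1))"
  proof (rule char_poly_eq_of_traces[OF A])
    fix k
    have "A ^\<^sub>m k = endo_matrix dend_scale bs (\<tau> ^^ k)"
      unfolding A_def
      by (rule dend.endo_matrix_pow[OF bs tau_linear[OF ac], symmetric]) (use tau_Dend[OF ac] n in auto)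
    then have "sum_list (diag_mat (A ^\<^sub>m k)) = trace_on dend_scale (Dend (n - 1)) (\<tau> ^^ k)"
      by (simp add: trace_on_def bs_def)
    also have "\<dots> = of_nat (2 * catalan (n - 1)) * (if n dvd k then of_nat n else 0) -
       (\<Sum>d | d dvd n. of_nat (nat \<lfloor>a_num d\<rfloor>) * (if d dvd k then of_nat d else 0))"
      unfolding trace_formula[OF n ac] using a_num_nat pos
      by (intro arg_cong2[of _ _ _ _ "(-)"] sum.cong) (auto simp: chi_def)
    finally show "sum_list (diag_mat (A ^\<^sub>m k)) = of_nat (2 * catalan (n - 1)) * (if n dvd k then of_nat n else 0) -
       (\<Sum>d | d dvd n. of_nat (nat \<lfloor>a_num d\<rfloor>) * (if d dvd k then of_nat d else 0))" .
  qed (use n in simp)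
  moreover have "(\<Prod>d | d dvd n. (monom 1 d - 1 :: rat poly) ^ nat \<lfloor>a_num d\<rfloor>) \<noteq> 0"
    using n pos monom_minus_1_nonzero by (subst prod_zero_iff) auto
  ultimately show "Fract (charpoly_on dend_scale (Dend (n - 1)) \<tau>) 1 =
           Fract ((monom 1 n - 1) ^ (2 * catalan (n - 1)))
                 (\<Prod>d | d dvd n. (monom 1 d - 1) ^ nat \<lfloor>a_num d\<rfloor>)"
    by (simp add: eq_fract charpoly_on_def A_def bs_def)
qed

end
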